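(* Let $n\ge 1$ be an integer, $0<s<1$, and let $\Omega_\infty=\mathbb{R}^{n-1}\times(-1,1)\subset\mathbb{R}^n$. Then the following statements hold: (1) If $0<s\le \frac12$, then $P^1_{n,s}(\Omega_\infty)=P^1_{1,s}((-1,1))=0$. (2) If $\frac12<s<1$, then $P^1_{n,s}(\Omega_\infty)>0$; more precisely, $P^1_{n,s}(\Omega_\infty)=P^1_{1,s}((-1,1))$.
   Context: For an integer $n\ge1$ and $0<s<1$ set $C_{n,s}=\dfrac{s\,2^{2s}\,\Gamma\left(\frac{n+2s}{2}\right)}{\pi^{n/2}\,\Gamma(1-s)}$. For an open set $\Omega\subset\mathbb{R}^n$ let $[u]_{s,2,\Omega}=\left(\frac{C_{n,s}}{2}\int_\Omega\int_\Omega\frac{|u(x)-u(y)|^2}{|x-y|^{n+2s}}\,dx\,dy\right)^{1/2}$, let $W^{s,2}(\Omega)$ be the space of $u\in L^2(\Omega)$ with $[u]_{s,2,\Omega}<\infty$, with norm $\left(\|u\|_{L^2(\Omega)}^2+[u]_{s,2,\Omega}^2\right)^{1/2}$, and let $W^{s,2}_0(\Omega)$ be the closure of $C_c^\infty(\Omega)$ in this norm. Define the (regional) fractional Poincaré constant $$P^1_{n,s}(\Omega)=\inf_{u\in W^{s,2}_0(\Omega),\,u\ne0}\frac{[u]_{s,2,\Omega}^2}{\int_\Omega u^2}.$$ *)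

theory Defs
  imports "HOL-Analysis.Analysis"
begin

definition frac_const :: "nat \<Rightarrow> real \<Rightarrow> real" where
  "frac_const n s =
     s * 2 powr (2 * s) * Gamma ((real n + 2 * s) / 2) / (pi powr (real n / 2) * Gamma (1 - s))"

(* A function is an element of L^2(\<Omega>) through its values on \<Omega> only; functions that agree
   almost everywhere on \<Omega> are not identified.  On the diagonal x = y the integrand is 0 / 0 = 0,
   which is harmless, the diagonal being a null set. *)
definition gagliardo_integral :: "real \<Rightarrow> 'a::euclidean_space set \<Rightarrow> ('a \<Rightarrow> real) \<Rightarrow> ennreal" where
  "gagliardo_integral s \<Omega> u =
     (\<integral>\<^sup>+ x. (\<integral>\<^sup>+ y. ennreal (\<bar>u x - u y\<bar>\<^sup>2 / norm (x - y) powr (real DIM('a) + 2 * s))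
        \<partial>lebesgue_on \<Omega>) \<partial>lebesgue_on \<Omega>)"

definition L2_norm_on :: "'a::euclidean_space set \<Rightarrow> ('a \<Rightarrow> real) \<Rightarrow> real" where
  "L2_norm_on \<Omega> u = sqrt (LINT x|lebesgue_on \<Omega>. (u x)\<^sup>2)"

(* Meaningful when the Gagliardo integral is finite, i.e. on sobolev_space below. *)
definition frac_seminorm :: "real \<Rightarrow> 'a::euclidean_space set \<Rightarrow> ('a \<Rightarrow> real) \<Rightarrow> real" where
  "frac_seminorm s \<Omega> u =
     sqrt (frac_const DIM('a) s / 2 * enn2real (gagliardo_integral s \<Omega> u))"

definition sobolev_space :: "real \<Rightarrow> 'a::euclidean_space set \<Rightarrow> ('a \<Rightarrow> real) set" where
  "sobolev_space s \<Omega> =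
     {u. u \<in> borel_measurable (lebesgue_on \<Omega>) \<and> integrable (lebesgue_on \<Omega>) (\<lambda>x. (u x)\<^sup>2) \<and>
         gagliardo_integral s \<Omega> u < \<infinity>}"

definition sobolev_norm :: "real \<Rightarrow> 'a::euclidean_space set \<Rightarrow> ('a \<Rightarrow> real) \<Rightarrow> real" where
  "sobolev_norm s \<Omega> u = sqrt ((L2_norm_on \<Omega> u)\<^sup>2 + (frac_seminorm s \<Omega> u)\<^sup>2)"

primrec C_diff :: "nat \<Rightarrow> ('a::euclidean_space \<Rightarrow> real) \<Rightarrow> bool" where
  "C_diff 0 f \<longleftrightarrow> continuous_on UNIV f"
| "C_diff (Suc m) f \<longleftrightarrow>
     (\<forall>x. f differentiable (at x)) \<and> (\<forall>b\<in>Basis. C_diff m (\<lambda>x. frechet_derivative f (at x) b))"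

(* Test functions on \<Omega>, extended by zero to the whole space. *)
definition test_functions :: "'a::euclidean_space set \<Rightarrow> ('a \<Rightarrow> real) set" where
  "test_functions \<Omega> =
     {\<phi>. (\<forall>m. C_diff m \<phi>) \<and> compact (closure {x. \<phi> x \<noteq> 0}) \<and> closure {x. \<phi> x \<noteq> 0} \<subseteq> \<Omega>}"

(* The closure of the test functions within sobolev_space. *)
definition sobolev_space_0 :: "real \<Rightarrow> 'a::euclidean_space set \<Rightarrow> ('a \<Rightarrow> real) set" where
  "sobolev_space_0 s \<Omega> =
     {u \<in> sobolev_space s \<Omega>.
        \<forall>\<epsilon>>0. \<exists>\<phi>\<in>test_functions \<Omega> \<inter> sobolev_space s \<Omega>. sobolev_norm s \<Omega> (\<lambda>x. u x - \<phi> x) < \<epsilon>}"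

(* The condition u \<noteq> 0 is meant in L^2(\<Omega>): u does not vanish almost everywhere on \<Omega>. *)
definition poincare_const :: "real \<Rightarrow> 'a::euclidean_space set \<Rightarrow> real" where
  "poincare_const s \<Omega> =
     Inf {(frac_seminorm s \<Omega> u)\<^sup>2 / (LINT x|lebesgue_on \<Omega>. (u x)\<^sup>2) |u.
            u \<in> sobolev_space_0 s \<Omega> \<and> \<not> (AE x in lebesgue_on \<Omega>. u x = 0)}"

(* R^(n-1) x (-1,1), where the bounded coordinate may be any coordinate k. *)
definition strip :: "'n::finite \<Rightarrow> (real ^ 'n) set" where
  "strip k = {x. x $ k \<in> {-1<..<1}}"

end

(*
  Write x = a + t e with a orthogonal to the bounded direction e.  For a test function u on the strip
  let U(t) be the L^2 norm of the slice u(., t).  Integrating the kernel over the orthogonal directions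
  turns the n-dimensional kernel into the one-dimensional one, with a factor equal to the quotient of
  the two normalising constants, and the reverse triangle inequality in L^2 for the slices gives
  [U] <= [u] while U and u have the same L^2 norm.  Conversely, phi(t) psi(a / R) with a
  fixed cutoff psi has, as R tends to infinity, the Rayleigh quotient of phi.  So the two constants
  agree.  On the interval, for s > 1/2 the inequality follows by comparing the mean squares over the
  intervals (-1, -1 + 2^(-j)) for consecutive j, and for s <= 1/2 convex combinations of cutoffs with uniformly bounded
  energy tend to 1 and have energy tending to 0.
*)
theory Submission
  imports Defs "HOL-Probability.Distributions"
begin

subsection \<open>Smooth functions\<close>

text \<open>Both constants are determined by test functions alone, because quadratic inequalities
  pass to the closure; each comparison is therefore one for smooth functions. The slice norm U need
  not be smooth where it vanishes, so sqrt(c^2 + U^2) - c replaces it: as a map of U this is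
  1-Lipschitz, so the energy does not grow, and it fixes 0, so the support stays compact. Since R^n
  is not given as a product, the orthogonal directions carry an auxiliary measure on the whole
  space, handled through Tonelli, translations and Gaussian integrals. In the converse direction the
  squared difference of cutoffs is bounded by a multiple of |z|^(1+s) and not of |z|^2: against the
  kernel, |z|^2 is not integrable over the orthogonal directions when s \<le> 1/2 and n > 1. The
  split at s = 1/2 is a matter of scaling: the recursion over halved intervals has the factor
  2^(1-2s), below 1 only for s > 1/2, while at s = 1/2 transition layers of width d yield a bound
  independent of d instead of a small one, so that smallness has to come from convexity.\<close>

lemma C_diff_SucI:
  assumes "\<And>x. (f has_derivative f' x) (at x)" "\<And>b. b \<in> Basis \<Longrightarrow> C_diff m (\<lambda>x. f' x b)"
  shows "C_diff (Suc m) f"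
proof -
  have "frechet_derivative f (at x) = f' x" for x
    using assms(1) by (metis frechet_derivative_at)
  then show ?thesis
    using assms by (auto simp: differentiable_def)
qed

lemma C_diff_SucD:
  assumes "C_diff (Suc m) f"
  shows "(f has_derivative frechet_derivative f (at x)) (at x)"
    and "b \<in> Basis \<Longrightarrow> C_diff m (\<lambda>x. frechet_derivative f (at x) b)"
  using assms by (auto simp: frechet_derivative_works)

lemma C_diff_continuous:
  assumes "C_diff m f"
  shows "continuous_on UNIV f"
  using assms by (cases m) (auto intro!: differentiable_imp_continuous_on simp: differentiable_on_def differentiable_at_withinI)

text \<open>The product rule mixes a function with derivatives of the other factor, so regularity
  has to be lowered by one level; at level 0 this is continuity of differentiable functions.\<close>

lemma C_diff_Suc_imp: "C_diff (Suc m) f \<Longrightarrow> C_diff m f"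
proof (induction m arbitrary: f)
  case 0
  show ?case using C_diff_continuous[OF "0.prems"] by simp
next
  case (Suc m)
  then show ?case
    by (metis C_diff.simps(2))
qed

lemma C_diff_const: "C_diff m (\<lambda>x. c)"
proof (induction m arbitrary: c)
  case (Suc m)
  then show ?case by (intro C_diff_SucI[where f'="\<lambda>_ _. 0"]) auto
qed auto

lemma C_diff_add: "C_diff m f \<Longrightarrow> C_diff m g \<Longrightarrow> C_diff m (\<lambda>x. f x + g x)"
proof (induction m arbitrary: f g)
  case (Suc m)
  note D = C_diff_SucD[OF Suc.prems(1)] C_diff_SucD[OF Suc.prems(2)]
  show ?case
    by (rule C_diff_SucI[OF has_derivative_add[OF D(1) D(3)]]) (use Suc.IH D in auto)
qed (auto intro: continuous_intros)

lemma C_diff_mult: "C_diff m f \<Longrightarrow> C_diff m g \<Longrightarrow> C_diff m (\<lambda>x. f x * g x)"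
proof (induction m arbitrary: f g)
  case (Suc m)
  note D = C_diff_SucD[OF Suc.prems(1)] C_diff_SucD[OF Suc.prems(2)]
  show ?case
    by (rule C_diff_SucI[OF has_derivative_mult[OF D(1) D(3)]])
      (intro C_diff_add Suc.IH D C_diff_Suc_imp[OF Suc.prems(1)] C_diff_Suc_imp[OF Suc.prems(2)]; assumption)
qed (auto intro: continuous_intros)

lemma C_diff_cmult: "C_diff m f \<Longrightarrow> C_diff m (\<lambda>x. c * f x)"
  using C_diff_mult[OF C_diff_const] .

lemma C_diff_diff: "C_diff m f \<Longrightarrow> C_diff m g \<Longrightarrow> C_diff m (\<lambda>x. f x - g x)"
  using C_diff_add[OF _ C_diff_cmult[of m g "-1"], of f] by simp

lemma C_diff_prod:
  "(\<And>i. i \<in> I \<Longrightarrow> C_diff m (f i)) \<Longrightarrow> C_diff m (\<lambda>x. \<Prod>i\<in>I. f i x)"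
  by (induction I rule: infinite_finite_induct) (auto intro: C_diff_const C_diff_mult)

lemma C_diff_comp_affine:
  fixes g :: "real \<Rightarrow> real"
  shows "C_diff m g \<Longrightarrow> C_diff m (\<lambda>x. g (x \<bullet> v + d))"
proof (induction m arbitrary: g)
  case 0
  then show ?case
    by (auto intro!: continuous_on_compose2[of UNIV g] continuous_intros)
next
  case (Suc m)
  note D = C_diff_SucD[OF Suc.prems]
  let ?g' = "\<lambda>y. frechet_derivative g (at y) 1"
  have lin: "frechet_derivative g (at y) h = h * ?g' y" for y h
    using linear_scale[OF linear_frechet_derivative, of g "at y" h 1] Suc.prems by simp
  have der: "((\<lambda>x. g (x \<bullet> v + d)) has_derivative (\<lambda>h. (h \<bullet> v) * ?g' (x \<bullet> v + d))) (at x)" for x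
  proof -
    have "((\<lambda>x. g (x \<bullet> v + d)) has_derivative (\<lambda>h. frechet_derivative g (at (x \<bullet> v + d)) (h \<bullet> v))) (at x)"
      by (rule has_derivative_compose[OF _ D(1)]) (auto intro!: derivative_eq_intros)
    then show ?thesis by (subst (asm) lin)
  qed
  show ?case
    by (rule C_diff_SucI[OF der]) (auto intro!: C_diff_cmult Suc.IH[OF D(2)])
qed

lemma C_diff_SucI_real:
  fixes f :: "real \<Rightarrow> real"
  assumes "\<And>x. (f has_real_derivative f' x) (at x)" "C_diff m f'"
  shows "C_diff (Suc m) f"
  by (rule C_diff_SucI[of f "\<lambda>x h. f' x * h"]) (use assms in \<open>auto simp: has_field_derivative_def\<close>)

text \<open>Meant for functions whose derivative is a smooth expression in the function itself, such
  as 1/f and 1/sqrt G: regularity of order m passes to the derivative and so becomes order m +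
  1.\<close>

lemma C_diff_bootstrap:
  fixes f :: "real \<Rightarrow> real"
  assumes "\<And>x. (f has_real_derivative f' x) (at x)" "\<And>m. C_diff m f \<Longrightarrow> C_diff m f'"
  shows "C_diff m f"
proof (induction m)
  case 0
  have "continuous_on UNIV f"
    using assms(1) by (meson DERIV_isCont continuous_at_imp_continuous_on)
  then show ?case by simp
next
  case (Suc m)
  then show ?case using C_diff_SucI_real assms by blast
qed

lemma C_diff_real_derivative:
  fixes f :: "real \<Rightarrow> real"
  assumes "\<And>m. C_diff m f"
  obtains f' where "\<And>x. (f has_real_derivative f' x) (at x)" "\<And>m. C_diff m f'"
proof -
  define f' where "f' x = frechet_derivative f (at x) 1" for x
  have sm: "C_diff m f'" for m
    unfolding f'_def using C_diff_SucD(2)[OF assms(1)[of "Suc m"], of 1] by simp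
  have der: "(f has_real_derivative f' x) (at x)" for x
  proof -
    have "frechet_derivative f (at x) h = f' x * h" for h
      using linear_scale[OF linear_frechet_derivative, of f "at x" h 1] assms(1)[of "Suc 0"]
      by (simp add: f'_def)
    then show ?thesis
      using C_diff_SucD(1)[OF assms(1)[of "Suc 0"], of x] unfolding has_field_derivative_def by (metis ext)
  qed
  show ?thesis
    using der sm by (rule that)
qed

lemma C_diff_inverse:
  fixes f :: "real \<Rightarrow> real"
  assumes "\<And>m. C_diff m f" "\<And>x. f x \<noteq> 0"
  shows "C_diff m (\<lambda>x. inverse (f x))"
proof -
  obtain f' where der: "\<And>x. (f has_real_derivative f' x) (at x)" and sm: "\<And>m. C_diff m f'"
    using C_diff_real_derivative[OF assms(1)] by blast
  show ?thesis
  proof (rule C_diff_bootstrap)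
    \<comment> \<open>Written as a product of \<open>f'\<close> with powers of 1/f, so that closure
      under products gives the regularity of the derivative from that of 1/f.\<close>
    show "((\<lambda>x. inverse (f x)) has_real_derivative (-1) * (f' x * (inverse (f x) * inverse (f x)))) (at x)" for x
      by (rule derivative_eq_intros der assms refl)+ (simp add: )
  qed (intro C_diff_cmult C_diff_mult sm)
qed

section \<open>The flat function exp(-1/x) and the smooth step\<close>

text \<open>The index n closes the family under differentiation, so that smoothness is an induction
  over all n at once; n = 0 is the usual flat function exp(-1/x).\<close>

definition exp_inv :: "nat \<Rightarrow> real \<Rightarrow> real" where
  "exp_inv n x = (if x > 0 then exp (- inverse x) / x ^ n else 0)"

lemma exp_inv_deriv:
  "(exp_inv n has_real_derivative exp_inv (n + 2) x - real n * exp_inv (n + 1) x) (at x)"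
proof -
  consider "x > 0" | "x < 0" | "x = 0" by linarith
  then show ?thesis
  proof cases
    case 1
    have "((\<lambda>x. exp (- inverse x) * inverse x ^ n) has_real_derivative
        exp (- inverse x) * inverse x ^ (n + 2) - real n * (exp (- inverse x) * inverse x ^ (n + 1))) (at x)"
    proof (rule DERIV_cong)
      show "((\<lambda>x. exp (- inverse x) * inverse x ^ n) has_real_derivative
          exp (- inverse x) * (real n * (inverse x ^ (n - 1) * - (inverse x ^ 2)))
          + exp (- inverse x) * inverse x ^ 2 * inverse x ^ n) (at x)"
        using 1 by (auto intro!: derivative_eq_intros simp: power2_eq_square)
      have "real n * (inverse x ^ (n - 1) * inverse x ^ 2) = real n * inverse x ^ (n + 1)"
        by (cases n) (auto simp: power2_eq_square)
      then show "exp (- inverse x) * (real n * (inverse x ^ (n - 1) * - (inverse x ^ 2)))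
          + exp (- inverse x) * inverse x ^ 2 * inverse x ^ n
          = exp (- inverse x) * inverse x ^ (n + 2) - real n * (exp (- inverse x) * inverse x ^ (n + 1))"
        by (auto simp: algebra_simps power2_eq_square)
    qed
    then have "((\<lambda>x. exp (- inverse x) / x ^ n) has_real_derivative exp_inv (n + 2) x - real n * exp_inv (n + 1) x) (at x)"
      using 1 by (simp add: exp_inv_def divide_inverse power_inverse)
    then show ?thesis
      by (rule has_field_derivative_transform_within_open[of _ _ _ "{0<..}"]) (use 1 in \<open>auto simp: exp_inv_def\<close>)
  next
    case 2
    have "((\<lambda>x. 0) has_real_derivative exp_inv (n + 2) x - real n * exp_inv (n + 1) x) (at x)"
      using 2 by (auto simp: exp_inv_def)
    then show ?thesis
      by (rule has_field_derivative_transform_within_open[of _ _ _ "{..<0}"]) (use 2 in \<open>auto simp: exp_inv_def\<close>)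
  next
    case 3
    \<comment> \<open>From the right the difference quotient at 0 becomes z^(n+1) / exp z with z =
      1/y, and the exponential wins; from the left it is 0.\<close>
    have "((\<lambda>y. exp_inv n y / y) \<longlongrightarrow> 0) (at_right 0)"
    proof (rule Lim_transform_eventually)
      show "((\<lambda>y::real. exp (- inverse y) / y ^ (n + 1)) \<longlongrightarrow> 0) (at_right 0)"
      proof -
        have "((\<lambda>z::real. z ^ (n + 1) / exp z) \<longlongrightarrow> 0) at_top"
          by (rule tendsto_power_div_exp_0)
        then have "((\<lambda>y::real. inverse y ^ (n + 1) / exp (inverse y)) \<longlongrightarrow> 0) (at_right 0)"
          by (rule filterlim_compose[OF _ filterlim_inverse_at_top_right])
        then show ?thesis by (simp add: exp_minus divide_inverse mult.commute power_inverse)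
      qed
    qed (auto simp: exp_inv_def eventually_at intro!: exI[of _ 1])
    moreover have "((\<lambda>y. exp_inv n y / y) \<longlongrightarrow> 0) (at_left 0)"
      by (rule Lim_transform_eventually[OF tendsto_const]) (auto simp: exp_inv_def eventually_at intro!: exI[of _ 1])
    ultimately have "((\<lambda>y. exp_inv n y / y) \<longlongrightarrow> 0) (at 0)"
      by (simp add: filterlim_split_at)
    then show ?thesis using 3 by (simp add: exp_inv_def has_field_derivative_iff)
  qed
qed

lemma C_diff_exp_inv: "C_diff m (exp_inv n)"
proof (induction m arbitrary: n)
  case 0
  have "continuous_on UNIV (exp_inv n)"
    by (meson DERIV_isCont continuous_at_imp_continuous_on exp_inv_deriv)
  then show ?case by simp
next
  case (Suc m)
  show ?case
    by (rule C_diff_SucI_real[OF exp_inv_deriv]) (intro C_diff_diff C_diff_cmult Suc)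
qed

text \<open>The standard transition from 0 to 1 on the unit interval. The denominator never
  vanishes, since x and 1 - x are not both nonpositive.\<close>

definition smooth_step :: "real \<Rightarrow> real" where
  "smooth_step x = exp_inv 0 x * inverse (exp_inv 0 x + exp_inv 0 (1 - x))"

lemma exp_inv_nonneg: "exp_inv n x \<ge> 0"
  by (simp add: exp_inv_def)

lemma exp_inv_pair_pos: "exp_inv 0 x + exp_inv 0 (1 - x) > 0"
  by (auto simp: exp_inv_def add_pos_pos)

lemma C_diff_smooth_step: "C_diff m smooth_step"
proof -
  have "C_diff m (\<lambda>x. exp_inv 0 (1 - x))" for m
    using C_diff_comp_affine[OF C_diff_exp_inv, of m 0 "-1::real" 1] by (simp add: algebra_simps)
  then have "C_diff m (\<lambda>x. inverse (exp_inv 0 x + exp_inv 0 (1 - x)))"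
    by (intro C_diff_inverse C_diff_add C_diff_exp_inv) (simp_all add: less_imp_neq[OF exp_inv_pair_pos, symmetric])
  then show ?thesis
    unfolding smooth_step_def by (intro C_diff_mult C_diff_exp_inv)
qed

lemma smooth_step_bounds: "0 \<le> smooth_step x" "smooth_step x \<le> 1"
  using exp_inv_pair_pos[of x] exp_inv_nonneg[of 0 x] exp_inv_nonneg[of 0 "1 - x"]
  by (auto simp: smooth_step_def field_simps)

lemma smooth_step_eq_0: "x \<le> 0 \<Longrightarrow> smooth_step x = 0"
  and smooth_step_eq_1: "x \<ge> 1 \<Longrightarrow> smooth_step x = 1"
  by (auto simp: smooth_step_def exp_inv_def)

section \<open>Bounds for smooth functions of compact support\<close>

lemma continuous_support_bounded:
  fixes f :: "'a::euclidean_space \<Rightarrow> real"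
  assumes "continuous_on UNIV f" "\<And>x. x \<notin> cball 0 r \<Longrightarrow> f x = 0"
  obtains B where "B \<ge> 0" "\<And>x. \<bar>f x\<bar> \<le> B"
proof -
  have "bounded (f ` cball 0 r)"
    using assms(1) by (intro compact_imp_bounded compact_continuous_image) (auto intro: continuous_on_subset)
  then obtain B where B: "\<And>x. x \<in> cball 0 r \<Longrightarrow> \<bar>f x\<bar> \<le> B"
    unfolding bounded_iff by (metis imageI real_norm_def)
  have "\<bar>f x\<bar> \<le> max B 0" for x
    using B[of x] assms(2)[of x] by (cases "x \<in> cball 0 r") auto
  then show ?thesis using that[of "max B 0"] by simp
qed

text \<open>The complement of the closed ball is open, so the function is locally constant
  there.\<close>

lemma frechet_derivative_outside_support:
  fixes f :: "'a::euclidean_space \<Rightarrow> real"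
  assumes "\<And>x. x \<notin> cball 0 r \<Longrightarrow> f x = 0" "x \<notin> cball 0 r"
  shows "frechet_derivative f (at x) = (\<lambda>h. 0)"
proof -
  have "(f has_derivative (\<lambda>h. 0)) (at x)"
    by (rule has_derivative_transform_within_open[of "\<lambda>x. 0" _ _ _ "- cball 0 r"])
      (use assms in auto)
  then show ?thesis
    by (metis frechet_derivative_at)
qed

text \<open>The partial derivatives are continuous with compact support, hence bounded, and the sum
  of their bounds controls the operator norm of the derivative.\<close>

lemma smooth_compact_support_lipschitz:
  fixes f :: "'a::euclidean_space \<Rightarrow> real"
  assumes "C_diff 1 f" "\<And>x. x \<notin> cball 0 r \<Longrightarrow> f x = 0"
  obtains L where "L > 0" "\<And>x y. \<bar>f x - f y\<bar> \<le> L * norm (x - y)"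
proof -
  let ?f' = "\<lambda>x. frechet_derivative f (at x)"
  have der: "(f has_derivative ?f' x) (at x)" for x
    using C_diff_SucD(1)[of 0 f x] assms(1) by simp
  have "\<exists>B. \<forall>x. \<bar>?f' x b\<bar> \<le> B" if b: "b \<in> Basis" for b
  proof -
    have cont: "continuous_on UNIV (\<lambda>x. ?f' x b)"
      using assms(1) b by auto
    have supp: "?f' x b = 0" if x: "x \<notin> cball 0 r" for x
      using frechet_derivative_outside_support[OF assms(2) x] by simp
    show ?thesis
      by (rule continuous_support_bounded[OF cont supp]) auto
  qed
  then obtain B where B: "\<And>b x. b \<in> Basis \<Longrightarrow> \<bar>?f' x b\<bar> \<le> B b"
    by metis
  \<comment> \<open>The summand 1 keeps \<open>L\<close> positive even when all the bounds
    \<open>B b\<close> are 0.\<close>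
  define L where "L = 1 + (\<Sum>b\<in>(Basis::'a set). B b)"
  have on: "norm (?f' x h) \<le> L * norm h" for x h
  proof -
    have lin: "linear (?f' x)"
      using der has_derivative_linear by blast
    have "?f' x h = ?f' x (\<Sum>b\<in>Basis. (h \<bullet> b) *\<^sub>R b)"
      by (simp add: euclidean_representation)
    also have "\<dots> = (\<Sum>b\<in>Basis. (h \<bullet> b) * ?f' x b)"
      by (simp add: linear_sum[OF lin] linear_scale[OF lin])
    also have "\<bar>\<dots>\<bar> \<le> (\<Sum>b\<in>Basis. norm h * B b)"
      by (rule order_trans[OF sum_abs], rule sum_mono)
        (auto simp: abs_mult intro!: mult_mono B Basis_le_norm)
    also have "\<dots> \<le> L * norm h"
      by (simp add: L_def sum_distrib_left algebra_simps)
    finally show ?thesis by simp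
  qed
  have "B b \<ge> 0" if "b \<in> Basis" for b
    using B[OF that, of 0] by linarith
  then have "L > 0"
    unfolding L_def by (simp add: sum_nonneg add_pos_nonneg)
  moreover have "\<bar>f x - f y\<bar> \<le> L * norm (x - y)" for x y
  proof -
    have "norm (f x - f y) \<le> L * norm (x - y)"
    proof (rule differentiable_bound[of UNIV f ?f'])
      show "onorm (?f' z) \<le> L" for z
        by (rule onorm_le) (rule on)
    qed (use der in auto)
    then show ?thesis by simp
  qed
  ultimately show ?thesis using that by blast
qed

section \<open>Cutoffs on the interval\<close>

text \<open>Each factor is a transition layer at one endpoint, at distance between d and 2 d from
  it; the gap of width d keeps the support compact inside the open interval.\<close>

definition cutoff :: "real \<Rightarrow> real \<Rightarrow> real" where
  "cutoff d x = smooth_step ((1 + x) / d - 1) * smooth_step ((1 - x) / d - 1)"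

lemma C_diff_cutoff: "C_diff m (cutoff d)"
proof -
  have "C_diff m (\<lambda>x. smooth_step ((1 + x) / d - 1))" "C_diff m (\<lambda>x. smooth_step ((1 - x) / d - 1))"
    using C_diff_comp_affine[OF C_diff_smooth_step, of m "1/d::real" "1/d-1"]
      C_diff_comp_affine[OF C_diff_smooth_step, of m "-1/d::real" "1/d-1"]
    by (simp_all add: add_divide_distrib diff_divide_distrib algebra_simps)
  then show ?thesis
    unfolding cutoff_def by (rule C_diff_mult)
qed

lemma cutoff_bounds: "0 \<le> cutoff d x" "cutoff d x \<le> 1"
  by (auto simp: cutoff_def smooth_step_bounds mult_le_one)

lemma cutoff_eq_0: "d > 0 \<Longrightarrow> \<bar>x\<bar> \<ge> 1 - d \<Longrightarrow> cutoff d x = 0"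
  by (cases "x \<ge> 0") (auto simp: cutoff_def field_simps intro!: smooth_step_eq_0)

lemma cutoff_eq_1: "d > 0 \<Longrightarrow> \<bar>x\<bar> \<le> 1 - 2 * d \<Longrightarrow> cutoff d x = 1"
  by (auto simp: cutoff_def field_simps smooth_step_eq_1)

text \<open>A single constant serves all d: the factor 1/d is the slope of the inner affine maps,
  and \<open>smooth_step\<close> itself is Lipschitz.\<close>

lemma cutoff_lipschitz:
  obtains L where "L > 0" "\<And>d x y. d > 0 \<Longrightarrow> \<bar>cutoff d x - cutoff d y\<bar> \<le> L / d * \<bar>x - y\<bar>"
proof -
  \<comment> \<open>\<open>smooth_step\<close> does not have compact support; \<open>h\<close> has,
    and it agrees with \<open>smooth_step\<close> up to x = 3.\<close>
  define h where "h x = smooth_step x * smooth_step (4 - x)" for x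
  have "C_diff m (\<lambda>x. smooth_step (4 - x))" for m
    using C_diff_comp_affine[OF C_diff_smooth_step, of m "-1::real" 4] by (simp add: algebra_simps)
  then have "C_diff 1 h"
    unfolding h_def by (intro C_diff_mult C_diff_smooth_step)
  moreover have "h x = 0" if "x \<notin> cball 0 4" for x
    using that by (cases "x \<ge> 0") (auto simp: h_def smooth_step_eq_0)
  ultimately obtain L where L: "L > 0" "\<And>x y. \<bar>h x - h y\<bar> \<le> L * norm (x - y)"
    using smooth_compact_support_lipschitz by blast
  have *: "\<bar>smooth_step x - smooth_step y\<bar> \<le> L * \<bar>x - y\<bar>" for x y
  proof -
    \<comment> \<open>Clipping the argument to [0, 2] does not change \<open>smooth_step\<close>,
      and clipping is 1-Lipschitz, so the constant of \<open>h\<close> carries over.\<close>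
    have clip: "smooth_step x = h (max 0 (min x 2))" for x
      by (cases "x \<le> 0"; cases "x \<ge> 2") (auto simp: h_def smooth_step_eq_0 smooth_step_eq_1)
    have "\<bar>h (max 0 (min x 2)) - h (max 0 (min y 2))\<bar> \<le> L * \<bar>max 0 (min x 2) - max 0 (min y 2)\<bar>"
      using L(2) by simp
    also have "\<dots> \<le> L * \<bar>x - y\<bar>"
      using L(1) by (intro mult_left_mono) (auto simp: max_def min_def)
    finally show ?thesis by (simp add: clip)
  qed
  have "\<bar>cutoff d x - cutoff d y\<bar> \<le> 2 * L / d * \<bar>x - y\<bar>" if d: "d > 0" for d x y
  proof -
    let ?a = "\<lambda>x. smooth_step ((1 + x) / d - 1)" and ?b = "\<lambda>x. smooth_step ((1 - x) / d - 1)"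
    have "\<bar>?a x - ?a y\<bar> \<le> L * \<bar>x - y\<bar> / d" "\<bar>?b x - ?b y\<bar> \<le> L * \<bar>x - y\<bar> / d"
      using *[of "(1 + x) / d - 1" "(1 + y) / d - 1"] *[of "(1 - x) / d - 1" "(1 - y) / d - 1"] d
      by (simp_all add: diff_divide_distrib[symmetric] abs_minus_commute)
    moreover have "\<bar>cutoff d x - cutoff d y\<bar> \<le> \<bar>(?a x - ?a y) * ?b x\<bar> + \<bar>?a y * (?b x - ?b y)\<bar>"
    proof -
      have "cutoff d x - cutoff d y = (?a x - ?a y) * ?b x + ?a y * (?b x - ?b y)"
        by (simp add: cutoff_def algebra_simps)
      then show ?thesis by (metis abs_triangle_ineq)
    qed
    moreover have "\<bar>(?a x - ?a y) * ?b x\<bar> \<le> \<bar>?a x - ?a y\<bar> * 1" "\<bar>?a y * (?b x - ?b y)\<bar> \<le> 1 * \<bar>?b x - ?b y\<bar>"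
      unfolding abs_mult by (intro mult_mono; simp add: smooth_step_bounds)+
    ultimately have "\<bar>cutoff d x - cutoff d y\<bar> \<le> L * \<bar>x - y\<bar> / d + L * \<bar>x - y\<bar> / d"
      by (smt (verit) mult_1 mult.right_neutral)
    then show ?thesis by simp
  qed
  with L(1) show ?thesis by (intro that[of "2 * L"]) auto
qed

subsection \<open>The fractional Sobolev space\<close>

abbreviation L2_sq :: "'a::euclidean_space set \<Rightarrow> ('a \<Rightarrow> real) \<Rightarrow> real" where
  "L2_sq \<Omega> u \<equiv> LINT x|lebesgue_on \<Omega>. (u x)\<^sup>2"

lemma borel_unit_interval: "{-1<..<1::real} \<in> sets borel"
  by simp

lemma frac_const_pos:
  assumes "0 < s" "s < 1"
  shows "frac_const n s > 0"
  unfolding frac_const_def using assms by (intro divide_pos_pos mult_pos_pos Gamma_real_pos) auto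

lemma frac_seminorm_sq:
  fixes u :: "'a::euclidean_space \<Rightarrow> real"
  assumes "0 < s" "s < 1"
  shows "(frac_seminorm s \<Omega> u)\<^sup>2 = frac_const DIM('a) s / 2 * enn2real (gagliardo_integral s \<Omega> u)"
  using frac_const_pos[OF assms, of "DIM('a)"] by (simp add: frac_seminorm_def)

text \<open>The definitions integrate over Lebesgue measure, while Tonelli is applied on
  \<open>lborel\<close>. A nonnegative integral is the same over a measure and its completion,
  whatever the integrand.\<close>

lemma nn_integral_lebesgue_on:
  assumes "S \<in> sets borel"
  shows "(\<integral>\<^sup>+x. f x \<partial>lebesgue_on S) = (\<integral>\<^sup>+x. f x * indicator S x \<partial>lborel)"
  using assms by (subst nn_integral_restrict_space) (auto simp: nn_integral_completion)

lemma gagliardo_lborel: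
  fixes u :: "'a::euclidean_space \<Rightarrow> real"
  assumes "\<Omega> \<in> sets borel"
  shows "gagliardo_integral s \<Omega> u =
     (\<integral>\<^sup>+x. (\<integral>\<^sup>+y. ennreal (\<bar>u x - u y\<bar>\<^sup>2 / norm (x - y) powr (real DIM('a) + 2 * s)) * indicator \<Omega> y \<partial>lborel)
        * indicator \<Omega> x \<partial>lborel)"
  unfolding gagliardo_integral_def by (simp add: nn_integral_lebesgue_on[OF assms])

lemma gagliardo_cong_AE:
  assumes "AE x in lebesgue_on \<Omega>. u x = v x"
  shows "gagliardo_integral s \<Omega> u = gagliardo_integral s \<Omega> v"
  unfolding gagliardo_integral_def
proof (rule nn_integral_cong_AE, use assms in eventually_elim)
  fix x assume "u x = v x"
  then show "(\<integral>\<^sup>+ y. ennreal (\<bar>u x - u y\<bar>\<^sup>2 / norm (x - y) powr (real DIM('a) + 2 * s)) \<partial>lebesgue_on \<Omega>) =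
    (\<integral>\<^sup>+ y. ennreal (\<bar>v x - v y\<bar>\<^sup>2 / norm (x - y) powr (real DIM('a) + 2 * s)) \<partial>lebesgue_on \<Omega>)"
    using assms by (intro nn_integral_cong_AE) auto
qed

text \<open>Functions in the Sobolev space are only Lebesgue measurable; a Borel representative
  makes the integrand of the energy measurable in both variables jointly.\<close>

lemma lebesgue_on_borel_representative:
  fixes u :: "'a::euclidean_space \<Rightarrow> real"
  assumes "\<Omega> \<in> sets borel" "u \<in> borel_measurable (lebesgue_on \<Omega>)"
  obtains v where "v \<in> borel_measurable borel" "AE x in lebesgue_on \<Omega>. u x = v x"
proof -
  have "(\<lambda>x. indicator \<Omega> x *\<^sub>R u x) \<in> borel_measurable lebesgue"
    using assms by (subst borel_measurable_restrict_space_iff[symmetric]) auto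
  then obtain v where v: "v \<in> borel_measurable lborel" "AE x in lborel. indicator \<Omega> x *\<^sub>R u x = v x"
    using completion_ex_borel_measurable_real by blast
  have "AE x in lebesgue. indicator \<Omega> x *\<^sub>R u x = v x"
    using v(2) by (rule AE_completion)
  then have "AE x in lebesgue_on \<Omega>. u x = v x"
    using assms(1) by (subst AE_restrict_space_iff) (auto elim: eventually_mono)
  with v(1) show ?thesis using that by simp
qed

section \<open>Weighted substitutes for the triangle inequality\<close>

text \<open>Young's inequality for the mixed term. It stands in for the triangle inequality of the
  norms and keeps the estimates quadratic; the loss in the leading term disappears as t tends to
  0.\<close>

lemma add_sq_le:
  fixes a b t :: real
  assumes "t > 0"
  shows "(a + b)\<^sup>2 \<le> (1 + t) * a\<^sup>2 + (1 + 1 / t) * b\<^sup>2"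
proof -
  have "0 \<le> (t * a - b)\<^sup>2 / t"
    using assms by simp
  also have "\<dots> = (1 + t) * a\<^sup>2 + (1 + 1 / t) * b\<^sup>2 - (a + b)\<^sup>2"
    using assms by (simp add: field_simps power2_eq_square)
  finally show ?thesis by simp
qed

lemma gagliardo_add_le:
  fixes u v :: "'a::euclidean_space \<Rightarrow> real"
  assumes \<Omega>: "\<Omega> \<in> sets borel" and t: "t > 0"
    and u: "u \<in> borel_measurable (lebesgue_on \<Omega>)" and v: "v \<in> borel_measurable (lebesgue_on \<Omega>)"
  shows "gagliardo_integral s \<Omega> (\<lambda>x. u x + v x)
    \<le> ennreal (1 + t) * gagliardo_integral s \<Omega> u + ennreal (1 + 1 / t) * gagliardo_integral s \<Omega> v"
proof -
  obtain u' where u': "u' \<in> borel_measurable borel" "AE x in lebesgue_on \<Omega>. u x = u' x"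
    using lebesgue_on_borel_representative[OF \<Omega> u] .
  obtain v' where v': "v' \<in> borel_measurable borel" "AE x in lebesgue_on \<Omega>. v x = v' x"
    using lebesgue_on_borel_representative[OF \<Omega> v] .
  note [measurable] = u'(1) v'(1) \<Omega>
  let ?K = "\<lambda>w x y. ennreal (\<bar>w x - w y\<bar>\<^sup>2 / norm (x - y) powr (real DIM('a) + 2 * s))"
  let ?I = "\<lambda>w. \<integral>\<^sup>+x. (\<integral>\<^sup>+y. ?K w x y * indicator \<Omega> y \<partial>lborel) * indicator \<Omega> x \<partial>lborel"
  have "gagliardo_integral s \<Omega> (\<lambda>x. u x + v x) = gagliardo_integral s \<Omega> (\<lambda>x. u' x + v' x)"
    using u'(2) v'(2) by (intro gagliardo_cong_AE) auto
  also have "\<dots> = ?I (\<lambda>x. u' x + v' x)"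
    by (rule gagliardo_lborel[OF \<Omega>])
  also have "\<dots> \<le> (\<integral>\<^sup>+x. (\<integral>\<^sup>+y. (ennreal (1 + t) * ?K u' x y + ennreal (1 + 1 / t) * ?K v' x y) * indicator \<Omega> y \<partial>lborel) * indicator \<Omega> x \<partial>lborel)"
  proof (intro nn_integral_mono mult_right_mono)
    fix x y
    have "\<bar>u' x + v' x - (u' y + v' y)\<bar>\<^sup>2 = ((u' x - u' y) + (v' x - v' y))\<^sup>2"
      by (simp add: algebra_simps)
    also have "\<dots> \<le> (1 + t) * \<bar>u' x - u' y\<bar>\<^sup>2 + (1 + 1 / t) * \<bar>v' x - v' y\<bar>\<^sup>2"
      using add_sq_le[OF t] by simp
    finally have "\<bar>u' x + v' x - (u' y + v' y)\<bar>\<^sup>2 / norm (x - y) powr (real DIM('a) + 2 * s)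
        \<le> (1 + t) * (\<bar>u' x - u' y\<bar>\<^sup>2 / norm (x - y) powr (real DIM('a) + 2 * s)) +
        (1 + 1 / t) * (\<bar>v' x - v' y\<bar>\<^sup>2 / norm (x - y) powr (real DIM('a) + 2 * s))"
      using divide_right_mono[of _ _ "norm (x - y) powr (real DIM('a) + 2 * s)"]
      by (fastforce simp: add_divide_distrib)
    then show "?K (\<lambda>x. u' x + v' x) x y \<le> ennreal (1 + t) * ?K u' x y + ennreal (1 + 1 / t) * ?K v' x y"
      using t by (simp add: ennreal_mult[symmetric] ennreal_plus[symmetric] del: ennreal_plus power2_abs)
  qed auto
  also have "\<dots> = ennreal (1 + t) * ?I u' + ennreal (1 + 1 / t) * ?I v'"
    by (simp add: distrib_right mult.assoc nn_integral_add nn_integral_cmult)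
  also have "\<dots> = ennreal (1 + t) * gagliardo_integral s \<Omega> u + ennreal (1 + 1 / t) * gagliardo_integral s \<Omega> v"
    using gagliardo_cong_AE[OF u'(2)] gagliardo_cong_AE[OF v'(2)]
    by (simp only: gagliardo_lborel[OF \<Omega>, symmetric])
  finally show ?thesis .
qed

lemma gagliardo_minus: "gagliardo_integral s \<Omega> (\<lambda>x. - u x) = gagliardo_integral s \<Omega> u"
  unfolding gagliardo_integral_def by (simp add: abs_minus_commute)

lemma frac_seminorm_minus: "frac_seminorm s \<Omega> (\<lambda>x. - u x) = frac_seminorm s \<Omega> u"
  by (simp add: frac_seminorm_def gagliardo_minus)

lemma L2_add_le:
  assumes [measurable]: "u \<in> borel_measurable M" "v \<in> borel_measurable M" and t: "t > (0::real)"
    and iu: "integrable M (\<lambda>x. (u x)\<^sup>2)" and iv: "integrable M (\<lambda>x. (v x)\<^sup>2)"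
  shows "integrable M (\<lambda>x. (u x + v x)\<^sup>2)"
    and "(LINT x|M. (u x + v x)\<^sup>2) \<le> (1 + t) * (LINT x|M. (u x)\<^sup>2) + (1 + 1 / t) * (LINT x|M. (v x)\<^sup>2)"
proof -
  have i: "integrable M (\<lambda>x. (1 + t) * (u x)\<^sup>2 + (1 + 1 / t) * (v x)\<^sup>2)"
    using iu iv by auto
  show 1: "integrable M (\<lambda>x. (u x + v x)\<^sup>2)"
    by (rule Bochner_Integration.integrable_bound[OF i])
      (use add_sq_le[OF t] in \<open>auto intro!: always_eventually order_trans[OF _ abs_ge_self]\<close>)
  have "(LINT x|M. (u x + v x)\<^sup>2) \<le> (LINT x|M. (1 + t) * (u x)\<^sup>2 + (1 + 1 / t) * (v x)\<^sup>2)"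
    by (rule integral_mono[OF 1 i]) (rule add_sq_le[OF t])
  also have "\<dots> = (1 + t) * (LINT x|M. (u x)\<^sup>2) + (1 + 1 / t) * (LINT x|M. (v x)\<^sup>2)"
    using iu iv by simp
  finally show "(LINT x|M. (u x + v x)\<^sup>2) \<le> (1 + t) * (LINT x|M. (u x)\<^sup>2) + (1 + 1 / t) * (LINT x|M. (v x)\<^sup>2)" .
qed

lemma sobolev_spaceD:
  assumes "u \<in> sobolev_space s \<Omega>"
  shows "u \<in> borel_measurable (lebesgue_on \<Omega>)" "integrable (lebesgue_on \<Omega>) (\<lambda>x. (u x)\<^sup>2)"
    "gagliardo_integral s \<Omega> u < \<infinity>"
  using assms by (auto simp: sobolev_space_def)

lemma sobolev_space_uminus: "u \<in> sobolev_space s \<Omega> \<Longrightarrow> (\<lambda>x. - u x) \<in> sobolev_space s \<Omega>"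
  by (auto simp: sobolev_space_def gagliardo_minus)

lemma sobolev_space_add:
  assumes "\<Omega> \<in> sets borel" "u \<in> sobolev_space s \<Omega>" "v \<in> sobolev_space s \<Omega>"
  shows "(\<lambda>x. u x + v x) \<in> sobolev_space s \<Omega>"
proof -
  note u = sobolev_spaceD[OF assms(2)] and v = sobolev_spaceD[OF assms(3)]
  have "gagliardo_integral s \<Omega> (\<lambda>x. u x + v x) < \<infinity>"
    using gagliardo_add_le[OF assms(1) zero_less_one u(1) v(1), of s] u(3) v(3)
    by (auto intro: le_less_trans simp: ennreal_mult_less_top)
  then show ?thesis
    using L2_add_le(1)[OF u(1) v(1) zero_less_one u(2) v(2)] u(1) v(1) by (simp add: sobolev_space_def)
qed

lemma frac_seminorm_add_le:
  fixes u v :: "'a::euclidean_space \<Rightarrow> real"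
  assumes s: "0 < s" "s < 1" and \<Omega>: "\<Omega> \<in> sets borel" and t: "t > 0"
    and "u \<in> sobolev_space s \<Omega>" "v \<in> sobolev_space s \<Omega>"
  shows "(frac_seminorm s \<Omega> (\<lambda>x. u x + v x))\<^sup>2
    \<le> (1 + t) * (frac_seminorm s \<Omega> u)\<^sup>2 + (1 + 1 / t) * (frac_seminorm s \<Omega> v)\<^sup>2"
proof -
  note u = sobolev_spaceD[OF assms(5)] and v = sobolev_spaceD[OF assms(6)]
  let ?G = "gagliardo_integral s \<Omega>"
  have "enn2real (?G (\<lambda>x. u x + v x)) \<le> enn2real (ennreal (1 + t) * ?G u + ennreal (1 + 1 / t) * ?G v)"
    using u(3) v(3) t by (intro enn2real_mono gagliardo_add_le \<Omega> u(1) v(1)) (auto simp: ennreal_mult_less_top)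
  also have "\<dots> = (1 + t) * enn2real (?G u) + (1 + 1 / t) * enn2real (?G v)"
    using u(3) v(3) t by (subst enn2real_plus) (auto simp: ennreal_mult_less_top enn2real_mult simp del: ennreal_plus)
  finally have "frac_const DIM('a) s / 2 * enn2real (?G (\<lambda>x. u x + v x))
      \<le> frac_const DIM('a) s / 2 * ((1 + t) * enn2real (?G u) + (1 + 1 / t) * enn2real (?G v))"
    using frac_const_pos[OF s, of "DIM('a)"] by (intro mult_left_mono) auto
  then show ?thesis
    by (simp only: frac_seminorm_sq[OF s] distrib_left mult.left_commute)
qed

lemma sobolev_norm_less:
  assumes "sobolev_norm s \<Omega> u < sqrt e"
  shows "L2_sq \<Omega> u < e" "(frac_seminorm s \<Omega> u)\<^sup>2 < e"
proof -
  have "0 \<le> L2_sq \<Omega> u"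
    by (rule Bochner_Integration.integral_nonneg) simp
  then have *: "(L2_norm_on \<Omega> u)\<^sup>2 = L2_sq \<Omega> u"
    unfolding L2_norm_on_def by simp
  have "(L2_norm_on \<Omega> u)\<^sup>2 + (frac_seminorm s \<Omega> u)\<^sup>2 < e"
    using assms unfolding sobolev_norm_def by simp
  then show "L2_sq \<Omega> u < e" "(frac_seminorm s \<Omega> u)\<^sup>2 < e"
    unfolding * using \<open>0 \<le> L2_sq \<Omega> u\<close> by (auto intro: le_less_trans[rotated])
qed

section \<open>Reduction to test functions\<close>

lemma le_limit_at_right_0:
  fixes f :: "real \<Rightarrow> real"
  assumes "(f \<longlongrightarrow> l) (at_right 0)" "\<And>t. t > 0 \<Longrightarrow> a \<le> f t"
  shows "a \<le> l"
  using assms(1) by (rule tendsto_lowerbound) (auto simp: eventually_at intro!: assms(2) exI[of _ 1])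

text \<open>Both sides are quadratic and continuous for the Sobolev norm, so an inequality for test
  functions extends to their closure.\<close>

lemma sobolev_space_0_poincare:
  fixes u :: "'a::euclidean_space \<Rightarrow> real"
  assumes s: "0 < s" "s < 1" and \<Omega>: "\<Omega> \<in> sets borel" and c: "0 \<le> c"
    and test: "\<And>\<phi>. \<phi> \<in> test_functions \<Omega> \<inter> sobolev_space s \<Omega> \<Longrightarrow>
      c * L2_sq \<Omega> \<phi> \<le> (frac_seminorm s \<Omega> \<phi>)\<^sup>2"
    and u: "u \<in> sobolev_space_0 s \<Omega>"
  shows "c * L2_sq \<Omega> u \<le> (frac_seminorm s \<Omega> u)\<^sup>2"
proof -
  let ?N = "\<lambda>u. LINT x|lebesgue_on \<Omega>. (u x)\<^sup>2" and ?S = "\<lambda>u. (frac_seminorm s \<Omega> u)\<^sup>2"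
  have uS: "u \<in> sobolev_space s \<Omega>"
    using u by (simp add: sobolev_space_0_def)
  \<comment> \<open>Two independent parameters: the factor 1 + 1/t blows up as t tends to 0, so e
    has to vanish for fixed t before t does.\<close>
  have main: "c * ?N u \<le> (1 + t) * (1 + t) * ?S u + ((1 + t) * (1 + 1 / t) + c * (1 + 1 / t)) * e"
    if t: "t > 0" and e: "e > 0" for t e :: real
  proof -
    obtain \<phi> where \<phi>: "\<phi> \<in> test_functions \<Omega> \<inter> sobolev_space s \<Omega>"
      "sobolev_norm s \<Omega> (\<lambda>x. u x - \<phi> x) < sqrt e"
      using u e real_sqrt_gt_zero[OF e] unfolding sobolev_space_0_def by blast
    define w where "w x = u x - \<phi> x" for x
    have w: "w \<in> sobolev_space s \<Omega>"
      using sobolev_space_add[OF \<Omega> uS sobolev_space_uminus, of \<phi>] \<phi>(1) by (simp add: w_def[abs_def])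
    have small: "?N w < e" "?S w < e"
      using sobolev_norm_less[OF \<phi>(2)] by (simp_all add: w_def[abs_def])
    have "?N u \<le> (1 + t) * ?N \<phi> + (1 + 1 / t) * ?N w"
      using L2_add_le(2)[of \<phi> "lebesgue_on \<Omega>" w t] sobolev_spaceD[of \<phi> s \<Omega>] sobolev_spaceD[OF w] \<phi>(1) t
      by (simp add: w_def)
    then have "c * ?N u \<le> c * ((1 + t) * ?N \<phi> + (1 + 1 / t) * ?N w)"
      using c by (rule mult_left_mono)
    also have "\<dots> = (1 + t) * (c * ?N \<phi>) + c * (1 + 1 / t) * ?N w"
      by (simp add: algebra_simps)
    also have "\<dots> \<le> (1 + t) * ?S \<phi> + c * (1 + 1 / t) * e"
      using t c small test[OF \<phi>(1)] by (intro add_mono mult_left_mono) auto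
    also have "(1 + t) * ?S \<phi> \<le> (1 + t) * ((1 + t) * ?S u + (1 + 1 / t) * e)"
    proof -
      have "?S \<phi> \<le> (1 + t) * ?S u + (1 + 1 / t) * ?S w"
        using frac_seminorm_add_le[OF s \<Omega> t uS sobolev_space_uminus[OF w]]
        unfolding frac_seminorm_minus by (simp add: w_def[abs_def])
      also have "(1 + 1 / t) * ?S w \<le> (1 + 1 / t) * e"
        using t small by (intro mult_left_mono) auto
      finally show ?thesis
        using t by (intro mult_left_mono) auto
    qed
    finally show ?thesis
      by (simp add: algebra_simps)
  qed
  have "c * ?N u \<le> (1 + t) * (1 + t) * ?S u + ((1 + t) * (1 + 1 / t) + c * (1 + 1 / t)) * 0" if t: "t > 0" for t
    by (rule le_limit_at_right_0[OF _ main[OF t]]) (assumption | rule tendsto_intros)+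
  moreover have "((\<lambda>t. (1 + t) * (1 + t) * ?S u) \<longlongrightarrow> (1 + 0) * (1 + 0) * ?S u) (at_right 0)"
    by (intro tendsto_intros)
  ultimately show ?thesis
    using le_limit_at_right_0[of "\<lambda>t. (1 + t) * (1 + t) * ?S u" "(1 + 0) * (1 + 0) * ?S u" "c * ?N u"] by simp
qed

lemma test_function_in_sobolev_space_0:
  fixes \<phi> :: "'a::euclidean_space \<Rightarrow> real"
  assumes "\<phi> \<in> test_functions \<Omega> \<inter> sobolev_space s \<Omega>"
  shows "\<phi> \<in> sobolev_space_0 s \<Omega>"
proof -
  have "sobolev_norm s \<Omega> (\<lambda>x. \<phi> x - \<phi> x) = 0"
    by (simp add: sobolev_norm_def L2_norm_on_def frac_seminorm_def gagliardo_integral_def)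
  then show ?thesis
    using assms unfolding sobolev_space_0_def by force
qed

text \<open>The constant is described by its lower bounds, tested on test functions only; comparing
  two constants then means comparing two families of inequalities. The infimum of the empty set of
  reals has no useful value, whence \<open>ne\<close>.\<close>

lemma le_poincare_const_iff:
  fixes \<Omega> :: "'a::euclidean_space set"
  assumes s: "0 < s" "s < 1" and \<Omega>: "\<Omega> \<in> sets borel" and c: "0 \<le> c"
    and ne: "\<exists>\<phi>\<in>test_functions \<Omega> \<inter> sobolev_space s \<Omega>. \<not> (AE x in lebesgue_on \<Omega>. \<phi> x = 0)"
  shows "c \<le> poincare_const s \<Omega> \<longleftrightarrow> (\<forall>\<phi>\<in>test_functions \<Omega> \<inter> sobolev_space s \<Omega>.
      c * L2_sq \<Omega> \<phi> \<le> (frac_seminorm s \<Omega> \<phi>)\<^sup>2)"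
proof -
  let ?N = "\<lambda>u. LINT x|lebesgue_on \<Omega>. (u x)\<^sup>2" and ?S = "\<lambda>u. (frac_seminorm s \<Omega> u)\<^sup>2"
  let ?R = "{?S u / ?N u |u. u \<in> sobolev_space_0 s \<Omega> \<and> \<not> (AE x in lebesgue_on \<Omega>. u x = 0)}"
  have N0: "?N u = 0 \<longleftrightarrow> (AE x in lebesgue_on \<Omega>. u x = 0)" if "u \<in> sobolev_space s \<Omega>" for u
    using sobolev_spaceD[OF that] by (subst integral_nonneg_eq_0_iff_AE) auto
  have Nnn: "?N u \<ge> 0" for u :: "'a \<Rightarrow> real"
    by (rule Bochner_Integration.integral_nonneg) simp
  have sub: "u \<in> sobolev_space s \<Omega>" if "u \<in> sobolev_space_0 s \<Omega>" for u
    using that by (simp add: sobolev_space_0_def)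
  have bdd: "bdd_below ?R"
    using Nnn by (intro bdd_belowI[of _ 0]) auto
  show ?thesis
  proof (intro iffI ballI)
    fix \<phi> assume le: "c \<le> poincare_const s \<Omega>" and \<phi>: "\<phi> \<in> test_functions \<Omega> \<inter> sobolev_space s \<Omega>"
    show "c * ?N \<phi> \<le> ?S \<phi>"
    proof (cases "AE x in lebesgue_on \<Omega>. \<phi> x = 0")
      case True
      then show ?thesis using N0[of \<phi>] \<phi> by simp
    next
      case False
      then have "?S \<phi> / ?N \<phi> \<in> ?R"
        using test_function_in_sobolev_space_0[OF \<phi>] by blast
      then have "c \<le> ?S \<phi> / ?N \<phi>"
        using le cInf_lower[OF _ bdd] unfolding poincare_const_def by fastforce
      moreover have "?N \<phi> > 0"
        using N0[of \<phi>] \<phi> False Nnn[of \<phi>] by (auto simp: order_less_le)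
      ultimately show ?thesis by (simp add: field_simps)
    qed
  next
    assume test: "\<forall>\<phi>\<in>test_functions \<Omega> \<inter> sobolev_space s \<Omega>. c * ?N \<phi> \<le> ?S \<phi>"
    show "c \<le> poincare_const s \<Omega>"
      unfolding poincare_const_def
    proof (rule cInf_greatest)
      show "?R \<noteq> {}"
        using ne test_function_in_sobolev_space_0 by blast
      fix q assume "q \<in> ?R"
      then obtain u where u: "q = ?S u / ?N u" "u \<in> sobolev_space_0 s \<Omega>" "\<not> (AE x in lebesgue_on \<Omega>. u x = 0)"
        by blast
      have "c * ?N u \<le> ?S u"
        using sobolev_space_0_poincare[OF s \<Omega> c _ u(2)] test by blast
      moreover have "?N u > 0"
        using N0[OF sub[OF u(2)]] u(3) Nnn[of u] by (auto simp: order_less_le)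
      ultimately show "c \<le> q" unfolding u(1) by (simp add: pos_le_divide_eq)
    qed
  qed
qed

subsection \<open>Lebesgue measure on the orthogonal complement of a coordinate direction\<close>

lemma nn_integral_lborel_translation:
  fixes c :: "'a::euclidean_space"
  assumes "f \<in> borel_measurable borel"
  shows "(\<integral>\<^sup>+x. f (x + c) \<partial>lborel) = (\<integral>\<^sup>+x. f x \<partial>lborel)"
proof -
  have "(\<integral>\<^sup>+x. f x \<partial>lborel) = (\<integral>\<^sup>+x. f x \<partial>distr lborel borel ((+) c))"
    by (simp add: lborel_distr_plus)
  also have "\<dots> = (\<integral>\<^sup>+x. f (c + x) \<partial>lborel)"
    using assms by (subst nn_integral_distr) auto
  finally show ?thesis by (simp add: add.commute)
qed

text \<open>The image of Lebesgue measure on the slab \<open>0 \<le> x \<bullet> e \<le> 1\<close> under the orthogonal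
  projection; this makes Fubini in the direction \<open>e\<close> available without leaving the type.\<close>

definition perp_lborel :: "'a::euclidean_space \<Rightarrow> 'a measure" where
  "perp_lborel e = distr (density lborel (\<lambda>x. indicator {0..1} (x \<bullet> e))) borel (\<lambda>x. x - (x \<bullet> e) *\<^sub>R e)"

lemma sets_perp_lborel [measurable_cong, simp]: "sets (perp_lborel e) = sets borel"
  and space_perp_lborel [simp]: "space (perp_lborel e) = UNIV"
  by (simp_all add: perp_lborel_def)

lemma nn_integral_perp_lborel:
  fixes e :: "'a::euclidean_space"
  assumes [measurable]: "f \<in> borel_measurable borel"
  shows "(\<integral>\<^sup>+a. f a \<partial>perp_lborel e) = (\<integral>\<^sup>+x. indicator {0..1} (x \<bullet> e) * f (x - (x \<bullet> e) *\<^sub>R e) \<partial>lborel)"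
  unfolding perp_lborel_def by (subst nn_integral_distr, simp, simp) (subst nn_integral_density, auto)

lemma AE_perp_lborel:
  fixes e :: "'a::euclidean_space"
  assumes "e \<in> Basis"
  shows "AE a in perp_lborel e. a \<bullet> e = 0"
proof -
  have [measurable]: "{x\<in>space borel. x \<bullet> e = 0} \<in> sets borel"
    by measurable
  show ?thesis
    unfolding perp_lborel_def using assms
    by (subst AE_distr_iff) (auto simp: inner_diff_left inner_same_Basis)
qed

text \<open>Points of the slab that project into a ball of radius r lie within distance r + 1 of the
  origin.\<close>

lemma emeasure_perp_lborel_cball:
  fixes e :: "'a::euclidean_space"
  assumes e: "e \<in> Basis"
  shows "emeasure (perp_lborel e) (cball 0 r) < \<infinity>"
proof -
  have "emeasure (perp_lborel e) (cball 0 r) = (\<integral>\<^sup>+a. indicator (cball 0 r) a \<partial>perp_lborel e)"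
    by simp
  also have "\<dots> = (\<integral>\<^sup>+x. indicator {0..1} (x \<bullet> e) * indicator (cball 0 r) (x - (x \<bullet> e) *\<^sub>R e) \<partial>lborel)"
    by (rule nn_integral_perp_lborel, rule borel_measurable_indicator) simp
  also have "\<dots> \<le> (\<integral>\<^sup>+(x::'a). indicator (cball 0 (r + 1)) x \<partial>lborel)"
  proof (rule nn_integral_mono)
    fix x :: 'a
    have "norm x \<le> norm (x - (x \<bullet> e) *\<^sub>R e) + norm ((x \<bullet> e) *\<^sub>R e)"
      by (metis diff_add_cancel norm_triangle_ineq)
    also have "norm ((x \<bullet> e) *\<^sub>R e) = \<bar>x \<bullet> e\<bar>"
      using e by simp
    finally show "indicator {0..1} (x \<bullet> e) * indicator (cball 0 r) (x - (x \<bullet> e) *\<^sub>R e)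
        \<le> (indicator (cball 0 (r + 1)) x :: ennreal)"
      by (auto simp: indicator_def)
  qed
  also have "\<dots> < \<infinity>"
    by (simp add: emeasure_bounded_finite[unfolded infinity_ennreal_def])
  finally show ?thesis .
qed

lemma sigma_finite_perp_lborel:
  fixes e :: "'a::euclidean_space"
  assumes e: "e \<in> Basis"
  shows "sigma_finite_measure (perp_lborel e)"
proof
  show "\<exists>A. countable A \<and> A \<subseteq> sets (perp_lborel e) \<and> \<Union>A = space (perp_lborel e) \<and> (\<forall>a\<in>A. emeasure (perp_lborel e) a \<noteq> \<infinity>)"
  proof (intro exI[of _ "range (\<lambda>n. cball 0 (real n))"] conjI)
    show "\<Union> (range (\<lambda>n. cball 0 (real n))) = space (perp_lborel e)"
      by (auto simp: real_arch_simple)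
  qed (use emeasure_perp_lborel_cball[OF e] in \<open>auto simp: less_top\<close>)
qed

text \<open>A shift orthogonal to \<open>e\<close> preserves the slab and commutes with taking the
  orthogonal part up to adding z, so invariance of \<open>lborel\<close> carries over.\<close>

lemma nn_integral_perp_lborel_translation:
  fixes e :: "'a::euclidean_space"
  assumes [measurable]: "f \<in> borel_measurable borel" and z: "z \<bullet> e = 0"
  shows "(\<integral>\<^sup>+a. f (a + z) \<partial>perp_lborel e) = (\<integral>\<^sup>+a. f a \<partial>perp_lborel e)"
proof -
  let ?g = "\<lambda>x. indicator {0..1} (x \<bullet> e) * f (x - (x \<bullet> e) *\<^sub>R e)"
  have "(\<integral>\<^sup>+a. f (a + z) \<partial>perp_lborel e) = (\<integral>\<^sup>+x. ?g (x + z) \<partial>lborel)"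
    by (simp add: nn_integral_perp_lborel inner_add_left z algebra_simps)
  also have "\<dots> = (\<integral>\<^sup>+x. ?g x \<partial>lborel)"
    by (rule nn_integral_lborel_translation) measurable
  also have "\<dots> = (\<integral>\<^sup>+a. f a \<partial>perp_lborel e)"
    by (simp add: nn_integral_perp_lborel)
  finally show ?thesis .
qed

text \<open>Only translation invariance and Tonelli are needed: on the slab, integrating over the line
  through \<open>x\<close> in direction \<open>e\<close> and shifting back leaves the integral over the parameter of an
  indicator of a unit interval.\<close>

lemma nn_integral_lborel_perp:
  fixes e :: "'a::euclidean_space"
  assumes e: "e \<in> Basis" and [measurable]: "f \<in> borel_measurable borel"
  shows "(\<integral>\<^sup>+x. f x \<partial>lborel) = (\<integral>\<^sup>+t. (\<integral>\<^sup>+a. f (a + t *\<^sub>R e) \<partial>perp_lborel e) \<partial>lborel)"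
proof -
  let ?I = "\<lambda>r. indicator {0..1::real} r :: ennreal"
  have ee: "e \<bullet> e = 1"
    using e by simp
  have "(\<integral>\<^sup>+t. (\<integral>\<^sup>+a. f (a + t *\<^sub>R e) \<partial>perp_lborel e) \<partial>lborel)
      = (\<integral>\<^sup>+t. (\<integral>\<^sup>+x. ?I (x \<bullet> e) * f (x - (x \<bullet> e) *\<^sub>R e + t *\<^sub>R e) \<partial>lborel) \<partial>lborel)"
    by (simp add: nn_integral_perp_lborel)
  also have "\<dots> = (\<integral>\<^sup>+x. (\<integral>\<^sup>+t. ?I (x \<bullet> e) * f (x - (x \<bullet> e) *\<^sub>R e + t *\<^sub>R e) \<partial>lborel) \<partial>lborel)"
    by (rule lborel_pair.Fubini') measurable
  also have "\<dots> = (\<integral>\<^sup>+x. (\<integral>\<^sup>+t. ?I (x \<bullet> e) * f (x + t *\<^sub>R e) \<partial>lborel) \<partial>lborel)"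
  proof (rule nn_integral_cong)
    fix x :: 'a
    have "(\<integral>\<^sup>+t. ?I (x \<bullet> e) * f (x - (x \<bullet> e) *\<^sub>R e + (t + x \<bullet> e) *\<^sub>R e) \<partial>lborel)
        = (\<integral>\<^sup>+t. ?I (x \<bullet> e) * f (x - (x \<bullet> e) *\<^sub>R e + t *\<^sub>R e) \<partial>lborel)"
      by (rule nn_integral_lborel_translation[of "\<lambda>t. ?I (x \<bullet> e) * f (x - (x \<bullet> e) *\<^sub>R e + t *\<^sub>R e)"]) measurable
    then show "(\<integral>\<^sup>+t. ?I (x \<bullet> e) * f (x - (x \<bullet> e) *\<^sub>R e + t *\<^sub>R e) \<partial>lborel)
        = (\<integral>\<^sup>+t. ?I (x \<bullet> e) * f (x + t *\<^sub>R e) \<partial>lborel)"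
      by (simp add: algebra_simps)
  qed
  also have "\<dots> = (\<integral>\<^sup>+t. (\<integral>\<^sup>+x. ?I (x \<bullet> e) * f (x + t *\<^sub>R e) \<partial>lborel) \<partial>lborel)"
    by (rule lborel_pair.Fubini') measurable
  also have "\<dots> = (\<integral>\<^sup>+t. (\<integral>\<^sup>+x. ?I (x \<bullet> e - t) * f x \<partial>lborel) \<partial>lborel)"
  proof (rule nn_integral_cong)
    fix t :: real
    show "(\<integral>\<^sup>+x. ?I (x \<bullet> e) * f (x + t *\<^sub>R e) \<partial>lborel) = (\<integral>\<^sup>+x. ?I (x \<bullet> e - t) * f x \<partial>lborel)"
      using nn_integral_lborel_translation[of "\<lambda>x. ?I (x \<bullet> e - t) * f x" "t *\<^sub>R e"]
      by (simp add: inner_add_left ee)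
  qed
  also have "\<dots> = (\<integral>\<^sup>+x. (\<integral>\<^sup>+t. ?I (x \<bullet> e - t) * f x \<partial>lborel) \<partial>lborel)"
    by (rule lborel_pair.Fubini') measurable
  also have "\<dots> = (\<integral>\<^sup>+x. f x \<partial>lborel)"
  proof (rule nn_integral_cong)
    fix x :: 'a
    have "(\<integral>\<^sup>+t. ?I (x \<bullet> e - t) * f x \<partial>lborel) = (\<integral>\<^sup>+t. indicator {x \<bullet> e - 1..x \<bullet> e} t * f x \<partial>lborel)"
      by (intro nn_integral_cong) (auto simp: indicator_def)
    also have "\<dots> = f x"
      by (simp add: nn_integral_multc)
    finally show "(\<integral>\<^sup>+t. ?I (x \<bullet> e - t) * f x \<partial>lborel) = f x" .
  qed
  finally show ?thesis by simp
qed

subsection \<open>Integrals of the kernel\<close>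

text \<open>A rescaled normal density: the variance 1/(2 r) turns its exponent into -r x^2.\<close>

lemma nn_integral_gaussian_real:
  assumes "r > 0"
  shows "(\<integral>\<^sup>+x. ennreal (exp (- r * x\<^sup>2)) \<partial>lborel) = ennreal (sqrt (pi / r))"
proof -
  define \<sigma> where "\<sigma> = sqrt (1 / (2 * r))"
  have \<sigma>: "\<sigma> > 0" "\<sigma>\<^sup>2 = 1 / (2 * r)"
    using assms by (auto simp: \<sigma>_def)
  have eq: "exp (- r * x\<^sup>2) = sqrt (pi / r) * normal_density 0 \<sigma> x" for x
    using assms by (simp add: normal_density_def \<sigma>(2) real_sqrt_divide)
  have "(\<integral>\<^sup>+x. ennreal (exp (- r * x\<^sup>2)) \<partial>lborel)
      = ennreal (sqrt (pi / r)) * (\<integral>\<^sup>+x. ennreal (normal_density 0 \<sigma> x) \<partial>lborel)"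
    unfolding eq using assms by (subst nn_integral_cmult[symmetric]) (auto simp: ennreal_mult')
  also have "(\<integral>\<^sup>+x. ennreal (normal_density 0 \<sigma> x) \<partial>lborel) = 1"
    using integral_normal_density[OF \<sigma>(1), of 0] integrable_normal_density[OF \<sigma>(1), of 0]
    by (subst nn_integral_eq_integral) auto
  finally show ?thesis by simp
qed

lemma nn_integral_gaussian:
  assumes "r > 0"
  shows "(\<integral>\<^sup>+(x::'a::euclidean_space). ennreal (exp (- r * (norm x)\<^sup>2)) \<partial>lborel) = ennreal (sqrt (pi / r) ^ DIM('a))"
proof -
  have "exp (- r * (norm x)\<^sup>2) = (\<Prod>b\<in>Basis. exp (- r * (x \<bullet> b)\<^sup>2))" for x :: 'a
    unfolding power2_norm_eq_inner euclidean_inner[of x x] by (simp add: exp_sum[symmetric] power2_eq_square sum_distrib_left sum_negf)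
  then have "(\<integral>\<^sup>+(x::'a). ennreal (exp (- r * (norm x)\<^sup>2)) \<partial>lborel)
      = (\<integral>\<^sup>+(x::'a). (\<Prod>b\<in>Basis. ennreal (exp (- r * (x \<bullet> b)\<^sup>2))) \<partial>lborel)"
    by (simp add: prod_ennreal)
  also have "\<dots> = (\<Prod>b\<in>(Basis::'a set). (\<integral>\<^sup>+x. ennreal (exp (- r * x\<^sup>2)) \<partial>lborel))"
    by (rule nn_integral_lborel_prod) auto
  also have "\<dots> = ennreal (sqrt (pi / r) ^ DIM('a))"
    unfolding nn_integral_gaussian_real[OF assms] using assms by (simp add: ennreal_power)
  finally show ?thesis .
qed

lemma norm_perp_add_sq:
  fixes e :: "'a::euclidean_space"
  assumes "e \<in> Basis" "a \<bullet> e = 0"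
  shows "(norm (a + t *\<^sub>R e))\<^sup>2 = (norm a)\<^sup>2 + t\<^sup>2"
  using assms unfolding power2_norm_eq_inner
  by (simp add: inner_add_left inner_add_right inner_commute power2_eq_square)

text \<open>By Pythagoras the n-dimensional Gaussian integral is the product of this one and a
  one-dimensional one; dividing gives the value without identifying the measure with Lebesgue
  measure on R^(n-1).\<close>

lemma nn_integral_gaussian_perp:
  fixes e :: "'a::euclidean_space"
  assumes e: "e \<in> Basis" and r: "r > 0"
  shows "(\<integral>\<^sup>+z. ennreal (exp (- r * (norm z)\<^sup>2)) \<partial>perp_lborel e) = ennreal ((pi / r) powr ((real DIM('a) - 1) / 2))"
proof -
  let ?A = "\<integral>\<^sup>+z. ennreal (exp (- r * (norm z)\<^sup>2)) \<partial>perp_lborel e"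
  have "(\<integral>\<^sup>+(x::'a). ennreal (exp (- r * (norm x)\<^sup>2)) \<partial>lborel)
      = (\<integral>\<^sup>+t. (\<integral>\<^sup>+a. ennreal (exp (- r * (norm (a + t *\<^sub>R e))\<^sup>2)) \<partial>perp_lborel e) \<partial>lborel)"
    by (rule nn_integral_lborel_perp[OF e]) measurable
  also have "\<dots> = (\<integral>\<^sup>+t. ?A * ennreal (exp (- r * t\<^sup>2)) \<partial>lborel)"
  proof (rule nn_integral_cong)
    fix t :: real
    have "(\<integral>\<^sup>+a. ennreal (exp (- r * (norm (a + t *\<^sub>R e))\<^sup>2)) \<partial>perp_lborel e)
        = (\<integral>\<^sup>+a. ennreal (exp (- r * (norm a)\<^sup>2)) * ennreal (exp (- r * t\<^sup>2)) \<partial>perp_lborel e)"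
    proof (rule nn_integral_cong_AE, use AE_perp_lborel[OF e] in eventually_elim)
      fix a :: 'a assume a: "a \<bullet> e = 0"
      show "ennreal (exp (- r * (norm (a + t *\<^sub>R e))\<^sup>2)) = ennreal (exp (- r * (norm a)\<^sup>2)) * ennreal (exp (- r * t\<^sup>2))"
        unfolding norm_perp_add_sq[OF e a] by (simp add: ennreal_mult[symmetric] exp_add[symmetric] algebra_simps)
    qed
    also have "\<dots> = ?A * ennreal (exp (- r * t\<^sup>2))"
      by (rule nn_integral_multc) measurable
    finally show "(\<integral>\<^sup>+a. ennreal (exp (- r * (norm (a + t *\<^sub>R e))\<^sup>2)) \<partial>perp_lborel e) = ?A * ennreal (exp (- r * t\<^sup>2))" .
  qed
  also have "\<dots> = ?A * ennreal (sqrt (pi / r))"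
    unfolding nn_integral_gaussian_real[OF r, symmetric] by (rule nn_integral_cmult) measurable
  finally have eq: "?A * ennreal (sqrt (pi / r)) = ennreal (sqrt (pi / r) ^ DIM('a))"
    by (simp only: nn_integral_gaussian[OF r])
  have pos: "sqrt (pi / r) > 0" using r by simp
  have "?A * ennreal (sqrt (pi / r)) = ennreal ((pi / r) powr ((real DIM('a) - 1) / 2)) * ennreal (sqrt (pi / r))"
  proof -
    have "sqrt (pi / r) ^ DIM('a) = (pi / r) powr (real DIM('a) / 2)"
      using r by (simp add: powr_half_sqrt[symmetric] powr_realpow[symmetric] powr_powr)
    also have "\<dots> = (pi / r) powr ((real DIM('a) - 1) / 2) * sqrt (pi / r)"
      using r by (simp add: powr_half_sqrt[symmetric] powr_add[symmetric] field_simps)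
    finally show ?thesis
      unfolding eq using pos by (simp add: ennreal_mult)
  qed
  then show ?thesis
    using pos r by (simp add: mult.commute ennreal_mult_cancel_left)
qed

text \<open>Euler's integral for \<open>Gamma p\<close> after the substitution t = A r.\<close>

lemma nn_integral_powr_exp:
  assumes p: "p > 0" and A: "A > 0"
  shows "(\<integral>\<^sup>+r. ennreal (r powr (p - 1) * exp (- r * A)) * indicator {0<..} r \<partial>lborel) = ennreal (Gamma p * A powr (- p))"
proof -
  let ?f = "\<lambda>t. ennreal (indicator {0..} t * t powr (p - 1) / exp t)"
  have "ennreal (Gamma p) = (\<integral>\<^sup>+t. ?f t \<partial>lborel)"
    using Gamma_conv_nn_integral_real[OF p] .
  also have "\<dots> = ennreal A * (\<integral>\<^sup>+r. ?f (0 + A * r) \<partial>lborel)"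
    using A by (subst nn_integral_real_affine[where t=0 and c=A]) auto
  also have "(\<integral>\<^sup>+r. ?f (0 + A * r) \<partial>lborel)
      = (\<integral>\<^sup>+r. ennreal (A powr (p - 1)) * (ennreal (r powr (p - 1) * exp (- r * A)) * indicator {0<..} r) \<partial>lborel)"
  \<comment> \<open>The point r = 0 is excluded because one side uses the closed and the other the
    open half line.\<close>
  proof (rule nn_integral_cong_AE, use AE_lborel_singleton[of 0] in eventually_elim)
    fix r :: real assume "r \<noteq> 0"
    then show "?f (0 + A * r) = ennreal (A powr (p - 1)) * (ennreal (r powr (p - 1) * exp (- r * A)) * indicator {0<..} r)"
      using A by (cases "r > 0") (auto simp: indicator_def powr_mult exp_minus field_simps ennreal_mult[symmetric] zero_le_mult_iff)
  qed
  also have "\<dots> = ennreal (A powr (p - 1)) * (\<integral>\<^sup>+r. ennreal (r powr (p - 1) * exp (- r * A)) * indicator {0<..} r \<partial>lborel)"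
    by (rule nn_integral_cmult) measurable
  finally have "ennreal (Gamma p) = ennreal (A * A powr (p - 1)) * (\<integral>\<^sup>+r. ennreal (r powr (p - 1) * exp (- r * A)) * indicator {0<..} r \<partial>lborel)"
    using A by (simp add: ennreal_mult mult.assoc)
  also have "A * A powr (p - 1) = A powr p"
    using A by (simp add: powr_mult_base)
  finally have *: "ennreal (Gamma p) = ennreal (A powr p) * (\<integral>\<^sup>+r. ennreal (r powr (p - 1) * exp (- r * A)) * indicator {0<..} r \<partial>lborel)" .
  have "ennreal (Gamma p * A powr (- p)) = ennreal (A powr (- p)) * ennreal (Gamma p)"
    using p by (simp add: ennreal_mult[symmetric] mult.commute)
  also have "\<dots> = ennreal (A powr (- p)) * ennreal (A powr p) * (\<integral>\<^sup>+r. ennreal (r powr (p - 1) * exp (- r * A)) * indicator {0<..} r \<partial>lborel)"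
    unfolding * by (simp add: mult.assoc)
  also have "ennreal (A powr (- p)) * ennreal (A powr p) = 1"
    using A by (simp add: ennreal_mult[symmetric] powr_add[symmetric])
  finally show ?thesis by simp
qed

text \<open>Write \<open>(q z + A) powr (- p)\<close> as a Gamma integral and apply Tonelli; the hypothesis says that
  \<open>M\<close> integrates Gaussians in \<open>q\<close> as Lebesgue measure does in dimension \<open>2 * d\<close>.\<close>

lemma nn_integral_power_of_gaussian:
  assumes M: "sigma_finite_measure M" and [measurable]: "q \<in> borel_measurable M"
    and q: "\<And>z. q z \<ge> (0::real)"
    and gauss: "\<And>r. r > 0 \<Longrightarrow> (\<integral>\<^sup>+z. ennreal (exp (- r * q z)) \<partial>M) = ennreal ((pi / r) powr d)"
    and p: "p > d" "d \<ge> 0" and A: "A > 0"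
  shows "(\<integral>\<^sup>+z. ennreal ((q z + A) powr (- p)) \<partial>M) = ennreal (pi powr d * Gamma (p - d) / Gamma p * A powr (- (p - d)))"
proof -
  interpret M: sigma_finite_measure M by fact
  interpret P: pair_sigma_finite lborel M ..
  have p0: "p > 0" using p by simp
  have cancel: "g * (a * b / g * c) = a * (b * c)" if "g > 0" for a b c g :: real
    using that by simp
  have "ennreal (Gamma p) * (\<integral>\<^sup>+z. ennreal ((q z + A) powr (- p)) \<partial>M)
      = (\<integral>\<^sup>+z. ennreal (Gamma p * (q z + A) powr (- p)) \<partial>M)"
    using p0 by (subst nn_integral_cmult[symmetric]) (auto simp: ennreal_mult')
  also have "\<dots> = (\<integral>\<^sup>+z. (\<integral>\<^sup>+r. ennreal (r powr (p - 1) * exp (- r * (q z + A))) * indicator {0<..} r \<partial>lborel) \<partial>M)"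
    using q A p0 by (intro nn_integral_cong nn_integral_powr_exp[symmetric] add_nonneg_pos) auto
  also have "\<dots> = (\<integral>\<^sup>+r. (\<integral>\<^sup>+z. ennreal (r powr (p - 1) * exp (- r * (q z + A))) * indicator {0<..} r \<partial>M) \<partial>lborel)"
    by (rule P.Fubini') measurable
  \<comment> \<open>Integrating the Gaussian contributes r^(-d), so a second Gamma integral with p -
    d in place of p remains.\<close>
  also have "\<dots> = (\<integral>\<^sup>+r. ennreal (pi powr d) * (ennreal (r powr (p - d - 1) * exp (- r * A)) * indicator {0<..} r) \<partial>lborel)"
  proof (rule nn_integral_cong)
    fix r :: real
    show "(\<integral>\<^sup>+z. ennreal (r powr (p - 1) * exp (- r * (q z + A))) * indicator {0<..} r \<partial>M)
        = ennreal (pi powr d) * (ennreal (r powr (p - d - 1) * exp (- r * A)) * indicator {0<..} r)"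
    proof (cases "r > 0")
      case r: True
      have "(\<integral>\<^sup>+z. ennreal (r powr (p - 1) * exp (- r * (q z + A))) * indicator {0<..} r \<partial>M)
          = (\<integral>\<^sup>+z. ennreal (r powr (p - 1) * exp (- r * A)) * ennreal (exp (- r * q z)) \<partial>M)"
        using r by (intro nn_integral_cong) (simp add: ennreal_mult[symmetric] exp_add[symmetric] algebra_simps)
      also have "\<dots> = ennreal (r powr (p - 1) * exp (- r * A)) * ennreal ((pi / r) powr d)"
        unfolding gauss[OF r, symmetric] by (rule nn_integral_cmult) measurable
      also have "\<dots> = ennreal (pi powr d) * ennreal (r powr (p - d - 1) * exp (- r * A))"
        using r by (simp add: ennreal_mult[symmetric] powr_divide powr_diff mult_ac)
      finally show ?thesis using r by simp
    qed simp
  qed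
  also have "\<dots> = ennreal (pi powr d) * ennreal (Gamma (p - d) * A powr (- (p - d)))"
    using nn_integral_powr_exp[of "p - d" A] p A by (subst nn_integral_cmult) auto
  also have "\<dots> = ennreal (Gamma p) * ennreal (pi powr d * Gamma (p - d) / Gamma p * A powr (- (p - d)))"
  proof -
    have "Gamma p * (pi powr d * Gamma (p - d) / Gamma p * A powr (- (p - d)))
        = pi powr d * (Gamma (p - d) * A powr (- (p - d)))"
      by (rule cancel[OF Gamma_real_pos[OF p0]])
    then show ?thesis
      using Gamma_real_pos[OF p0] Gamma_real_pos[of "p - d"] p by (simp only: ennreal_mult'[symmetric] powr_ge_zero less_imp_le)
  qed
  finally show ?thesis
    using Gamma_real_pos[OF p0] by (subst (asm) ennreal_mult_cancel_left) auto
qed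

text \<open>The integral of (|z|^2 + 1)^(-(n - 1 + q)/2) over the n - 1 orthogonal directions. It is
  used with q = 1 + 2 s for the energy and with q = s for the error caused by the cutoffs.\<close>

definition slice_const :: "nat \<Rightarrow> real \<Rightarrow> real" where
  "slice_const n q = pi powr ((real n - 1) / 2) * Gamma (q / 2) / Gamma ((real n - 1 + q) / 2)"

text \<open>By Pythagoras the kernel is a power of |z|^2 + t^2, to which the Gamma computation
  applies with d = (n - 1)/2 and p = (n - 1 + q)/2, so that p - d = q/2.\<close>

lemma nn_integral_kernel_slice:
  fixes e :: "'a::euclidean_space"
  assumes e: "e \<in> Basis" and q: "q > 0" and t: "t \<noteq> 0"
  shows "(\<integral>\<^sup>+z. ennreal (1 / norm (z + t *\<^sub>R e) powr (real DIM('a) - 1 + q)) \<partial>perp_lborel e)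
    = ennreal (slice_const DIM('a) q / \<bar>t\<bar> powr q)"
proof -
  have D: "real DIM('a) \<ge> 1" using DIM_positive[where 'a='a] by linarith
  let ?p = "(real DIM('a) - 1 + q) / 2"
  have "(\<integral>\<^sup>+z. ennreal (1 / norm (z + t *\<^sub>R e) powr (real DIM('a) - 1 + q)) \<partial>perp_lborel e)
      = (\<integral>\<^sup>+z. ennreal (((norm z)\<^sup>2 + t\<^sup>2) powr (- ?p)) \<partial>perp_lborel e)"
  proof (rule nn_integral_cong_AE, use AE_perp_lborel[OF e] in eventually_elim)
    fix z :: 'a assume z: "z \<bullet> e = 0"
    have "norm (z + t *\<^sub>R e) > 0"
      using norm_perp_add_sq[OF e z, of t] t by (metis add_nonneg_pos norm_eq_zero power_zero_numeral zero_le_power2 zero_less_norm_iff zero_less_power2 less_irrefl)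
    moreover have eq: "2 * - ?p = - (real DIM('a) - 1 + q)"
      by (simp add: field_simps)
    ultimately have "((norm z)\<^sup>2 + t\<^sup>2) powr (- ?p) = 1 / norm (z + t *\<^sub>R e) powr (real DIM('a) - 1 + q)"
      unfolding norm_perp_add_sq[OF e z, symmetric]
      using eq by (simp only: powr_numeral[symmetric] powr_powr powr_minus_divide[symmetric])
    then show "ennreal (1 / norm (z + t *\<^sub>R e) powr (real DIM('a) - 1 + q)) = ennreal (((norm z)\<^sup>2 + t\<^sup>2) powr (- ?p))"
      by simp
  qed
  also have "\<dots> = ennreal (pi powr ((real DIM('a) - 1) / 2) * Gamma (?p - (real DIM('a) - 1) / 2) / Gamma ?p
      * (t\<^sup>2) powr (- (?p - (real DIM('a) - 1) / 2)))"
    using nn_integral_gaussian_perp[OF e] D q t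
    by (intro nn_integral_power_of_gaussian sigma_finite_perp_lborel[OF e]) auto
  also have "?p - (real DIM('a) - 1) / 2 = q / 2"
    by (simp add: field_simps)
  also have "(t\<^sup>2) powr (- (q / 2)) = 1 / \<bar>t\<bar> powr q"
  proof -
    have "t\<^sup>2 = \<bar>t\<bar> powr 2" using t by (simp add: powr_numeral)
    then show ?thesis by (simp only: powr_powr) (simp add: powr_minus_divide)
  qed
  finally show ?thesis by (simp add: slice_const_def)
qed

definition strip_along :: "'a::euclidean_space \<Rightarrow> 'a set" where
  "strip_along e = {x. x \<bullet> e \<in> {-1<..<1}}"

lemma borel_strip_along [measurable]: "strip_along e \<in> sets borel"
proof -
  have "open ((\<lambda>x. x \<bullet> e) -` {-1<..<1})"
    by (intro open_vimage continuous_intros)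
  then show ?thesis by (simp add: strip_along_def vimage_def)
qed

subsection \<open>The Gagliardo integral over a strip in slices\<close>

text \<open>The second point is written relative to the first, b = a + z. The kernel then depends on
  the orthogonal variable z alone, and it multiplies the squared L^2 distance between the slice at t
  and a translate of the slice at t'.\<close>

lemma gagliardo_strip:
  fixes e :: "'a::euclidean_space" and u :: "'a \<Rightarrow> real"
  assumes e: "e \<in> Basis" and u[measurable]: "u \<in> borel_measurable borel"
  shows "gagliardo_integral s (strip_along e) u =
    (\<integral>\<^sup>+t. (\<integral>\<^sup>+t'. (\<integral>\<^sup>+z. ennreal (1 / norm (z + (t' - t) *\<^sub>R e) powr (real DIM('a) + 2 * s)) *
        (\<integral>\<^sup>+a. ennreal ((u (a + t *\<^sub>R e) - u (a + z + t' *\<^sub>R e))\<^sup>2) \<partial>perp_lborel e) \<partial>perp_lborel e)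
        * indicator {-1<..<1} t' \<partial>lborel) * indicator {-1<..<1} t \<partial>lborel)"
proof -
  let ?\<mu> = "perp_lborel e" and ?J = "\<lambda>t. indicator {-1<..<1::real} t :: ennreal"
  interpret M: sigma_finite_measure ?\<mu>
    by (rule sigma_finite_perp_lborel[OF e])
  interpret P: pair_sigma_finite lborel ?\<mu> ..
  interpret Q: pair_sigma_finite ?\<mu> ?\<mu> ..
  define F where "F x y = ennreal (1 / norm (y - x) powr (real DIM('a) + 2 * s)) * ennreal ((u x - u y)\<^sup>2)" for x y
  have [measurable]: "case_prod F \<in> borel_measurable (borel \<Otimes>\<^sub>M borel)"
    unfolding F_def[abs_def] by measurable
  \<comment> \<open>Holds for \<open>a\<close> orthogonal to \<open>e\<close>, that is, for almost
    every \<open>a\<close>: the strip condition concerns t alone.\<close>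
  have ind: "indicator (strip_along e) (a + t *\<^sub>R e) = ?J t" if "a \<bullet> e = 0" for a t
    using e that by (simp add: strip_along_def indicator_def inner_add_left)
  define H where "H x = (\<integral>\<^sup>+y. F x y * indicator (strip_along e) y \<partial>lborel)" for x
  let ?B = "\<lambda>t t' a. \<integral>\<^sup>+z. F (a + t *\<^sub>R e) (a + z + t' *\<^sub>R e) \<partial>?\<mu>"
  let ?A = "\<lambda>t t' z. \<integral>\<^sup>+a. F (a + t *\<^sub>R e) (a + z + t' *\<^sub>R e) \<partial>?\<mu>"
  have [measurable]: "H \<in> borel_measurable borel"
    unfolding H_def by measurable
  have H: "H (a + t *\<^sub>R e) = (\<integral>\<^sup>+t'. ?B t t' a * ?J t' \<partial>lborel)"
    if a: "a \<bullet> e = 0" for a t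
  proof -
    have "H (a + t *\<^sub>R e) = (\<integral>\<^sup>+t'. (\<integral>\<^sup>+b. F (a + t *\<^sub>R e) (b + t' *\<^sub>R e) * indicator (strip_along e) (b + t' *\<^sub>R e) \<partial>?\<mu>) \<partial>lborel)"
      unfolding H_def by (rule nn_integral_lborel_perp[OF e]) measurable
    also have "\<dots> = (\<integral>\<^sup>+t'. ?B t t' a * ?J t' \<partial>lborel)"
    proof (rule nn_integral_cong)
      fix t' :: real
      have "(\<integral>\<^sup>+b. F (a + t *\<^sub>R e) (b + t' *\<^sub>R e) * indicator (strip_along e) (b + t' *\<^sub>R e) \<partial>?\<mu>)
          = (\<integral>\<^sup>+b. F (a + t *\<^sub>R e) (b + t' *\<^sub>R e) * ?J t' \<partial>?\<mu>)"
        using AE_perp_lborel[OF e] by (intro nn_integral_cong_AE) (auto simp: ind elim!: eventually_mono)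
      also have "\<dots> = (\<integral>\<^sup>+b. F (a + t *\<^sub>R e) (b + t' *\<^sub>R e) \<partial>?\<mu>) * ?J t'"
        by (rule nn_integral_multc) measurable
      \<comment> \<open>The shift by \<open>a\<close>, orthogonal to \<open>e\<close>, introduces
        the relative variable z.\<close>
      also have "(\<integral>\<^sup>+b. F (a + t *\<^sub>R e) (b + t' *\<^sub>R e) \<partial>?\<mu>) = (\<integral>\<^sup>+z. F (a + t *\<^sub>R e) (z + a + t' *\<^sub>R e) \<partial>?\<mu>)"
        by (rule nn_integral_perp_lborel_translation[OF _ a, symmetric]) measurable
      finally show "(\<integral>\<^sup>+b. F (a + t *\<^sub>R e) (b + t' *\<^sub>R e) * indicator (strip_along e) (b + t' *\<^sub>R e) \<partial>?\<mu>)
          = ?B t t' a * ?J t'"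
        by (simp add: add.commute)
    qed
    finally show ?thesis .
  qed
  have "gagliardo_integral s (strip_along e) u = (\<integral>\<^sup>+x. H x * indicator (strip_along e) x \<partial>lborel)"
    unfolding gagliardo_lborel[OF borel_strip_along] H_def F_def
    by (simp add: ennreal_mult[symmetric] norm_minus_commute)
  also have "\<dots> = (\<integral>\<^sup>+t. (\<integral>\<^sup>+a. H (a + t *\<^sub>R e) * indicator (strip_along e) (a + t *\<^sub>R e) \<partial>?\<mu>) \<partial>lborel)"
    by (rule nn_integral_lborel_perp[OF e]) measurable
  also have "\<dots> = (\<integral>\<^sup>+t. (\<integral>\<^sup>+t'. (\<integral>\<^sup>+z. ?A t t' z \<partial>?\<mu>) * ?J t' \<partial>lborel) * ?J t \<partial>lborel)"
  proof (rule nn_integral_cong)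
    fix t :: real
    have "(\<integral>\<^sup>+a. H (a + t *\<^sub>R e) * indicator (strip_along e) (a + t *\<^sub>R e) \<partial>?\<mu>)
        = (\<integral>\<^sup>+a. (\<integral>\<^sup>+t'. ?B t t' a * ?J t' \<partial>lborel) * ?J t \<partial>?\<mu>)"
      using AE_perp_lborel[OF e] by (intro nn_integral_cong_AE) (auto simp: ind H elim!: eventually_mono)
    also have "\<dots> = (\<integral>\<^sup>+a. (\<integral>\<^sup>+t'. ?B t t' a * ?J t' \<partial>lborel) \<partial>?\<mu>) * ?J t"
      by (rule nn_integral_multc) measurable
    also have "(\<integral>\<^sup>+a. (\<integral>\<^sup>+t'. ?B t t' a * ?J t' \<partial>lborel) \<partial>?\<mu>)
        = (\<integral>\<^sup>+t'. (\<integral>\<^sup>+a. ?B t t' a * ?J t' \<partial>?\<mu>) \<partial>lborel)"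
      by (rule P.Fubini') measurable
    also have "\<dots> = (\<integral>\<^sup>+t'. (\<integral>\<^sup>+z. ?A t t' z \<partial>?\<mu>) * ?J t' \<partial>lborel)"
    proof (rule nn_integral_cong)
      fix t' :: real
      have "(\<integral>\<^sup>+a. ?B t t' a * ?J t' \<partial>?\<mu>)
          = (\<integral>\<^sup>+a. ?B t t' a \<partial>?\<mu>) * ?J t'"
        by (rule nn_integral_multc) measurable
      also have "(\<integral>\<^sup>+a. ?B t t' a \<partial>?\<mu>)
          = (\<integral>\<^sup>+z. ?A t t' z \<partial>?\<mu>)"
        by (rule Q.Fubini') measurable
      finally show "(\<integral>\<^sup>+a. ?B t t' a * ?J t' \<partial>?\<mu>)
        = (\<integral>\<^sup>+z. ?A t t' z \<partial>?\<mu>) * ?J t'" .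
    qed
    finally show "(\<integral>\<^sup>+a. H (a + t *\<^sub>R e) * indicator (strip_along e) (a + t *\<^sub>R e) \<partial>?\<mu>)
        = (\<integral>\<^sup>+t'. (\<integral>\<^sup>+z. ?A t t' z \<partial>?\<mu>) * ?J t' \<partial>lborel) * ?J t" .
  qed
  also have "\<dots> = (\<integral>\<^sup>+t. (\<integral>\<^sup>+t'. (\<integral>\<^sup>+z. ennreal (1 / norm (z + (t' - t) *\<^sub>R e) powr (real DIM('a) + 2 * s)) *
        (\<integral>\<^sup>+a. ennreal ((u (a + t *\<^sub>R e) - u (a + z + t' *\<^sub>R e))\<^sup>2) \<partial>?\<mu>) \<partial>?\<mu>) * ?J t' \<partial>lborel) * ?J t \<partial>lborel)"
  proof (intro nn_integral_cong arg_cong2[where f="(*)"] refl)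
    fix t t' :: real and z :: 'a
    have shift: "a + z + t' *\<^sub>R e - (a + t *\<^sub>R e) = z + (t' - t) *\<^sub>R e" for a
      by (simp add: algebra_simps)
    show "?A t t' z =
        ennreal (1 / norm (z + (t' - t) *\<^sub>R e) powr (real DIM('a) + 2 * s)) *
        (\<integral>\<^sup>+a. ennreal ((u (a + t *\<^sub>R e) - u (a + z + t' *\<^sub>R e))\<^sup>2) \<partial>?\<mu>)"
      unfolding F_def shift by (rule nn_integral_cmult) measurable
  qed
  finally show ?thesis .
qed

lemma slice_const_pos: "n \<ge> 1 \<Longrightarrow> q > 0 \<Longrightarrow> slice_const n q > 0"
  unfolding slice_const_def by (intro divide_pos_pos mult_pos_pos Gamma_real_pos) auto

text \<open>At q = 1 + 2 s the denominator of \<open>slice_const\<close> is the Gamma factor in the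
  numerator of \<open>frac_const\<close>, since n - 1 + (1 + 2 s) = n + 2 s. This cancellation is
  why no dimensional factor separates the two Poincare constants.\<close>

lemma frac_const_slice:
  assumes s: "0 < s" "s < 1" and n: "n \<ge> 1"
  shows "frac_const n s * slice_const n (1 + 2 * s) = frac_const 1 s"
proof -
  have G: "Gamma ((real n + 2 * s) / 2) > 0" "Gamma (1 - s) > 0"
    using s by (auto intro!: Gamma_real_pos)
  have pi: "pi powr (real n / 2) = pi powr ((real n - 1) / 2) * pi powr (1 / 2)"
    by (simp add: powr_add[symmetric] field_simps)
  have cancel: "s * p * g / (x * y * k) * (x * h / g) = s * p * h / (y * k)"
    if "g > 0" "k > 0" "x > 0" "y > 0" for p g x y k h :: real
    using that by (simp add: field_simps)
  show ?thesis
    unfolding frac_const_def slice_const_def pi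
    using cancel[OF G, of "pi powr ((real n - 1) / 2)" "pi powr (1 / 2)" "2 powr (2 * s)" "Gamma ((1 + 2 * s) / 2)"]
    by (simp add: algebra_simps)
qed

subsection \<open>Slice norms of test functions\<close>

lemma integrable_perp_lborel:
  fixes e :: "'a::euclidean_space" and f :: "'a \<Rightarrow> real"
  assumes e: "e \<in> Basis" and [measurable]: "f \<in> borel_measurable borel"
    and f: "\<And>x. \<bar>f x\<bar> \<le> B" "\<And>x. x \<notin> cball 0 r \<Longrightarrow> f x = 0"
  shows "integrable (perp_lborel e) f"
  by (rule integrableI_bounded_set[of "cball 0 r" _ _ B])
    (use f emeasure_perp_lborel_cball[OF e, of r] in auto)

text \<open>Differentiation under the integral by dominated convergence: the difference quotients
  are bounded by a Lipschitz constant and vanish outside a ball that is the same along the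
  sequence.\<close>

lemma perp_integral_has_derivative:
  fixes e :: "'a::euclidean_space" and h :: "'a \<Rightarrow> real"
  assumes e: "e \<in> Basis" and h: "C_diff 1 h" and supp: "\<And>x. x \<notin> cball 0 r \<Longrightarrow> h x = 0"
  shows "((\<lambda>t. LINT a|perp_lborel e. h (a + t *\<^sub>R e)) has_real_derivative
    (LINT a|perp_lborel e. frechet_derivative h (at (a + t *\<^sub>R e)) e)) (at t)"
proof -
  let ?\<mu> = "perp_lborel e" and ?h' = "\<lambda>x. frechet_derivative h (at x) e"
  obtain L where L: "L > 0" "\<And>x y. \<bar>h x - h y\<bar> \<le> L * norm (x - y)"
    using smooth_compact_support_lipschitz[OF h supp] by blast
  have cont: "continuous_on UNIV h" "continuous_on UNIV ?h'"
    using C_diff_continuous[OF h] C_diff_SucD(2)[of 0 h e] h e by auto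
  have [measurable]: "h \<in> borel_measurable borel" "?h' \<in> borel_measurable borel"
    using cont by (auto intro: borel_measurable_continuous_onI)
  obtain B where B: "\<And>x. \<bar>h x\<bar> \<le> B"
    using continuous_support_bounded[OF cont(1) supp] by blast
  have int: "integrable ?\<mu> (\<lambda>a. h (a + t *\<^sub>R e))" for t
  proof (rule integrable_perp_lborel[OF e _ B, of _ "r + \<bar>t\<bar>"])
    fix x :: 'a assume x: "x \<notin> cball 0 (r + \<bar>t\<bar>)"
    have "norm x \<le> norm (x + t *\<^sub>R e) + norm (t *\<^sub>R e)"
      by (metis add_diff_cancel norm_triangle_ineq4)
    then show "h (x + t *\<^sub>R e) = 0" using x e by (intro supp) auto
  qed measurable
  show ?thesis
    unfolding has_field_derivative_iff tendsto_at_iff_sequentially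
  proof (intro allI impI)
    fix X :: "nat \<Rightarrow> real" assume X: "\<forall>i. X i \<in> UNIV - {t}" "X \<longlonglongrightarrow> t"
    let ?q = "\<lambda>i a. (h (a + X i *\<^sub>R e) - h (a + t *\<^sub>R e)) / (X i - t)"
    obtain C where C: "\<And>i. \<bar>X i\<bar> \<le> C"
      using X(2) by (metis convergent_def convergent_imp_Bseq Bseq_def real_norm_def)
    have "(\<lambda>i. LINT a|?\<mu>. ?q i a) \<longlonglongrightarrow> (LINT a|?\<mu>. ?h' (a + t *\<^sub>R e))"
    proof (rule integral_dominated_convergence[where w="\<lambda>a. L * indicator (cball 0 (r + \<bar>t\<bar> + C)) a"])
      show "integrable ?\<mu> (\<lambda>a. L * indicator (cball 0 (r + \<bar>t\<bar> + C)) a)"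
        using emeasure_perp_lborel_cball[OF e, of "r + \<bar>t\<bar> + C"]
        by (intro integrable_mult_right) (auto simp: integrable_indicator_iff)
      show "AE a in ?\<mu>. (\<lambda>i. ?q i a) \<longlonglongrightarrow> ?h' (a + t *\<^sub>R e)"
      proof (intro always_eventually allI)
        fix a
        have "(h has_derivative frechet_derivative h (at (a + t *\<^sub>R e))) (at (a + t *\<^sub>R e))"
          using C_diff_SucD(1)[of 0 h] h by simp
        then have "((\<lambda>t. h (a + t *\<^sub>R e)) has_derivative (\<lambda>k. frechet_derivative h (at (a + t *\<^sub>R e)) (k *\<^sub>R e))) (at t)"
          by (rule has_derivative_compose[rotated]) (auto intro!: derivative_eq_intros)
        moreover have "frechet_derivative h (at (a + t *\<^sub>R e)) (k *\<^sub>R e) = ?h' (a + t *\<^sub>R e) * k" for k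
          using linear_scale[OF linear_frechet_derivative, of h] h by simp
        ultimately have "((\<lambda>t. h (a + t *\<^sub>R e)) has_real_derivative ?h' (a + t *\<^sub>R e)) (at t)"
          by (simp add: has_field_derivative_def)
        then show "(\<lambda>i. ?q i a) \<longlonglongrightarrow> ?h' (a + t *\<^sub>R e)"
          using X unfolding has_field_derivative_iff tendsto_at_iff_sequentially by (simp add: o_def)
      qed
      show "AE a in ?\<mu>. norm (?q i a) \<le> L * indicator (cball 0 (r + \<bar>t\<bar> + C)) a" for i
      proof (intro always_eventually allI)
        fix a
        show "norm (?q i a) \<le> L * indicator (cball 0 (r + \<bar>t\<bar> + C)) a"
        proof (cases "a \<in> cball 0 (r + \<bar>t\<bar> + C)")
          case True
          have "\<bar>h (a + X i *\<^sub>R e) - h (a + t *\<^sub>R e)\<bar> \<le> L * norm ((X i - t) *\<^sub>R e)"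
            using L(2)[of "a + X i *\<^sub>R e" "a + t *\<^sub>R e"] by (simp add: algebra_simps)
          then show ?thesis
            using True e X(1) by (simp add: divide_le_eq)
        next
          case False
          have "h (a + w *\<^sub>R e) = 0" if "\<bar>w\<bar> \<le> \<bar>t\<bar> + C" for w
          proof -
            have "norm a \<le> norm (a + w *\<^sub>R e) + norm (w *\<^sub>R e)"
              by (metis add_diff_cancel norm_triangle_ineq4)
            then show ?thesis using False e that by (intro supp) auto
          qed
          then have "h (a + X i *\<^sub>R e) = 0" "h (a + t *\<^sub>R e) = 0"
            using C[of i] C[of 0] by (auto intro: order_trans)
          then show ?thesis using L(1) by simp
        qed
      qed
    qed measurable
    moreover have "(LINT a|?\<mu>. ?q i a) = ((LINT a|?\<mu>. h (a + X i *\<^sub>R e)) - (LINT a|?\<mu>. h (a + t *\<^sub>R e))) / (X i - t)" for i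
      by (simp only: integral_divide_zero Bochner_Integration.integral_diff[OF int int])
    ultimately show "((\<lambda>y. ((LINT a|?\<mu>. h (a + y *\<^sub>R e)) - (LINT a|?\<mu>. h (a + t *\<^sub>R e))) / (y - t)) \<circ> X)
        \<longlonglongrightarrow> (LINT a|?\<mu>. ?h' (a + t *\<^sub>R e))"
      by (simp only: o_def)
  qed
qed

text \<open>The derivative along \<open>e\<close> is again smooth and vanishes outside the same
  ball, so the induction runs over all such integrands.\<close>

lemma C_diff_perp_integral:
  fixes e :: "'a::euclidean_space" and h :: "'a \<Rightarrow> real"
  assumes e: "e \<in> Basis"
  shows "(\<And>m. C_diff m h) \<Longrightarrow> (\<And>x. x \<notin> cball 0 r \<Longrightarrow> h x = 0) \<Longrightarrow>
    C_diff m (\<lambda>t. LINT a|perp_lborel e. h (a + t *\<^sub>R e))"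
proof (induction m arbitrary: h)
  case 0
  have "continuous_on UNIV (\<lambda>t. LINT a|perp_lborel e. h (a + t *\<^sub>R e))"
    using DERIV_isCont[OF perp_integral_has_derivative[OF e "0.prems"]]
    by (simp add: continuous_at_imp_continuous_on)
  then show ?case by simp
next
  case (Suc m)
  show ?case
  proof (rule C_diff_SucI_real)
    show "C_diff m (\<lambda>t. LINT a|perp_lborel e. frechet_derivative h (at (a + t *\<^sub>R e)) e)"
    proof (rule Suc.IH)
      show "C_diff m (\<lambda>x. frechet_derivative h (at x) e)" for m
        by (rule C_diff_SucD(2)[OF Suc.prems(1) e])
      show "frechet_derivative h (at x) e = 0" if "x \<notin> cball 0 r" for x
        using frechet_derivative_outside_support[OF Suc.prems(2) that] by simp
    qed
  qed (rule perp_integral_has_derivative[OF e Suc.prems])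
qed

text \<open>The derivative of sqrt G contains 1/sqrt G, so the bootstrap is run on W = 1/sqrt G,
  which satisfies W' = -G' W^3 / 2; then sqrt G = G W.\<close>

lemma C_diff_sqrt:
  fixes G :: "real \<Rightarrow> real"
  assumes G: "\<And>m. C_diff m G" and pos: "\<And>x. G x > 0"
  shows "C_diff m (\<lambda>x. sqrt (G x))"
proof -
  obtain G' where der: "\<And>x. (G has_real_derivative G' x) (at x)" and sm: "\<And>m. C_diff m G'"
    using C_diff_real_derivative[OF G] by blast
  define W where "W x = inverse (sqrt (G x))" for x
  have W: "C_diff m W" for m
  proof (rule C_diff_bootstrap)
    show "(W has_real_derivative (- 1 / 2) * (G' x * (W x * (W x * W x)))) (at x)" for x
      unfolding W_def using pos[of x]
      by (auto intro!: derivative_eq_intros der simp: field_simps)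
  qed (intro C_diff_cmult C_diff_mult sm)
  have "sqrt (G x) = G x * W x" for x
    using pos[of x] by (simp add: W_def real_div_sqrt flip: divide_inverse)
  then show ?thesis
    using C_diff_mult[OF G W] by simp
qed

text \<open>After expanding the squares the claim is the Cauchy-Schwarz inequality for the mixed
  integral.\<close>

lemma L2_reverse_triangle:
  assumes [measurable]: "f \<in> borel_measurable M" "g \<in> borel_measurable M"
    and if2: "integrable M (\<lambda>x. (f x)\<^sup>2)" and ig2: "integrable M (\<lambda>x. (g x :: real)\<^sup>2)"
  shows "(sqrt (LINT x|M. (f x)\<^sup>2) - sqrt (LINT x|M. (g x)\<^sup>2))\<^sup>2 \<le> (LINT x|M. (f x - g x)\<^sup>2)"
proof -
  let ?F = "LINT x|M. (f x)\<^sup>2" and ?G = "LINT x|M. (g x)\<^sup>2"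
  have ifg: "integrable M (\<lambda>x. f x * g x)"
  proof (rule Bochner_Integration.integrable_bound[OF Bochner_Integration.integrable_add[OF if2 ig2]])
    have "\<bar>f x * g x\<bar> \<le> (f x)\<^sup>2 + (g x)\<^sup>2" for x
      using sum_squares_bound[of "\<bar>f x\<bar>" "\<bar>g x\<bar>"] mult_nonneg_nonneg[OF abs_ge_zero abs_ge_zero, of "f x" "g x"]
      unfolding abs_mult mult.assoc power2_abs by linarith
    then show "AE x in M. norm (f x * g x) \<le> norm ((f x)\<^sup>2 + (g x)\<^sup>2)"
      by (auto intro!: always_eventually order_trans[OF _ abs_ge_self])
  qed measurable
  have nn: "?F \<ge> 0" "?G \<ge> 0"
    by (auto intro!: Bochner_Integration.integral_nonneg)
  have "(\<integral>\<^sup>+x. ennreal \<bar>f x\<bar> * ennreal \<bar>g x\<bar> \<partial>M)\<^sup>2 \<le> (\<integral>\<^sup>+x. (ennreal \<bar>f x\<bar>)\<^sup>2 \<partial>M) * (\<integral>\<^sup>+x. (ennreal \<bar>g x\<bar>)\<^sup>2 \<partial>M)"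
    by (rule Cauchy_Schwarz_nn_integral) measurable
  also have "\<dots> = ennreal (?F * ?G)"
    using if2 ig2 nn by (simp add: ennreal_power nn_integral_eq_integral ennreal_mult)
  also have "(\<integral>\<^sup>+x. ennreal \<bar>f x\<bar> * ennreal \<bar>g x\<bar> \<partial>M) = ennreal (LINT x|M. \<bar>f x * g x\<bar>)"
    using ifg by (simp add: ennreal_mult[symmetric] abs_mult[symmetric] nn_integral_eq_integral)
  finally have "(LINT x|M. \<bar>f x * g x\<bar>)\<^sup>2 \<le> ?F * ?G"
    using nn by (simp add: ennreal_power)
  then have "(LINT x|M. \<bar>f x * g x\<bar>) \<le> sqrt (?F * ?G)"
    by (rule real_le_rsqrt)
  moreover have "(LINT x|M. f x * g x) \<le> (LINT x|M. \<bar>f x * g x\<bar>)"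
    using ifg by (intro integral_mono) auto
  moreover have "(LINT x|M. (f x - g x)\<^sup>2) = ?F + ?G - 2 * (LINT x|M. f x * g x)"
    using if2 ig2 ifg by (simp add: power2_diff mult.assoc)
  ultimately show ?thesis
    using nn by (simp add: power2_diff real_sqrt_mult)
qed

text \<open>sqrt (c^2 + A) is the modulus of the complex number c + i sqrt A, so this is the reverse
  triangle inequality in the plane.\<close>

lemma sqrt_shift_contraction:
  fixes A B c :: real
  assumes "A \<ge> 0" "B \<ge> 0" "c > 0"
  shows "(sqrt (c\<^sup>2 + A) - sqrt (c\<^sup>2 + B))\<^sup>2 \<le> (sqrt A - sqrt B)\<^sup>2"
proof -
  have "sqrt (c\<^sup>2 + A) = norm (Complex c (sqrt A))" "sqrt (c\<^sup>2 + B) = norm (Complex c (sqrt B))"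
    using assms by (simp_all add: cmod_def)
  moreover have "\<bar>norm (Complex c (sqrt A)) - norm (Complex c (sqrt B))\<bar> \<le> norm (Complex c (sqrt A) - Complex c (sqrt B))"
    by (rule norm_triangle_ineq3)
  moreover have "norm (Complex c (sqrt A) - Complex c (sqrt B)) = \<bar>sqrt A - sqrt B\<bar>"
    by (simp add: cmod_def)
  ultimately show ?thesis
    by (metis abs_le_square_iff abs_idempotent)
qed

section \<open>Basic facts on test functions\<close>

lemma test_functionsE:
  assumes "\<phi> \<in> test_functions \<Omega>"
  obtains K where "compact K" "K \<subseteq> \<Omega>" "\<And>x. x \<notin> K \<Longrightarrow> \<phi> x = 0"
proof (rule that[of "closure {x. \<phi> x \<noteq> 0}"])
  show "\<phi> x = 0" if "x \<notin> closure {x. \<phi> x \<noteq> 0}" for x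
    using that closure_subset[of "{x. \<phi> x \<noteq> 0}"] by blast
qed (use assms in \<open>auto simp: test_functions_def\<close>)

lemma test_functionsI:
  assumes "\<And>m. C_diff m \<phi>" "compact K" "K \<subseteq> \<Omega>" "\<And>x. x \<notin> K \<Longrightarrow> \<phi> x = 0"
  shows "\<phi> \<in> test_functions \<Omega>"
proof -
  have "closure {x. \<phi> x \<noteq> 0} \<subseteq> K"
    using assms by (intro closure_minimal compact_imp_closed) auto
  moreover from this have "compact (closure {x. \<phi> x \<noteq> 0})"
    using assms(2) by (metis bounded_subset closed_closure compact_eq_bounded_closed)
  ultimately show ?thesis
    using assms by (auto simp: test_functions_def)
qed

lemma test_functions_smooth: "\<phi> \<in> test_functions \<Omega> \<Longrightarrow> C_diff m \<phi>"
  by (simp add: test_functions_def)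

lemma test_functions_borel: "\<phi> \<in> test_functions \<Omega> \<Longrightarrow> \<phi> \<in> borel_measurable borel"
  using C_diff_continuous[OF test_functions_smooth] by (rule borel_measurable_continuous_onI)

lemma test_functions_bounded:
  fixes \<phi> :: "'a::euclidean_space \<Rightarrow> real"
  assumes "\<phi> \<in> test_functions \<Omega>"
  obtains B r where "\<And>x. \<bar>\<phi> x\<bar> \<le> B" "\<And>x. x \<notin> cball 0 r \<Longrightarrow> \<phi> x = 0"
proof -
  obtain K where K': "compact K" "K \<subseteq> \<Omega>" "\<And>x. x \<notin> K \<Longrightarrow> \<phi> x = 0"
    using test_functionsE[OF assms] by blast
  note K = K'(1,3)
  obtain r where r: "K \<subseteq> cball 0 r"
    using compact_imp_bounded[OF K(1)] by (auto simp: bounded_iff subset_eq)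
  have supp: "\<phi> x = 0" if "x \<notin> cball 0 r" for x
    using K(2) r that by blast
  obtain B where "B \<ge> 0" and B: "\<And>x. \<bar>\<phi> x\<bar> \<le> B"
    using continuous_support_bounded[OF C_diff_continuous[OF test_functions_smooth[OF assms]] supp] by blast
  show ?thesis
    by (rule that[OF B supp])
qed

lemma integral_lebesgue_on_lborel:
  fixes f :: "'a::euclidean_space \<Rightarrow> real"
  assumes \<Omega>: "\<Omega> \<in> sets borel" and [measurable]: "f \<in> borel_measurable borel" and f: "\<And>x. f x \<ge> 0"
  shows "(LINT x|lebesgue_on \<Omega>. f x) = enn2real (\<integral>\<^sup>+x. ennreal (f x) * indicator \<Omega> x \<partial>lborel)"
proof -
  have "f \<in> borel_measurable (lebesgue_on \<Omega>)"
    by (intro measurable_restrict_space1 measurable_completion) simp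
  then have "(LINT x|lebesgue_on \<Omega>. f x) = enn2real (\<integral>\<^sup>+x. ennreal (f x) \<partial>lebesgue_on \<Omega>)"
    using f by (intro integral_eq_nn_integral) auto
  then show ?thesis by (simp add: nn_integral_lebesgue_on[OF \<Omega>])
qed

lemma test_function_L2:
  fixes \<phi> :: "'a::euclidean_space \<Rightarrow> real"
  assumes \<phi>: "\<phi> \<in> test_functions \<Omega>" and \<Omega>: "\<Omega> \<in> sets borel"
  shows "(\<integral>\<^sup>+x. ennreal ((\<phi> x)\<^sup>2) * indicator \<Omega> x \<partial>lborel) < \<infinity>"
proof -
  obtain B r where B: "\<And>x. \<bar>\<phi> x\<bar> \<le> B" "\<And>x. x \<notin> cball 0 r \<Longrightarrow> \<phi> x = 0"
    using test_functions_bounded[OF \<phi>] by blast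
  have "(\<integral>\<^sup>+x. ennreal ((\<phi> x)\<^sup>2) * indicator \<Omega> x \<partial>lborel) \<le> (\<integral>\<^sup>+(x::'a). ennreal (B\<^sup>2) * indicator (cball 0 r) x \<partial>lborel)"
  proof (rule nn_integral_mono)
    fix x :: 'a
    have "(\<phi> x)\<^sup>2 \<le> B\<^sup>2"
      using B(1)[of x] by (simp add: abs_le_square_iff[symmetric])
    then show "ennreal ((\<phi> x)\<^sup>2) * indicator \<Omega> x \<le> ennreal (B\<^sup>2) * indicator (cball 0 r) x"
      using B(2)[of x] by (auto simp: indicator_def ennreal_leI)
  qed
  also have "\<dots> = ennreal (B\<^sup>2) * emeasure lborel (cball 0 r :: 'a set)"
    by (rule nn_integral_cmult_indicator) simp
  also have "\<dots> < \<infinity>"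
    using emeasure_bounded_finite[of "cball 0 r :: 'a set"] by (simp add: ennreal_mult_less_top)
  finally show ?thesis .
qed

lemma test_function_in_sobolev_space:
  fixes \<phi> :: "'a::euclidean_space \<Rightarrow> real"
  assumes \<phi>: "\<phi> \<in> test_functions \<Omega>" and \<Omega>: "\<Omega> \<in> sets borel" and G: "gagliardo_integral s \<Omega> \<phi> < \<infinity>"
  shows "\<phi> \<in> sobolev_space s \<Omega>"
proof -
  have m: "\<phi> \<in> borel_measurable (lebesgue_on \<Omega>)"
    using test_functions_borel[OF \<phi>] by (intro measurable_restrict_space1 measurable_completion) simp
  have "(\<integral>\<^sup>+x. ennreal ((\<phi> x)\<^sup>2) \<partial>lebesgue_on \<Omega>) < \<infinity>"
    using test_function_L2[OF \<phi> \<Omega>] by (simp add: nn_integral_lebesgue_on[OF \<Omega>])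
  then have "integrable (lebesgue_on \<Omega>) (\<lambda>x. (\<phi> x)\<^sup>2)"
    using m by (intro integrableI_nonneg) auto
  with m G show ?thesis by (simp add: sobolev_space_def)
qed

section \<open>From the interval to the strip: slices of a test function\<close>

text \<open>Squared, because the square depends smoothly on t.\<close>

definition slice_norm_sq :: "'a::euclidean_space \<Rightarrow> ('a \<Rightarrow> real) \<Rightarrow> real \<Rightarrow> real" where
  "slice_norm_sq e u t = (LINT a|perp_lborel e. (u (a + t *\<^sub>R e))\<^sup>2)"

lemma slice_norm_sq_nonneg: "slice_norm_sq e u t \<ge> 0"
  unfolding slice_norm_sq_def by (rule Bochner_Integration.integral_nonneg) simp

locale strip_test_function =
  fixes e :: "'a::euclidean_space" and u :: "'a \<Rightarrow> real"
  assumes e: "e \<in> Basis" and u: "u \<in> test_functions (strip_along e)"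
begin

lemma u_borel [measurable]: "u \<in> borel_measurable borel"
  using test_functions_borel[OF u] .

lemma integrable_slice: "integrable (perp_lborel e) (\<lambda>a. (u (a + c))\<^sup>2)"
proof -
  obtain B r where B: "\<And>x. \<bar>u x\<bar> \<le> B" "\<And>x. x \<notin> cball 0 r \<Longrightarrow> u x = 0"
    using test_functions_bounded[OF u] by blast
  show ?thesis
  proof (rule integrable_perp_lborel[OF e, of _ "B\<^sup>2" "r + norm c"])
    show "\<bar>(u (a + c))\<^sup>2\<bar> \<le> B\<^sup>2" for a
      using B(1)[of "a + c"] by (simp add: abs_le_square_iff[symmetric])
    fix a :: 'a assume a: "a \<notin> cball 0 (r + norm c)"
    have "norm a \<le> norm (a + c) + norm c"
      by (metis add_diff_cancel norm_triangle_ineq4)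
    then show "(u (a + c))\<^sup>2 = 0" using a B(2)[of "a + c"] by auto
  qed measurable
qed

lemma slice_norm_sq_shift:
  assumes z: "z \<bullet> e = 0"
  shows "(LINT a|perp_lborel e. (u (a + z + t *\<^sub>R e))\<^sup>2) = slice_norm_sq e u t"
proof -
  have "(\<integral>\<^sup>+a. ennreal ((u (a + z + t *\<^sub>R e))\<^sup>2) \<partial>perp_lborel e) = (\<integral>\<^sup>+a. ennreal ((u (a + t *\<^sub>R e))\<^sup>2) \<partial>perp_lborel e)"
    by (rule nn_integral_perp_lborel_translation[OF _ z]) measurable
  then show ?thesis
    unfolding slice_norm_sq_def
    by (subst (1 2) integral_eq_nn_integral) auto
qed

lemma C_diff_slice_norm_sq: "C_diff m (slice_norm_sq e u)"
proof -
  obtain B r where B: "\<And>x. \<bar>u x\<bar> \<le> B" "\<And>x. x \<notin> cball 0 r \<Longrightarrow> u x = 0"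
    using test_functions_bounded[OF u] by blast
  have "C_diff m (\<lambda>t. LINT a|perp_lborel e. (\<lambda>x. u x * u x) (a + t *\<^sub>R e))"
    by (rule C_diff_perp_integral[OF e, of "\<lambda>x. u x * u x" r])
      (auto intro!: C_diff_mult test_functions_smooth[OF u] simp del: mem_cball_0 simp: B(2))
  then show ?thesis by (simp add: slice_norm_sq_def[abs_def] power2_eq_square)
qed

lemma borel_slice_norm_sq [measurable]: "slice_norm_sq e u \<in> borel_measurable borel"
  using C_diff_continuous[OF C_diff_slice_norm_sq] by (rule borel_measurable_continuous_onI)

text \<open>The projection of a compact subset of the strip to the direction \<open>e\<close> is
  compact in the open interval.\<close>

lemma slice_norm_sq_support:
  obtains K where "compact K" "K \<subseteq> {-1<..<1}" "\<And>t. t \<notin> K \<Longrightarrow> slice_norm_sq e u t = 0"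
proof -
  obtain K where K: "compact K" "K \<subseteq> strip_along e" "\<And>x. x \<notin> K \<Longrightarrow> u x = 0"
    using test_functionsE[OF u] by blast
  let ?K = "(\<lambda>x. x \<bullet> e) ` K"
  have "slice_norm_sq e u t = 0" if t: "t \<notin> ?K" for t
  proof -
    have "slice_norm_sq e u t = (LINT a|perp_lborel e. 0)"
      unfolding slice_norm_sq_def
    proof (rule integral_cong_AE)
      show "AE a in perp_lborel e. (u (a + t *\<^sub>R e))\<^sup>2 = 0"
        using AE_perp_lborel[OF e]
      proof eventually_elim
        fix a assume a: "a \<bullet> e = 0"
        have "(a + t *\<^sub>R e) \<bullet> e = t" using e a by (simp add: inner_add_left)
        then have "a + t *\<^sub>R e \<notin> K" using t by (metis image_eqI)
        then show "(u (a + t *\<^sub>R e))\<^sup>2 = 0" using K(3) by simp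
      qed
    qed measurable
    then show ?thesis by simp
  qed
  moreover have "compact ?K"
    using K(1) by (intro compact_continuous_image continuous_intros)
  moreover have "?K \<subseteq> {-1<..<1}"
    using K(2) by (auto simp: strip_along_def)
  ultimately show ?thesis using that by blast
qed

lemma L2_slice:
  "L2_sq (strip_along e) u = (LINT t|lebesgue_on {-1<..<1}. slice_norm_sq e u t)"
proof -
  have "(\<integral>\<^sup>+x. ennreal ((u x)\<^sup>2) * indicator (strip_along e) x \<partial>lborel)
      = (\<integral>\<^sup>+t. (\<integral>\<^sup>+a. ennreal ((u (a + t *\<^sub>R e))\<^sup>2) * indicator (strip_along e) (a + t *\<^sub>R e) \<partial>perp_lborel e) \<partial>lborel)"
    by (rule nn_integral_lborel_perp[OF e]) measurable
  also have "\<dots> = (\<integral>\<^sup>+t. ennreal (slice_norm_sq e u t) * indicator {-1<..<1} t \<partial>lborel)"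
  proof (rule nn_integral_cong)
    fix t :: real
    have "(\<integral>\<^sup>+a. ennreal ((u (a + t *\<^sub>R e))\<^sup>2) * indicator (strip_along e) (a + t *\<^sub>R e) \<partial>perp_lborel e)
        = (\<integral>\<^sup>+a. ennreal ((u (a + t *\<^sub>R e))\<^sup>2) * indicator {-1<..<1} t \<partial>perp_lborel e)"
      using AE_perp_lborel[OF e] e
      by (intro nn_integral_cong_AE) (auto simp: strip_along_def indicator_def inner_add_left elim!: eventually_mono)
    also have "\<dots> = (\<integral>\<^sup>+a. ennreal ((u (a + t *\<^sub>R e))\<^sup>2) \<partial>perp_lborel e) * indicator {-1<..<1} t"
      by (rule nn_integral_multc) measurable
    also have "(\<integral>\<^sup>+a. ennreal ((u (a + t *\<^sub>R e))\<^sup>2) \<partial>perp_lborel e) = ennreal (slice_norm_sq e u t)"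
      unfolding slice_norm_sq_def using integrable_slice by (intro nn_integral_eq_integral) auto
    finally show "(\<integral>\<^sup>+a. ennreal ((u (a + t *\<^sub>R e))\<^sup>2) * indicator (strip_along e) (a + t *\<^sub>R e) \<partial>perp_lborel e)
        = ennreal (slice_norm_sq e u t) * indicator {-1<..<1} t" .
  qed
  finally show ?thesis
    by (simp add: integral_lebesgue_on_lborel borel_strip_along slice_norm_sq_nonneg)
qed

text \<open>The square root of \<^term>\<open>slice_norm_sq e u\<close> need not be smooth where it vanishes.\<close>

definition smooth_slice_norm :: "real \<Rightarrow> real \<Rightarrow> real" where
  "smooth_slice_norm c t = sqrt (c\<^sup>2 + slice_norm_sq e u t) - c"

lemma smooth_slice_norm_test_function:
  assumes c: "c > 0"
  shows "smooth_slice_norm c \<in> test_functions {-1<..<1}"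
proof -
  obtain K where K: "compact K" "K \<subseteq> {-1<..<1}" "\<And>t. t \<notin> K \<Longrightarrow> slice_norm_sq e u t = 0"
    using slice_norm_sq_support by blast
  show ?thesis
  proof (rule test_functionsI[OF _ K(1,2)])
    show "C_diff m (smooth_slice_norm c)" for m
      unfolding smooth_slice_norm_def using c slice_norm_sq_nonneg[of e u]
      by (intro C_diff_diff C_diff_sqrt C_diff_add C_diff_const C_diff_slice_norm_sq) (auto intro: add_pos_nonneg)
    show "smooth_slice_norm c t = 0" if "t \<notin> K" for t
      using K(3)[OF that] c by (simp add: smooth_slice_norm_def)
  qed
qed

text \<open>The inequality holds for each pair t, t' before integration: the difference of slice
  norms does not depend on z and bounds the L^2 distance of the translated slices from below, and
  the kernel integrates over z to a multiple of the one-dimensional one.\<close>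

lemma gagliardo_smooth_slice_norm:
  assumes c: "c > 0" and s: "0 < s"
  shows "ennreal (slice_const DIM('a) (1 + 2 * s)) * gagliardo_integral s {-1<..<1} (smooth_slice_norm c)
    \<le> gagliardo_integral s (strip_along e) u"
proof -
  let ?\<mu> = "perp_lborel e" and ?C = "slice_const DIM('a) (1 + 2 * s)"
  have [measurable]: "smooth_slice_norm c \<in> borel_measurable borel"
    using smooth_slice_norm_test_function[OF c] test_functions_borel by blast
  have C: "?C > 0"
    using s by (intro slice_const_pos) (auto simp: DIM_positive Suc_leI)
  have pt: "ennreal ?C * ennreal (\<bar>smooth_slice_norm c t - smooth_slice_norm c t'\<bar>\<^sup>2 / norm (t - t') powr (1 + 2 * s))
      \<le> (\<integral>\<^sup>+z. ennreal (1 / norm (z + (t' - t) *\<^sub>R e) powr (real DIM('a) + 2 * s)) *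
        (\<integral>\<^sup>+a. ennreal ((u (a + t *\<^sub>R e) - u (a + z + t' *\<^sub>R e))\<^sup>2) \<partial>?\<mu>) \<partial>?\<mu>)" for t t'
  proof (cases "t = t'")
    case False
    let ?k = "\<lambda>z. ennreal (1 / norm (z + (t' - t) *\<^sub>R e) powr (real DIM('a) + 2 * s))"
    have "ennreal ?C * ennreal (\<bar>smooth_slice_norm c t - smooth_slice_norm c t'\<bar>\<^sup>2 / norm (t - t') powr (1 + 2 * s))
        = ennreal (?C / \<bar>t' - t\<bar> powr (1 + 2 * s)) * ennreal ((smooth_slice_norm c t - smooth_slice_norm c t')\<^sup>2)"
      using C by (simp add: ennreal_mult[symmetric] abs_minus_commute[of t])
    also have "\<dots> = (\<integral>\<^sup>+z. ?k z \<partial>?\<mu>) * ennreal ((smooth_slice_norm c t - smooth_slice_norm c t')\<^sup>2)"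
      using nn_integral_kernel_slice[OF e, of "1 + 2 * s" "t' - t"] False s by simp
    also have "\<dots> = (\<integral>\<^sup>+z. ?k z * ennreal ((smooth_slice_norm c t - smooth_slice_norm c t')\<^sup>2) \<partial>?\<mu>)"
      by (rule nn_integral_multc[symmetric]) measurable
    also have "\<dots> \<le> (\<integral>\<^sup>+z. ?k z * (\<integral>\<^sup>+a. ennreal ((u (a + t *\<^sub>R e) - u (a + z + t' *\<^sub>R e))\<^sup>2) \<partial>?\<mu>) \<partial>?\<mu>)"
    proof (rule nn_integral_mono_AE, use AE_perp_lborel[OF e] in eventually_elim)
      fix z :: 'a assume z: "z \<bullet> e = 0"
      let ?f = "\<lambda>a. u (a + t *\<^sub>R e)" and ?g = "\<lambda>a. u (a + z + t' *\<^sub>R e)"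
      have if2: "integrable ?\<mu> (\<lambda>a. (?f a)\<^sup>2)" and ig2: "integrable ?\<mu> (\<lambda>a. (?g a)\<^sup>2)"
        using integrable_slice[of "t *\<^sub>R e"] integrable_slice[of "z + t' *\<^sub>R e"] by (simp_all add: add.assoc)
      \<comment> \<open>Regularising with c is a contraction on slice norms, and translating the
        slice at t' by z leaves its norm unchanged.\<close>
      have "(smooth_slice_norm c t - smooth_slice_norm c t')\<^sup>2 \<le> (sqrt (slice_norm_sq e u t) - sqrt (slice_norm_sq e u t'))\<^sup>2"
        using sqrt_shift_contraction[OF slice_norm_sq_nonneg slice_norm_sq_nonneg c] by (simp add: smooth_slice_norm_def)
      also have "\<dots> = (sqrt (LINT a|?\<mu>. (?f a)\<^sup>2) - sqrt (LINT a|?\<mu>. (?g a)\<^sup>2))\<^sup>2"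
        using slice_norm_sq_shift[OF z, of t'] by (simp add: slice_norm_sq_def)
      also have "\<dots> \<le> (LINT a|?\<mu>. (?f a - ?g a)\<^sup>2)"
        by (rule L2_reverse_triangle) (use if2 ig2 in measurable)
      finally have "ennreal ((smooth_slice_norm c t - smooth_slice_norm c t')\<^sup>2) \<le> ennreal (LINT a|?\<mu>. (?f a - ?g a)\<^sup>2)"
        by (rule ennreal_leI)
      also have "\<dots> = (\<integral>\<^sup>+a. ennreal ((?f a - ?g a)\<^sup>2) \<partial>?\<mu>)"
      proof (rule nn_integral_eq_integral[symmetric])
        have "integrable ?\<mu> (\<lambda>a. (?f a + - ?g a)\<^sup>2)"
          by (rule L2_add_le(1)[OF _ _ zero_less_one]) (use if2 ig2 in \<open>simp_all\<close>)
        then show "integrable ?\<mu> (\<lambda>a. (?f a - ?g a)\<^sup>2)" by simp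
      qed auto
      finally show "?k z * ennreal ((smooth_slice_norm c t - smooth_slice_norm c t')\<^sup>2) \<le> ?k z * (\<integral>\<^sup>+a. ennreal ((?f a - ?g a)\<^sup>2) \<partial>?\<mu>)"
        by (rule mult_left_mono) simp
    qed
    finally show ?thesis .
  qed simp
  have "ennreal ?C * gagliardo_integral s {-1<..<1} (smooth_slice_norm c)
      = (\<integral>\<^sup>+t. (\<integral>\<^sup>+t'. ennreal ?C * ennreal (\<bar>smooth_slice_norm c t - smooth_slice_norm c t'\<bar>\<^sup>2 / norm (t - t') powr (1 + 2 * s)) * indicator {-1<..<1} t' \<partial>lborel)
        * indicator {-1<..<1} t \<partial>lborel)"
    by (simp add: gagliardo_lborel nn_integral_cmult mult.assoc)
  also have "\<dots> \<le> gagliardo_integral s (strip_along e) u"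
    unfolding gagliardo_strip[OF e u_borel]
    by (intro nn_integral_mono mult_right_mono pt) auto
  finally show ?thesis .
qed

text \<open>The interval inequality is applied to \<open>smooth_slice_norm c\<close>, whose energy
  is controlled by that of \<open>u\<close>; the loss in the L^2 norm vanishes as c tends to
  0.\<close>

lemma poincare_interval_to_strip:
  assumes s: "0 < s" "s < 1" and \<gamma>: "0 \<le> \<gamma>" and uS: "u \<in> sobolev_space s (strip_along e)"
    and interval: "\<And>\<phi>. \<phi> \<in> test_functions {-1<..<1::real} \<inter> sobolev_space s {-1<..<1} \<Longrightarrow>
      \<gamma> * L2_sq {-1<..<1} \<phi> \<le> (frac_seminorm s {-1<..<1} \<phi>)\<^sup>2"
  shows "\<gamma> * L2_sq (strip_along e) u \<le> (frac_seminorm s (strip_along e) u)\<^sup>2"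
proof -
  let ?C = "slice_const DIM('a) (1 + 2 * s)" and ?G = "slice_norm_sq e u"
  let ?L = "lebesgue_on {-1<..<1::real}"
  have C: "?C > 0"
    using s by (intro slice_const_pos) (auto simp: DIM_positive Suc_leI)
  have fin: "gagliardo_integral s (strip_along e) u < \<infinity>"
    using sobolev_spaceD[OF uS] by simp
  obtain K where K: "compact K" "K \<subseteq> {-1<..<1}" "\<And>t. t \<notin> K \<Longrightarrow> ?G t = 0"
    using slice_norm_sq_support by blast
  have "?G t = 0" if "t \<notin> cball 0 1" for t
    using K(2,3) that by force
  then obtain B0 where B0: "B0 \<ge> 0" "\<And>t. \<bar>?G t\<bar> \<le> B0"
    using continuous_support_bounded[OF C_diff_continuous[OF C_diff_slice_norm_sq]] by blast
  define B where "B = sqrt B0"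
  have B: "sqrt (?G t) \<le> B" for t
    unfolding B_def using B0(2)[of t] by simp
  have mL: "f \<in> borel_measurable ?L" if "f \<in> borel_measurable borel" for f :: "real \<Rightarrow> real"
    using that by (intro measurable_restrict_space1 measurable_completion) simp
  have emL: "emeasure ?L (space ?L) = 2"
    by (subst emeasure_restrict_space) auto
  have intG: "integrable ?L ?G"
  proof (rule integrableI_bounded_set[where A="{-1<..<1}" and B="B\<^sup>2"])
    have "?G t \<le> B\<^sup>2" for t
      using power_mono[OF B[of t], of 2] slice_norm_sq_nonneg[of e u t] by simp
    then show "AE t in ?L. t \<in> {-1<..<1} \<longrightarrow> norm (?G t) \<le> B\<^sup>2"
      by (intro always_eventually) (auto simp: slice_norm_sq_nonneg)
  qed (use emL in \<open>auto intro!: mL simp: emeasure_restrict_space space_restrict_space\<close>)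
  \<comment> \<open>Here 4 c B is the pointwise error 2 c B times the length 2 of the
    interval.\<close>
  have main: "\<gamma> * ((LINT t|?L. ?G t) - 4 * c * B) \<le> (frac_seminorm s (strip_along e) u)\<^sup>2" if c: "c > 0" for c
  proof -
    have le: "ennreal ?C * gagliardo_integral s {-1<..<1} (smooth_slice_norm c) \<le> gagliardo_integral s (strip_along e) u"
      by (rule gagliardo_smooth_slice_norm[OF c s(1)])
    then have "ennreal ?C * gagliardo_integral s {-1<..<1} (smooth_slice_norm c) < \<infinity>"
      using fin by (rule le_less_trans)
    then have finU: "gagliardo_integral s {-1<..<1} (smooth_slice_norm c) < \<infinity>"
      using C by (auto simp: ennreal_mult_less_top)
    then have US: "smooth_slice_norm c \<in> test_functions {-1<..<1} \<inter> sobolev_space s {-1<..<1}"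
      using test_function_in_sobolev_space[OF smooth_slice_norm_test_function[OF c]] smooth_slice_norm_test_function[OF c] by simp
    have "enn2real (ennreal ?C * gagliardo_integral s {-1<..<1} (smooth_slice_norm c)) \<le> enn2real (gagliardo_integral s (strip_along e) u)"
      using le fin by (intro enn2real_mono) auto
    then have "frac_const DIM('a) s / 2 * (?C * enn2real (gagliardo_integral s {-1<..<1} (smooth_slice_norm c)))
        \<le> frac_const DIM('a) s / 2 * enn2real (gagliardo_integral s (strip_along e) u)"
      using C frac_const_pos[OF s, of "DIM('a)"] by (intro mult_left_mono) (auto simp: enn2real_mult)
    moreover have "frac_const DIM('a) s / 2 * (?C * enn2real (gagliardo_integral s {-1<..<1} (smooth_slice_norm c)))
        = (frac_seminorm s {-1<..<1} (smooth_slice_norm c))\<^sup>2"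
      unfolding frac_seminorm_sq[OF s] using frac_const_slice[OF s, of "DIM('a)", symmetric]
      by (simp add: DIM_positive Suc_leI)
    ultimately have semi: "(frac_seminorm s {-1<..<1} (smooth_slice_norm c))\<^sup>2 \<le> (frac_seminorm s (strip_along e) u)\<^sup>2"
      unfolding frac_seminorm_sq[OF s, of "strip_along e"] by simp
    have U2: "integrable ?L (\<lambda>t. (smooth_slice_norm c t)\<^sup>2)"
      using US sobolev_spaceD by blast
    \<comment> \<open>The regularised norm is at least g - c for the slice norm g; where g < c the
      left side is already nonpositive.\<close>
    have ptw: "?G t - 2 * c * B \<le> (smooth_slice_norm c t)\<^sup>2" for t
    proof -
      define g where "g = sqrt (?G t)"
      have g: "g \<ge> 0" "?G t = g\<^sup>2" "g \<le> B"
        using slice_norm_sq_nonneg[of e u t] B[of t] by (auto simp: g_def)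
      have cB: "c * g \<le> c * B" using g c by simp
      show ?thesis
      proof (cases "g \<ge> c")
        case True
        have "smooth_slice_norm c t \<ge> g - c"
          unfolding smooth_slice_norm_def g(2) using c by (simp add: real_le_rsqrt)
        then have "(g - c)\<^sup>2 \<le> (smooth_slice_norm c t)\<^sup>2"
          using True by (intro power_mono) auto
        then have "g\<^sup>2 + c\<^sup>2 - 2 * (c * g) \<le> (smooth_slice_norm c t)\<^sup>2"
          by (simp add: power2_diff algebra_simps)
        moreover have "c\<^sup>2 \<ge> 0" by simp
        ultimately show ?thesis
          using cB unfolding g(2) by linarith
      next
        case False
        then have "g\<^sup>2 \<le> c * g" using g by (simp add: power2_eq_square mult_right_mono)
        then have "g\<^sup>2 - 2 * c * B \<le> 0"
          using cB mult_nonneg_nonneg[of c g] c g by linarith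
        then show ?thesis unfolding g(2) by (meson order_trans zero_le_power2)
      qed
    qed
    have fm: "finite_measure ?L"
      using emL by (intro finite_measureI) simp
    have mu: "measure ?L (space ?L) = 2"
      using emL by (simp add: measure_def)
    have "(LINT t|?L. ?G t) - 4 * c * B = (LINT t|?L. ?G t - 2 * c * B)"
      using intG mu finite_measure.integrable_const[OF fm] by (subst Bochner_Integration.integral_diff) auto
    also have "\<dots> \<le> (LINT t|?L. (smooth_slice_norm c t)\<^sup>2)"
      using intG U2 ptw finite_measure.integrable_const[OF fm]
      by (intro integral_mono Bochner_Integration.integrable_diff) auto
    finally have "\<gamma> * ((LINT t|?L. ?G t) - 4 * c * B) \<le> \<gamma> * (LINT t|?L. (smooth_slice_norm c t)\<^sup>2)"
      using \<gamma> by (rule mult_left_mono)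
    also have "\<dots> \<le> (frac_seminorm s {-1<..<1} (smooth_slice_norm c))\<^sup>2"
      by (rule interval[OF US])
    finally show ?thesis using semi by simp
  qed
  have "((\<lambda>c. \<gamma> * ((LINT t|?L. ?G t) - 4 * c * B)) \<longlongrightarrow> \<gamma> * ((LINT t|?L. ?G t) - 4 * 0 * B)) (at_right 0)"
    by (intro tendsto_intros)
  then have "\<gamma> * ((LINT t|?L. ?G t) - 4 * 0 * B) \<le> (frac_seminorm s (strip_along e) u)\<^sup>2"
    by (rule tendsto_upperbound) (auto simp: eventually_at intro!: main exI[of _ 1])
  then show ?thesis
    by (simp add: L2_slice)
qed

end

subsection \<open>Test functions on the interval\<close>

text \<open>Symmetry reduces the claim to a power with exponent above -1 on [0, 2].\<close>

lemma nn_integral_abs_powr_finite: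
  assumes q: "q < 1"
  shows "(\<integral>\<^sup>+t. ennreal (1 / \<bar>t\<bar> powr q) * indicator {-2..2} t \<partial>lborel) < \<infinity>"
proof -
  let ?f = "\<lambda>t. ennreal (t powr (- q)) * indicator {0..2} t"
  have "((\<lambda>t. t powr (- q)) has_integral (2 powr (- q + 1) / (- q + 1))) {0..2}"
    using has_integral_powr_from_0[of "- q" 2] q by simp
  then have "(\<integral>\<^sup>+t. ennreal (indicator {0..2} t * t powr (- q)) \<partial>lborel) = ennreal (2 powr (- q + 1) / (- q + 1))"
    by (intro nn_integral_has_integral_lebesgue) auto
  then have f: "(\<integral>\<^sup>+t. ?f t \<partial>lborel) < \<infinity>"
    by (simp add: ennreal_mult' ennreal_indicator mult.commute)
  have sym: "(\<integral>\<^sup>+t. ?f (- t) \<partial>lborel) = (\<integral>\<^sup>+t. ?f t \<partial>lborel)"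
    by (subst (2) nn_integral_real_affine[where c="-1" and t=0]) auto
  have "(\<integral>\<^sup>+t. ennreal (1 / \<bar>t\<bar> powr q) * indicator {-2..2} t \<partial>lborel) \<le> (\<integral>\<^sup>+t. ?f t + ?f (- t) \<partial>lborel)"
    by (rule nn_integral_mono) (auto simp: indicator_def powr_minus_divide abs_if)
  also have "\<dots> = (\<integral>\<^sup>+t. ?f t \<partial>lborel) + (\<integral>\<^sup>+t. ?f t \<partial>lborel)"
    by (subst nn_integral_add) (auto simp: sym)
  finally show ?thesis
    using f by (auto intro: le_less_trans)
qed

lemma nn_integral_interval_powr_finite:
  assumes q: "q < 1"
  shows "(\<integral>\<^sup>+t. (\<integral>\<^sup>+t'. ennreal (1 / \<bar>t - t'\<bar> powr q) * indicator {-1<..<1} t' \<partial>lborel) * indicator {-1<..<1::real} t \<partial>lborel) < \<infinity>"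
proof -
  let ?c = "\<integral>\<^sup>+t. ennreal (1 / \<bar>t\<bar> powr q) * indicator {-2..2} t \<partial>lborel"
  have "(\<integral>\<^sup>+t'. ennreal (1 / \<bar>t - t'\<bar> powr q) * indicator {-1<..<1} t' \<partial>lborel) \<le> ?c" if t: "t \<in> {-1<..<1}" for t :: real
  proof -
    have "(\<integral>\<^sup>+t'. ennreal (1 / \<bar>t - t'\<bar> powr q) * indicator {-1<..<1} t' \<partial>lborel)
        = (\<integral>\<^sup>+r. ennreal (1 / \<bar>r\<bar> powr q) * indicator {-1<..<1} (t + r) \<partial>lborel)"
      by (subst nn_integral_real_affine[where c=1 and t=t]) auto
    also have "\<dots> \<le> ?c"
      using t by (intro nn_integral_mono) (auto simp: indicator_def)
    finally show ?thesis .
  qed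
  then have "(\<integral>\<^sup>+t. (\<integral>\<^sup>+t'. ennreal (1 / \<bar>t - t'\<bar> powr q) * indicator {-1<..<1} t' \<partial>lborel) * indicator {-1<..<1::real} t \<partial>lborel)
      \<le> (\<integral>\<^sup>+t. ?c * indicator {-1<..<1::real} t \<partial>lborel)"
    by (intro nn_integral_mono) (auto simp: indicator_def)
  also have "\<dots> = ?c * 2"
    by (subst nn_integral_cmult_indicator) auto
  also have "\<dots> < \<infinity>"
    using nn_integral_abs_powr_finite[OF q] by (simp add: ennreal_mult_less_top)
  finally show ?thesis .
qed

lemma test_function_lipschitz:
  fixes \<phi> :: "'a::euclidean_space \<Rightarrow> real"
  assumes \<phi>: "\<phi> \<in> test_functions \<Omega>"
  obtains L where "L > 0" "\<And>x y. \<bar>\<phi> x - \<phi> y\<bar> \<le> L * norm (x - y)"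
proof -
  obtain B r where "\<And>x. \<bar>\<phi> x\<bar> \<le> B" "\<And>x. x \<notin> cball 0 r \<Longrightarrow> \<phi> x = 0"
    using test_functions_bounded[OF \<phi>] by blast
  then show ?thesis
    using smooth_compact_support_lipschitz[OF test_functions_smooth[OF \<phi>]] that by blast
qed

text \<open>The Lipschitz bound leaves the kernel |t - t'|^(1 - 2 s), which is integrable because 2
  s - 1 < 1.\<close>

lemma test_function_interval_sobolev:
  fixes \<phi> :: "real \<Rightarrow> real"
  assumes s: "0 < s" "s < 1" and \<phi>: "\<phi> \<in> test_functions {-1<..<1}"
  shows "\<phi> \<in> sobolev_space s {-1<..<1}"
proof (rule test_function_in_sobolev_space[OF \<phi>])
  obtain L where L: "L > 0" "\<And>x y. \<bar>\<phi> x - \<phi> y\<bar> \<le> L * norm (x - y)"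
    using test_function_lipschitz[OF \<phi>] by blast
  have [measurable]: "\<phi> \<in> borel_measurable borel"
    by (rule test_functions_borel[OF \<phi>])
  let ?J = "indicator {-1<..<1::real} :: real \<Rightarrow> ennreal"
  have "gagliardo_integral s {-1<..<1} \<phi> \<le>
      (\<integral>\<^sup>+t. (\<integral>\<^sup>+t'. ennreal (L\<^sup>2) * (ennreal (1 / \<bar>t - t'\<bar> powr (2 * s - 1)) * ?J t') \<partial>lborel) * ?J t \<partial>lborel)"
    unfolding gagliardo_lborel[OF borel_unit_interval] mult.assoc[symmetric]
  proof (intro nn_integral_mono mult_right_mono)
    fix t t' :: real
    have "\<bar>\<phi> t - \<phi> t'\<bar>\<^sup>2 \<le> (L * \<bar>t - t'\<bar>)\<^sup>2"
      using L(2)[of t t'] by (intro power_mono) auto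
    then have "\<bar>\<phi> t - \<phi> t'\<bar>\<^sup>2 / \<bar>t - t'\<bar> powr (1 + 2 * s) \<le> (L * \<bar>t - t'\<bar>)\<^sup>2 / \<bar>t - t'\<bar> powr (1 + 2 * s)"
      by (rule divide_right_mono) simp
    also have "\<dots> = L\<^sup>2 * (1 / \<bar>t - t'\<bar> powr (2 * s - 1))"
    proof (cases "t = t'")
      case False
      have "a powr (1 + 2 * s) = a powr (2 * s - 1) * a\<^sup>2" if "a > 0" for a
      proof -
        have "a\<^sup>2 = a powr 2" using that by simp
        then show ?thesis by (simp only: powr_add[symmetric]) simp
      qed
      then have "\<bar>t - t'\<bar> powr (1 + 2 * s) = \<bar>t - t'\<bar> powr (2 * s - 1) * \<bar>t - t'\<bar>\<^sup>2"
        using False by simp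
      then show ?thesis using False by (simp add: power_mult_distrib)
    qed simp
    finally show "ennreal (\<bar>\<phi> t - \<phi> t'\<bar>\<^sup>2 / norm (t - t') powr (real DIM(real) + 2 * s))
        \<le> ennreal (L\<^sup>2) * ennreal (1 / \<bar>t - t'\<bar> powr (2 * s - 1))"
      by (simp add: ennreal_mult'[symmetric] ennreal_leI)
  qed auto
  also have "\<dots> = ennreal (L\<^sup>2) * (\<integral>\<^sup>+t. (\<integral>\<^sup>+t'. ennreal (1 / \<bar>t - t'\<bar> powr (2 * s - 1)) * ?J t' \<partial>lborel) * ?J t \<partial>lborel)"
    by (simp add: nn_integral_cmult mult.assoc)
  also have "\<dots> < \<infinity>"
    using nn_integral_interval_powr_finite[of "2 * s - 1"] s by (simp add: ennreal_mult_less_top)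
  finally show "gagliardo_integral s {-1<..<1} \<phi> < \<infinity>" .
qed auto

lemma cutoff_test_function:
  assumes "d > 0"
  shows "cutoff d \<in> test_functions {-1<..<1}"
proof (rule test_functionsI[OF C_diff_cutoff])
  show "compact {-(1-d)..1-d}" "{-(1-d)..1-d} \<subseteq> {-1<..<1}"
    using assms by auto
  show "cutoff d x = 0" if "x \<notin> {-(1-d)..1-d}" for x
    using that assms by (intro cutoff_eq_0) auto
qed

lemma L2_ge_1:
  assumes \<phi>: "\<phi> \<in> test_functions {-1<..<1::real}" and 1: "\<And>x. \<bar>x\<bar> \<le> 1/2 \<Longrightarrow> \<phi> x = 1"
  shows "L2_sq {-1<..<1} \<phi> \<ge> 1"
proof -
  have [measurable]: "\<phi> \<in> borel_measurable borel"
    by (rule test_functions_borel[OF \<phi>])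
  have "ennreal 1 = (\<integral>\<^sup>+(x::real). indicator {-1/2..1/2} x \<partial>lborel)"
    by simp
  also have "\<dots> \<le> (\<integral>\<^sup>+x. ennreal ((\<phi> x)\<^sup>2) * indicator {-1<..<1} x \<partial>lborel)"
    using 1 by (intro nn_integral_mono) (auto simp: indicator_def)
  finally have "enn2real (ennreal 1) \<le> enn2real (\<integral>\<^sup>+x. ennreal ((\<phi> x)\<^sup>2) * indicator {-1<..<1} x \<partial>lborel)"
    using test_function_L2[OF \<phi>] by (intro enn2real_mono) auto
  then show ?thesis
    by (simp add: integral_lebesgue_on_lborel)
qed

lemma not_AE_zero_if_L2_pos:
  fixes u :: "'a::euclidean_space \<Rightarrow> real"
  assumes "L2_sq \<Omega> u > 0"
  shows "\<not> (AE x in lebesgue_on \<Omega>. u x = 0)"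
proof
  assume "AE x in lebesgue_on \<Omega>. u x = 0"
  then have "L2_sq \<Omega> u = 0"
    by (intro integral_eq_zero_AE) (auto elim: eventually_mono)
  with assms show False by simp
qed

subsection \<open>Cutting off in the directions of the strip\<close>

text \<open>A product rather than a radial cutoff, so that it can be compared with boxes of explicit
  measure. In dimension one the product is empty and the function is 1. The width 1/4 makes each
  factor 1 up to R/2 and 0 from 3 R/4 on.\<close>

definition perp_cutoff :: "'a::euclidean_space \<Rightarrow> real \<Rightarrow> 'a \<Rightarrow> real" where
  "perp_cutoff e R x = (\<Prod>b\<in>Basis - {e}. cutoff (1/4) (x \<bullet> b / R))"

lemma C_diff_perp_cutoff: "C_diff m (perp_cutoff e R)"
  unfolding perp_cutoff_def
proof (rule C_diff_prod)
  fix b :: 'a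
  show "C_diff m (\<lambda>x. cutoff (1/4) (x \<bullet> b / R))"
    using C_diff_comp_affine[OF C_diff_cutoff, of m "1/4" "(1 / R) *\<^sub>R b" 0] by simp
qed

lemma perp_cutoff_borel [measurable]: "perp_cutoff e R \<in> borel_measurable borel"
  using C_diff_continuous[OF C_diff_perp_cutoff] by (rule borel_measurable_continuous_onI)

lemma perp_cutoff_bounds: "0 \<le> perp_cutoff e R x" "perp_cutoff e R x \<le> 1"
  unfolding perp_cutoff_def by (auto intro!: prod_nonneg prod_le_1 simp: cutoff_bounds)

lemma perp_cutoff_shift:
  assumes "e \<in> Basis"
  shows "perp_cutoff e R (x + t *\<^sub>R e) = perp_cutoff e R x"
  unfolding perp_cutoff_def using assms
  by (intro prod.cong) (auto simp: inner_add_left inner_not_same_Basis)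

lemma perp_cutoff_eq_0:
  assumes R: "R > 0" and "b \<in> Basis - {e}" "\<bar>x \<bullet> b\<bar> > R"
  shows "perp_cutoff e R x = 0"
proof -
  have "cutoff (1/4) (x \<bullet> b / R) = 0"
    using assms by (intro cutoff_eq_0) (auto simp: field_simps)
  then show ?thesis
    unfolding perp_cutoff_def using assms(2) by (intro prod_zero) auto
qed

lemma perp_cutoff_eq_1:
  assumes R: "R > 0" and "\<And>b. b \<in> Basis - {e} \<Longrightarrow> \<bar>x \<bullet> b\<bar> \<le> R / 2"
  shows "perp_cutoff e R x = 1"
  unfolding perp_cutoff_def using assms by (intro prod.neutral ballI cutoff_eq_1) (auto simp: field_simps)

text \<open>The factors lie in [0, 1], so the difference of the products is at most the sum of the
  differences of the factors; the 4 comes from the width 1/4.\<close>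

lemma perp_cutoff_lipschitz:
  obtains L where "L > 0" "\<And>R (x::'a::euclidean_space) y e. R > 0 \<Longrightarrow> \<bar>perp_cutoff e R x - perp_cutoff e R y\<bar> \<le> L / R * norm (x - y)"
proof -
  obtain L0 where L0: "L0 > 0" "\<And>d x y. d > 0 \<Longrightarrow> \<bar>cutoff d x - cutoff d y\<bar> \<le> L0 / d * \<bar>x - y\<bar>"
    using cutoff_lipschitz by blast
  define L where "L = 4 * L0 * real DIM('a)"
  have "\<bar>perp_cutoff e R x - perp_cutoff e R y\<bar> \<le> L / R * norm (x - y)" if R: "R > 0" for R and x y e :: 'a
  proof -
    have "norm (perp_cutoff e R x - perp_cutoff e R y)
        \<le> (\<Sum>b\<in>Basis - {e}. norm (cutoff (1/4) (x \<bullet> b / R) - cutoff (1/4) (y \<bullet> b / R)))"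
      unfolding perp_cutoff_def by (rule norm_prod_diff) (auto simp: cutoff_bounds)
    also have "\<dots> \<le> (\<Sum>b\<in>Basis - {e}. 4 * L0 / R * norm (x - y))"
    proof (rule sum_mono)
      fix b assume b: "b \<in> Basis - {e}"
      have "\<bar>cutoff (1/4) (x \<bullet> b / R) - cutoff (1/4) (y \<bullet> b / R)\<bar> \<le> 4 * L0 * \<bar>x \<bullet> b / R - y \<bullet> b / R\<bar>"
        using L0(2)[of "1/4" "x \<bullet> b / R" "y \<bullet> b / R"] by (simp add: mult.commute)
      also have "\<bar>x \<bullet> b / R - y \<bullet> b / R\<bar> = \<bar>(x - y) \<bullet> b\<bar> / R"
        using R by (simp add: diff_divide_distrib[symmetric] inner_diff_left)
      also have "4 * L0 * (\<bar>(x - y) \<bullet> b\<bar> / R) \<le> 4 * L0 * (norm (x - y) / R)"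
        using b L0(1) R by (intro mult_left_mono divide_right_mono Basis_le_norm) auto
      finally show "norm (cutoff (1/4) (x \<bullet> b / R) - cutoff (1/4) (y \<bullet> b / R)) \<le> 4 * L0 / R * norm (x - y)"
        by simp
    qed
    also have "\<dots> \<le> L / R * norm (x - y)"
    proof -
      have "real (card (Basis - {e})) \<le> real DIM('a)"
        by (simp add: card_mono)
      then have "real (card (Basis - {e})) * (4 * L0 / R * norm (x - y)) \<le> real DIM('a) * (4 * L0 / R * norm (x - y))"
        using L0(1) R by (intro mult_right_mono) auto
      then show ?thesis by (simp add: L_def mult_ac)
    qed
    finally show ?thesis by simp
  qed
  moreover have "L > 0" using L0(1) by (simp add: L_def DIM_positive)
  ultimately show ?thesis using that by blast
qed

text \<open>Valued in \<open>ennreal\<close> and written as a product over coordinates, the form to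
  which \<open>nn_integral_lborel_prod\<close> applies.\<close>

definition perp_box :: "'a::euclidean_space \<Rightarrow> real \<Rightarrow> 'a \<Rightarrow> ennreal" where
  "perp_box e r x = (\<Prod>b\<in>Basis - {e}. indicator {-r..r} (x \<bullet> b))"

lemma perp_box_borel [measurable]: "perp_box e r \<in> borel_measurable borel"
  unfolding perp_box_def by measurable

lemma perp_box_eq: "perp_box e r x = (if \<forall>b\<in>Basis - {e}. \<bar>x \<bullet> b\<bar> \<le> r then 1 else 0)"
proof (cases "\<forall>b\<in>Basis - {e}. \<bar>x \<bullet> b\<bar> \<le> r")
  case True
  then have "perp_box e r x = 1"
    unfolding perp_box_def by (intro prod.neutral ballI) (simp add: abs_le_iff minus_le_iff)
  with True show ?thesis by simp
next
  case False
  then obtain b where b: "b \<in> Basis - {e}" "\<not> \<bar>x \<bullet> b\<bar> \<le> r"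
    by blast
  then have "indicator {-r..r} (x \<bullet> b) = (0 :: ennreal)"
    by (auto simp: indicator_def)
  then have "perp_box e r x = 0"
    unfolding perp_box_def using b(1) by (intro prod_zero) auto
  with False show ?thesis by auto
qed

lemma perp_cutoff_eq_0_box:
  assumes R: "R > 0" and "perp_box e R x = 0"
  shows "perp_cutoff e R x = 0"
proof -
  obtain b where "b \<in> Basis - {e}" "\<bar>x \<bullet> b\<bar> > R"
    using assms(2) by (auto simp: perp_box_eq not_le split: if_splits)
  then show ?thesis by (rule perp_cutoff_eq_0[OF R])
qed

lemma nn_integral_perp_box:
  fixes e :: "'a::euclidean_space"
  assumes e: "e \<in> Basis" and r: "r > 0"
  shows "(\<integral>\<^sup>+a. perp_box e r a \<partial>perp_lborel e) = ennreal ((2 * r) ^ (DIM('a) - 1))"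
proof -
  \<comment> \<open>The direction \<open>e\<close> receives the unit interval of the slab behind
    \<open>perp_lborel\<close>, which contributes the factor 1.\<close>
  define f where "f b = (if b = e then indicator {0..1} else indicator {-r..r} :: real \<Rightarrow> ennreal)" for b
  have [measurable]: "f b \<in> borel_measurable borel" for b
    by (simp add: f_def)
  have split: "(\<Prod>b\<in>Basis. g b) = g e * (\<Prod>b\<in>Basis - {e}. g b)" for g :: "'a \<Rightarrow> ennreal"
    using e by (intro prod.remove) auto
  have "(\<integral>\<^sup>+a. perp_box e r a \<partial>perp_lborel e) = (\<integral>\<^sup>+x. indicator {0..1} (x \<bullet> e) * perp_box e r (x - (x \<bullet> e) *\<^sub>R e) \<partial>lborel)"
    by (rule nn_integral_perp_lborel) measurable
  also have "\<dots> = (\<integral>\<^sup>+x. (\<Prod>b\<in>Basis. f b (x \<bullet> b)) \<partial>lborel)"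
  proof (rule nn_integral_cong)
    fix x :: 'a
    have "perp_box e r (x - (x \<bullet> e) *\<^sub>R e) = (\<Prod>b\<in>Basis - {e}. f b (x \<bullet> b))"
      unfolding perp_box_def using e
      by (intro prod.cong) (auto simp: f_def inner_diff_left inner_not_same_Basis)
    then show "indicator {0..1} (x \<bullet> e) * perp_box e r (x - (x \<bullet> e) *\<^sub>R e) = (\<Prod>b\<in>Basis. f b (x \<bullet> b))"
      unfolding split by (simp add: f_def)
  qed
  also have "\<dots> = (\<Prod>b\<in>(Basis::'a set). (\<integral>\<^sup>+t. f b t \<partial>lborel))"
    by (rule nn_integral_lborel_prod) auto
  also have "\<dots> = (\<Prod>b\<in>Basis - {e}. ennreal (2 * r))"
    unfolding split using r by (auto simp: f_def intro!: prod.cong)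
  also have "\<dots> = ennreal ((2 * r) ^ (DIM('a) - 1))"
    using r e by (simp add: card_Diff_singleton ennreal_power)
  finally show ?thesis .
qed

text \<open>Comparison with the large box gives finiteness. The lower bound, from the smaller box
  where the cutoff is 1, lets \<Psi> absorb the volume factor R^(n-1) of the cutoff error.\<close>

lemma perp_cutoff_sq_integral:
  fixes e :: "'a::euclidean_space"
  assumes e: "e \<in> Basis" and R: "R > 0"
  obtains \<Psi> where "\<Psi> \<ge> R ^ (DIM('a) - 1)" "(\<integral>\<^sup>+a. ennreal ((perp_cutoff e R a)\<^sup>2) \<partial>perp_lborel e) = ennreal \<Psi>"
proof -
  let ?I = "\<integral>\<^sup>+a. ennreal ((perp_cutoff e R a)\<^sup>2) \<partial>perp_lborel e"
  have "?I \<le> (\<integral>\<^sup>+a. perp_box e R a \<partial>perp_lborel e)"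
  proof (rule nn_integral_mono)
    fix a
    show "ennreal ((perp_cutoff e R a)\<^sup>2) \<le> perp_box e R a"
    proof (cases "\<forall>b\<in>Basis - {e}. \<bar>a \<bullet> b\<bar> \<le> R")
      case True
      then show ?thesis
        using perp_cutoff_bounds[of e R a] by (simp add: perp_box_eq power_le_one)
    next
      case False
      then have "perp_cutoff e R a = 0"
        using perp_cutoff_eq_0[OF R] by fastforce
      then show ?thesis by simp
    qed
  qed
  then have "?I \<le> ennreal ((2 * R) ^ (DIM('a) - 1))"
    using nn_integral_perp_box[OF e R] by simp
  then have fin: "?I < \<infinity>"
    by (rule le_less_trans) simp
  have "ennreal (R ^ (DIM('a) - 1)) = (\<integral>\<^sup>+a. perp_box e (R / 2) a \<partial>perp_lborel e)"
    using nn_integral_perp_box[OF e, of "R / 2"] R by simp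
  also have "\<dots> \<le> ?I"
  proof (rule nn_integral_mono)
    show "perp_box e (R / 2) a \<le> ennreal ((perp_cutoff e R a)\<^sup>2)" for a
      using perp_cutoff_eq_1[OF R, of e a] by (auto simp: perp_box_eq)
  qed
  finally have "ennreal (R ^ (DIM('a) - 1)) \<le> ?I" .
  then have "R ^ (DIM('a) - 1) \<le> enn2real ?I"
    using enn2real_mono[of "ennreal (R ^ (DIM('a) - 1))" ?I] fin R by simp
  moreover have "?I = ennreal (enn2real ?I)"
    using fin by simp
  ultimately show ?thesis using that by blast
qed

lemma sq_le_powr:
  fixes w :: real
  assumes "0 \<le> w" "w \<le> 1" "\<alpha> \<le> 2"
  shows "w\<^sup>2 \<le> w powr \<alpha>"
proof (cases "w = 0")
  case False
  then have "w\<^sup>2 = w powr 2" using assms(1) by simp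
  also have "\<dots> \<le> w powr \<alpha>" using assms by (intro powr_mono') auto
  finally show ?thesis .
qed simp

text \<open>The difference is at most the minimum of 1 and w = L |z| / R, whose square is at most
  w^\<alpha> for 0 < \<alpha> \<le> 2. The integrand vanishes outside a box and its translate, which
  gives the factor 2 (2 R)^(n-1).\<close>

lemma perp_cutoff_difference:
  fixes e :: "'a::euclidean_space"
  assumes e: "e \<in> Basis" and R: "R > 0" and z: "z \<bullet> e = 0" and \<alpha>: "0 < \<alpha>" "\<alpha> \<le> 2" and L: "L > 0"
    and lip: "\<And>x y. \<bar>perp_cutoff e R x - perp_cutoff e R y\<bar> \<le> L / R * norm (x - y)"
  shows "(\<integral>\<^sup>+a. ennreal ((perp_cutoff e R a - perp_cutoff e R (a + z))\<^sup>2) \<partial>perp_lborel e)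
    \<le> ennreal (2 * (2 * R) ^ (DIM('a) - 1) * (L / R * norm z) powr \<alpha>)"
proof -
  let ?\<psi> = "perp_cutoff e R" and ?w = "L / R * norm z" and ?B = "perp_box e R"
  have w: "?w \<ge> 0" using L R by simp
  have bd: "(?\<psi> a - ?\<psi> (a + z))\<^sup>2 \<le> ?w powr \<alpha>" for a
  proof (cases "?w \<le> 1")
    case True
    have "\<bar>?\<psi> a - ?\<psi> (a + z)\<bar> \<le> ?w"
      using lip[of a "a + z"] by simp
    then have "(?\<psi> a - ?\<psi> (a + z))\<^sup>2 \<le> ?w\<^sup>2"
      using power_mono[of "\<bar>?\<psi> a - ?\<psi> (a + z)\<bar>" ?w 2] by simp
    also have "\<dots> \<le> ?w powr \<alpha>"
      by (rule sq_le_powr[OF w True \<alpha>(2)])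
    finally show ?thesis .
  next
    case False
    have "\<bar>?\<psi> a - ?\<psi> (a + z)\<bar> \<le> 1"
      using perp_cutoff_bounds[of e R a] perp_cutoff_bounds[of e R "a + z"] by linarith
    then have "(?\<psi> a - ?\<psi> (a + z))\<^sup>2 \<le> 1"
      by (simp add: abs_square_le_1)
    also have "1 \<le> ?w powr \<alpha>"
      using False \<alpha> by (intro ge_one_powr_ge_zero) auto
    finally show ?thesis .
  qed
  have "(\<integral>\<^sup>+a. ennreal ((?\<psi> a - ?\<psi> (a + z))\<^sup>2) \<partial>perp_lborel e)
      \<le> (\<integral>\<^sup>+a. ennreal (?w powr \<alpha>) * (?B a + ?B (a + z)) \<partial>perp_lborel e)"
  proof (rule nn_integral_mono)
    fix a
    show "ennreal ((?\<psi> a - ?\<psi> (a + z))\<^sup>2) \<le> ennreal (?w powr \<alpha>) * (?B a + ?B (a + z))"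
    proof (cases "?B a = 0 \<and> ?B (a + z) = 0")
      case True
      then have "?\<psi> a = 0" "?\<psi> (a + z) = 0"
        by (auto intro: perp_cutoff_eq_0_box[OF R])
      then show ?thesis by simp
    next
      case False
      then have "1 \<le> ?B a + ?B (a + z)"
        by (auto simp: perp_box_eq split: if_splits)
      then have "ennreal (?w powr \<alpha>) * 1 \<le> ennreal (?w powr \<alpha>) * (?B a + ?B (a + z))"
        by (rule mult_left_mono) simp
      then show ?thesis
        using order_trans[OF ennreal_leI[OF bd[of a]]] by (simp only: mult_1_right)
    qed
  qed
  also have "\<dots> = ennreal (?w powr \<alpha>) * ((\<integral>\<^sup>+a. ?B a \<partial>perp_lborel e) + (\<integral>\<^sup>+a. ?B (a + z) \<partial>perp_lborel e))"
    by (simp add: nn_integral_cmult nn_integral_add)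
  also have "(\<integral>\<^sup>+a. ?B (a + z) \<partial>perp_lborel e) = (\<integral>\<^sup>+a. ?B a \<partial>perp_lborel e)"
    by (rule nn_integral_perp_lborel_translation[OF _ z]) measurable
  also have "ennreal (?w powr \<alpha>) * ((\<integral>\<^sup>+a. ?B a \<partial>perp_lborel e) + (\<integral>\<^sup>+a. ?B a \<partial>perp_lborel e))
      = ennreal (2 * (2 * R) ^ (DIM('a) - 1) * ?w powr \<alpha>)"
    unfolding nn_integral_perp_box[OF e R] using R
    by (simp add: ennreal_plus[symmetric] ennreal_mult'[symmetric] mult_ac del: ennreal_plus)
  finally show ?thesis .
qed

lemma strip_product_test_function:
  fixes e :: "'a::euclidean_space"
  assumes e: "e \<in> Basis" and R: "R > 0" and \<phi>: "\<phi> \<in> test_functions {-1<..<1}"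
  shows "(\<lambda>x. \<phi> (x \<bullet> e) * perp_cutoff e R x) \<in> test_functions (strip_along e)"
proof -
  obtain K where K: "compact K" "K \<subseteq> {-1<..<1}" "\<And>x. x \<notin> K \<Longrightarrow> \<phi> x = 0"
    using test_functionsE[OF \<phi>] by blast
  let ?K = "{x. x \<bullet> e \<in> K} \<inter> (\<Inter>b\<in>Basis - {e}. {x. \<bar>x \<bullet> b\<bar> \<le> R})"
  show ?thesis
  proof (rule test_functionsI[of _ ?K])
    show "C_diff m (\<lambda>x. \<phi> (x \<bullet> e) * perp_cutoff e R x)" for m
      using C_diff_comp_affine[OF test_functions_smooth[OF \<phi>], of m e 0]
      by (intro C_diff_mult C_diff_perp_cutoff) simp
    have "closed ((\<lambda>x. x \<bullet> e) -` K)"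
      using compact_imp_closed[OF K(1)] by (rule closed_vimage) (intro continuous_intros)
    then have "closed ?K"
      by (intro closed_Int closed_INT ballI closed_Collect_le continuous_intros) (simp add: vimage_def)
    moreover have "bounded ?K"
      unfolding bounded_iff
    proof (intro exI[of _ "\<Sum>b\<in>(Basis::'a set). max 1 R"] ballI)
      fix x assume x: "x \<in> ?K"
      have "norm x \<le> (\<Sum>b\<in>Basis. \<bar>x \<bullet> b\<bar>)"
        by (rule norm_le_l1)
      also have "\<dots> \<le> (\<Sum>b\<in>(Basis::'a set). max 1 R)"
      proof (rule sum_mono)
        fix b :: 'a assume b: "b \<in> Basis"
        show "\<bar>x \<bullet> b\<bar> \<le> max 1 R"
        proof (cases "b = e")
          case True
          then have "x \<bullet> b \<in> {-1<..<1}" using x K(2) by auto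
          then show ?thesis by auto
        qed (use x b in force)
      qed
      finally show "norm x \<le> (\<Sum>b\<in>(Basis::'a set). max 1 R)" .
    qed
    ultimately show "compact ?K" by (simp add: compact_eq_bounded_closed)
    show "?K \<subseteq> strip_along e" using K(2) by (auto simp: strip_along_def)
    show "\<phi> (x \<bullet> e) * perp_cutoff e R x = 0" if "x \<notin> ?K" for x
      using that K(3) perp_cutoff_eq_0[OF R, of _ e x] by (auto simp: not_le)
  qed
qed

section \<open>From the strip to the interval: products with a wide cutoff\<close>

text \<open>The increment of the product splits as (\<phi> t - \<phi> t') \<psi>(a) + \<phi> t'
  (\<psi>(a) - \<psi>(a + z)). The second part is bounded by |z|^\<alpha> with \<alpha> \<le> 2,
  where |z|^\<alpha> times the kernel has to integrate over z to at most a multiple of |t - t'|^(-q)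
  with 0 < q < 1. As q = 1 + 2 s - \<alpha>, the choice \<alpha> = 1 + s, q = s works for all
  s.\<close>

lemma gagliardo_product_le:
  fixes e :: "'a::euclidean_space" and \<phi> :: "real \<Rightarrow> real"
  assumes s: "0 < s" "s < 1" and e: "e \<in> Basis" and \<phi>: "\<phi> \<in> test_functions {-1<..<1}"
    and M: "\<And>t. \<bar>\<phi> t\<bar> \<le> M" and L: "L > 0"
    and lip: "\<And>x y. \<bar>perp_cutoff e R x - perp_cutoff e R y\<bar> \<le> L / R * norm (x - y)"
    and R: "R > 0" and \<theta>: "\<theta> > 0"
    and \<Psi>: "\<Psi> \<ge> R ^ (DIM('a) - 1)" "(\<integral>\<^sup>+a. ennreal ((perp_cutoff e R a)\<^sup>2) \<partial>perp_lborel e) = ennreal \<Psi>"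
  shows "gagliardo_integral s (strip_along e) (\<lambda>x. \<phi> (x \<bullet> e) * perp_cutoff e R x)
    \<le> ennreal ((1 + \<theta>) * \<Psi> * slice_const DIM('a) (1 + 2 * s)) * gagliardo_integral s {-1<..<1} \<phi>
      + ennreal ((1 + 1 / \<theta>) * M\<^sup>2 * \<Psi> * (2 ^ DIM('a) * L powr (1 + s)) * R powr (- (1 + s)) * slice_const DIM('a) s)
        * (\<integral>\<^sup>+t. (\<integral>\<^sup>+t'. ennreal (1 / \<bar>t - t'\<bar> powr s) * indicator {-1<..<1} t' \<partial>lborel) * indicator {-1<..<1::real} t \<partial>lborel)"
proof -
  let ?\<mu> = "perp_lborel e" and ?\<psi> = "perp_cutoff e R" and ?n = "DIM('a)" and ?J = "indicator {-1<..<1::real} :: real \<Rightarrow> ennreal"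
  define u where "u x = \<phi> (x \<bullet> e) * ?\<psi> x" for x
  have [measurable]: "\<phi> \<in> borel_measurable borel"
    by (rule test_functions_borel[OF \<phi>])
  have u_borel [measurable]: "u \<in> borel_measurable borel"
    unfolding u_def by measurable
  have \<Psi>0: "\<Psi> > 0"
    using \<Psi>(1) R by (auto intro: less_le_trans[rotated])
  have n: "?n \<ge> 1" by (simp add: DIM_positive Suc_leI)
  have C: "slice_const ?n (1 + 2 * s) > 0" "slice_const ?n s > 0"
    using s n by (auto intro!: slice_const_pos)
  let ?k = "\<lambda>\<tau> z. ennreal (1 / norm (z + \<tau> *\<^sub>R e) powr (real ?n + 2 * s))"
  define A where "A t t' = (1 + \<theta>) * \<Psi> * (\<phi> t - \<phi> t')\<^sup>2" for t t'
  define B where "B = (1 + 1 / \<theta>) * M\<^sup>2 * \<Psi> * (2 ^ ?n * L powr (1 + s)) * R powr (- (1 + s))"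
  have A0: "A t t' \<ge> 0" for t t' using \<Psi>0 \<theta> by (simp add: A_def)
  have B0: "B \<ge> 0" using \<Psi>0 \<theta> by (simp add: B_def)
  let ?D = "\<lambda>t t' z. \<integral>\<^sup>+a. ennreal ((u (a + t *\<^sub>R e) - u (a + z + t' *\<^sub>R e))\<^sup>2) \<partial>?\<mu>"
  have inner: "?D t t' z
      \<le> ennreal (A t t') + ennreal (B * norm z powr (1 + s))" if z: "z \<bullet> e = 0" for z t t'
  proof -
    have "?D t t' z
        \<le> (\<integral>\<^sup>+a. ennreal ((1 + \<theta>) * (\<phi> t - \<phi> t')\<^sup>2) * ennreal ((?\<psi> a)\<^sup>2)
            + ennreal ((1 + 1 / \<theta>) * M\<^sup>2) * ennreal ((?\<psi> a - ?\<psi> (a + z))\<^sup>2) \<partial>?\<mu>)"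
    proof (rule nn_integral_mono_AE, use AE_perp_lborel[OF e] in eventually_elim)
      fix a :: 'a assume a: "a \<bullet> e = 0"
      have "u (a + t *\<^sub>R e) - u (a + z + t' *\<^sub>R e) = \<phi> t * ?\<psi> a - \<phi> t' * ?\<psi> (a + z)"
        using a z e by (simp add: u_def perp_cutoff_shift[OF e] inner_add_left)
      also have "\<dots> = (\<phi> t - \<phi> t') * ?\<psi> a + \<phi> t' * (?\<psi> a - ?\<psi> (a + z))"
        by (simp add: algebra_simps)
      finally have "(u (a + t *\<^sub>R e) - u (a + z + t' *\<^sub>R e))\<^sup>2
          \<le> (1 + \<theta>) * ((\<phi> t - \<phi> t') * ?\<psi> a)\<^sup>2 + (1 + 1 / \<theta>) * (\<phi> t' * (?\<psi> a - ?\<psi> (a + z)))\<^sup>2"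
        using add_sq_le[OF \<theta>] by simp
      also have "(1 + 1 / \<theta>) * (\<phi> t' * (?\<psi> a - ?\<psi> (a + z)))\<^sup>2 \<le> (1 + 1 / \<theta>) * (M\<^sup>2 * (?\<psi> a - ?\<psi> (a + z))\<^sup>2)"
      proof -
        have "(\<phi> t')\<^sup>2 \<le> M\<^sup>2" using power_mono[OF M[of t'], of 2] by simp
        then show ?thesis
          using \<theta> unfolding power_mult_distrib by (intro mult_left_mono mult_right_mono) auto
      qed
      finally have "(u (a + t *\<^sub>R e) - u (a + z + t' *\<^sub>R e))\<^sup>2
          \<le> (1 + \<theta>) * (\<phi> t - \<phi> t')\<^sup>2 * (?\<psi> a)\<^sup>2 + (1 + 1 / \<theta>) * M\<^sup>2 * (?\<psi> a - ?\<psi> (a + z))\<^sup>2"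
        by (simp add: power_mult_distrib mult.assoc)
      from ennreal_leI[OF this] show "ennreal ((u (a + t *\<^sub>R e) - u (a + z + t' *\<^sub>R e))\<^sup>2)
          \<le> ennreal ((1 + \<theta>) * (\<phi> t - \<phi> t')\<^sup>2) * ennreal ((?\<psi> a)\<^sup>2)
            + ennreal ((1 + 1 / \<theta>) * M\<^sup>2) * ennreal ((?\<psi> a - ?\<psi> (a + z))\<^sup>2)"
        using \<theta> by (subst (asm) ennreal_plus) (auto simp: ennreal_mult')
    qed
    also have "\<dots> = ennreal ((1 + \<theta>) * (\<phi> t - \<phi> t')\<^sup>2) * ennreal \<Psi>
        + ennreal ((1 + 1 / \<theta>) * M\<^sup>2) * (\<integral>\<^sup>+a. ennreal ((?\<psi> a - ?\<psi> (a + z))\<^sup>2) \<partial>?\<mu>)"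
      by (simp only: \<Psi>(2)[symmetric]) (simp add: nn_integral_add nn_integral_cmult)
    also have "\<dots> \<le> ennreal (A t t') + ennreal ((1 + 1 / \<theta>) * M\<^sup>2) *
        ennreal (2 * (2 * R) ^ (?n - 1) * (L / R * norm z) powr (1 + s))"
    proof (intro add_mono mult_left_mono perp_cutoff_difference[OF e R z _ _ L lip])
      show "ennreal ((1 + \<theta>) * (\<phi> t - \<phi> t')\<^sup>2) * ennreal \<Psi> \<le> ennreal (A t t')"
        using \<theta> \<Psi>0 by (simp add: A_def ennreal_mult'[symmetric] mult_ac)
    qed (use s in auto)
    also have "ennreal ((1 + 1 / \<theta>) * M\<^sup>2) * ennreal (2 * (2 * R) ^ (?n - 1) * (L / R * norm z) powr (1 + s))
        \<le> ennreal (B * norm z powr (1 + s))"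
    proof -
      \<comment> \<open>The factor R^(n-1) is to be absorbed by \<Psi>, which leaves the decaying
        power R^(-(1+s)).\<close>
      have "2 * (2 * R) ^ (?n - 1) * (L / R * norm z) powr (1 + s)
          = (2 ^ ?n * L powr (1 + s)) * R powr (- (1 + s)) * norm z powr (1 + s) * R ^ (?n - 1)"
      proof -
        have "(2::real) * 2 ^ (?n - 1) = 2 ^ ?n" using n by (metis One_nat_def Suc_pred less_eq_Suc_le power_Suc)
        moreover have "(L / R * norm z) powr (1 + s) = L powr (1 + s) * R powr (- (1 + s)) * norm z powr (1 + s)"
          unfolding powr_minus_divide[of R "1 + s"] using L R by (simp add: powr_mult powr_divide)
        ultimately show ?thesis by (simp add: power_mult_distrib mult_ac)
      qed
      also have "\<dots> \<le> (2 ^ ?n * L powr (1 + s)) * R powr (- (1 + s)) * norm z powr (1 + s) * \<Psi>"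
        using \<Psi>(1) by (intro mult_left_mono) auto
      finally have "(1 + 1 / \<theta>) * M\<^sup>2 * (2 * (2 * R) ^ (?n - 1) * (L / R * norm z) powr (1 + s))
          \<le> (1 + 1 / \<theta>) * M\<^sup>2 * ((2 ^ ?n * L powr (1 + s)) * R powr (- (1 + s)) * norm z powr (1 + s) * \<Psi>)"
        using \<theta> by (intro mult_left_mono) auto
      also have "\<dots> = B * norm z powr (1 + s)"
        by (simp add: B_def)
      finally show ?thesis
        using \<theta> R by (simp add: ennreal_mult'[symmetric] ennreal_leI)
    qed
    finally show ?thesis by (simp add: add_left_mono)
  qed
  have outer: "(\<integral>\<^sup>+z. ?k (t' - t) z * ?D t t' z \<partial>?\<mu>)
      \<le> ennreal ((1 + \<theta>) * \<Psi> * slice_const ?n (1 + 2 * s)) * ennreal (\<bar>\<phi> t - \<phi> t'\<bar>\<^sup>2 / norm (t - t') powr (real DIM(real) + 2 * s))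
        + ennreal (B * slice_const ?n s) * ennreal (1 / \<bar>t - t'\<bar> powr s)" if ne: "t \<noteq> t'" for t t'
  proof -
    let ?k' = "\<lambda>z. ennreal (1 / norm (z + (t' - t) *\<^sub>R e) powr (real ?n - 1 + s))"
    have \<tau>: "t' - t \<noteq> 0" using ne by simp
    have "(\<integral>\<^sup>+z. ?k (t' - t) z * ?D t t' z \<partial>?\<mu>)
      \<le> (\<integral>\<^sup>+z. ennreal (A t t') * ?k (t' - t) z + ennreal B * ?k' z \<partial>?\<mu>)"
    proof (rule nn_integral_mono_AE, use AE_perp_lborel[OF e] in eventually_elim)
      fix z :: 'a assume z: "z \<bullet> e = 0"
      define \<nu> where "\<nu> = norm (z + (t' - t) *\<^sub>R e)"
      have sq: "\<nu>\<^sup>2 = (norm z)\<^sup>2 + (t' - t)\<^sup>2"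
        unfolding \<nu>_def by (rule norm_perp_add_sq[OF e z])
      have "\<nu>\<^sup>2 > 0" unfolding sq using \<tau> by (intro add_nonneg_pos) auto
      then have \<nu>: "\<nu> > 0" unfolding \<nu>_def by (simp add: zero_less_norm_iff)
      have z\<nu>: "norm z \<le> \<nu>"
        by (rule power2_le_imp_le) (use sq \<nu> in auto)
      have "?k (t' - t) z * ?D t t' z
          \<le> ?k (t' - t) z * (ennreal (A t t') + ennreal (B * norm z powr (1 + s)))"
        by (rule mult_left_mono[OF inner[OF z]]) simp
      also have "\<dots> = ennreal (A t t') * ?k (t' - t) z + ennreal (B * (norm z powr (1 + s) / \<nu> powr (real ?n + 2 * s)))"
        unfolding distrib_left
        by (rule arg_cong2[where f="(+)"], rule mult.commute)
          (use B0 in \<open>simp add: \<nu>_def ennreal_mult'[symmetric]\<close>)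
      also have "\<dots> \<le> ennreal (A t t') * ?k (t' - t) z + ennreal B * ?k' z"
      proof -
        \<comment> \<open>As |z| \<le> \<nu>, the power |z|^(1+s) lowers the exponent n + 2 s of the
          kernel to n - 1 + s.\<close>
        have "norm z powr (1 + s) / \<nu> powr (real ?n + 2 * s) \<le> \<nu> powr (1 + s) / \<nu> powr (real ?n + 2 * s)"
          using z\<nu> s by (intro divide_right_mono powr_mono2) auto
        also have "\<dots> = \<nu> powr (1 + s - (real ?n + 2 * s))"
          by (rule powr_diff[symmetric])
        also have "1 + s - (real ?n + 2 * s) = - (real ?n - 1 + s)"
          by simp
        also have "\<nu> powr (- (real ?n - 1 + s)) = 1 / \<nu> powr (real ?n - 1 + s)"
          by (rule powr_minus_divide)
        finally have "B * (norm z powr (1 + s) / \<nu> powr (real ?n + 2 * s)) \<le> B * (1 / \<nu> powr (real ?n - 1 + s))"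
          using B0 by (rule mult_left_mono)
        from ennreal_leI[OF this] show ?thesis
          using B0 by (intro add_left_mono) (simp add: ennreal_mult'[symmetric] \<nu>_def)
      qed
      finally show "?k (t' - t) z * ?D t t' z
          \<le> ennreal (A t t') * ?k (t' - t) z + ennreal B * ?k' z" .
    qed
    also have "\<dots> = ennreal (A t t') * (\<integral>\<^sup>+z. ?k (t' - t) z \<partial>?\<mu>) + ennreal B * (\<integral>\<^sup>+z. ?k' z \<partial>?\<mu>)"
      by (simp add: nn_integral_add nn_integral_cmult)
    also have "(\<integral>\<^sup>+z. ?k (t' - t) z \<partial>?\<mu>) = ennreal (slice_const ?n (1 + 2 * s) / \<bar>t' - t\<bar> powr (1 + 2 * s))"
      using nn_integral_kernel_slice[OF e, of "1 + 2 * s" "t' - t"] \<tau> s by simp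
    also have "(\<integral>\<^sup>+z. ?k' z \<partial>?\<mu>) = ennreal (slice_const ?n s / \<bar>t' - t\<bar> powr s)"
      using nn_integral_kernel_slice[OF e s(1) \<tau>] by simp
    also have "ennreal (A t t') * ennreal (slice_const ?n (1 + 2 * s) / \<bar>t' - t\<bar> powr (1 + 2 * s))
        = ennreal ((1 + \<theta>) * \<Psi> * slice_const ?n (1 + 2 * s)) * ennreal (\<bar>\<phi> t - \<phi> t'\<bar>\<^sup>2 / norm (t - t') powr (real DIM(real) + 2 * s))"
      using \<Psi>0 \<theta> C A0[of t t'] by (simp add: ennreal_mult'[symmetric] A_def abs_minus_commute[of t'] mult_ac)
    also have "ennreal B * ennreal (slice_const ?n s / \<bar>t' - t\<bar> powr s) = ennreal (B * slice_const ?n s) * ennreal (1 / \<bar>t - t'\<bar> powr s)"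
      using B0 C by (simp add: ennreal_mult'[symmetric] abs_minus_commute)
    finally show ?thesis .
  qed
  let ?E = "\<lambda>t t'. ennreal ((1 + \<theta>) * \<Psi> * slice_const ?n (1 + 2 * s)) * ennreal (\<bar>\<phi> t - \<phi> t'\<bar>\<^sup>2 / norm (t - t') powr (real DIM(real) + 2 * s))
        + ennreal (B * slice_const ?n s) * ennreal (1 / \<bar>t - t'\<bar> powr s)"
  have "gagliardo_integral s (strip_along e) u \<le>
    (\<integral>\<^sup>+t. (\<integral>\<^sup>+t'. ?E t t' * ?J t' \<partial>lborel) * ?J t \<partial>lborel)"
    unfolding gagliardo_strip[OF e u_borel]
  proof (rule nn_integral_mono, rule mult_right_mono)
    fix t :: real
    show "(\<integral>\<^sup>+t'. (\<integral>\<^sup>+z. ?k (t' - t) z * ?D t t' z \<partial>?\<mu>) * ?J t' \<partial>lborel)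
      \<le> (\<integral>\<^sup>+t'. ?E t t' * ?J t' \<partial>lborel)"
    \<comment> \<open>The diagonal is left out because the slice formula for the kernel requires t
      \<noteq> t'.\<close>
    proof (rule nn_integral_mono_AE, use AE_lborel_singleton[of t] in eventually_elim)
      fix t' :: real assume "t' \<noteq> t"
      then have "t \<noteq> t'" by simp
      then show "(\<integral>\<^sup>+z. ?k (t' - t) z * ?D t t' z \<partial>?\<mu>) * ?J t'
        \<le> ?E t t' * ?J t'"
        by (intro mult_right_mono outer) auto
    qed
  qed simp
  also have "\<dots> = ennreal ((1 + \<theta>) * \<Psi> * slice_const ?n (1 + 2 * s)) * gagliardo_integral s {-1<..<1} \<phi>
      + ennreal (B * slice_const ?n s) * (\<integral>\<^sup>+t. (\<integral>\<^sup>+t'. ennreal (1 / \<bar>t - t'\<bar> powr s) * ?J t' \<partial>lborel) * ?J t \<partial>lborel)"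
    unfolding gagliardo_lborel[OF borel_unit_interval]
    by (simp add: distrib_right mult.assoc nn_integral_add nn_integral_cmult)
  finally show ?thesis
    by (simp add: u_def[abs_def] B_def)
qed

text \<open>The strip inequality is tested on \<phi> times \<open>perp_cutoff e R\<close>. The
  factor \<Psi> appears on both sides and cancels, and the remaining error has order
  R^(-(1+s)).\<close>

lemma poincare_strip_to_interval:
  fixes e :: "'a::euclidean_space" and \<phi> :: "real \<Rightarrow> real"
  assumes s: "0 < s" "s < 1" and \<gamma>: "0 \<le> \<gamma>" and e: "e \<in> Basis" and \<phi>: "\<phi> \<in> test_functions {-1<..<1}"
    and strip: "\<And>u. u \<in> test_functions (strip_along e) \<inter> sobolev_space s (strip_along e) \<Longrightarrow>
      \<gamma> * L2_sq (strip_along e) u \<le> (frac_seminorm s (strip_along e) u)\<^sup>2"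
  shows "\<gamma> * L2_sq {-1<..<1} \<phi> \<le> (frac_seminorm s {-1<..<1} \<phi>)\<^sup>2"
proof -
  let ?n = "DIM('a)" and ?N = "LINT x|lebesgue_on {-1<..<1}. (\<phi> x)\<^sup>2" and ?S = "(frac_seminorm s {-1<..<1} \<phi>)\<^sup>2"
  let ?C = "slice_const ?n (1 + 2 * s)"
  have n: "?n \<ge> 1" by (simp add: DIM_positive Suc_leI)
  have C: "?C > 0" "slice_const ?n s > 0"
    using s n by (auto intro!: slice_const_pos)
  have [measurable]: "\<phi> \<in> borel_measurable borel"
    by (rule test_functions_borel[OF \<phi>])
  obtain M r where M: "\<And>t. \<bar>\<phi> t\<bar> \<le> M" "\<And>t. t \<notin> cball 0 r \<Longrightarrow> \<phi> t = 0"
    using test_functions_bounded[OF \<phi>] by blast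
  obtain L where L: "L > 0" "\<And>R (x::'a) y e. R > 0 \<Longrightarrow> \<bar>perp_cutoff e R x - perp_cutoff e R y\<bar> \<le> L / R * norm (x - y)"
    using perp_cutoff_lipschitz by blast
  let ?I = "\<integral>\<^sup>+t. (\<integral>\<^sup>+t'. ennreal (1 / \<bar>t - t'\<bar> powr s) * indicator {-1<..<1} t' \<partial>lborel) * indicator {-1<..<1::real} t \<partial>lborel"
  have I: "?I < \<infinity>"
    by (rule nn_integral_interval_powr_finite[OF s(2)])
  have G: "gagliardo_integral s {-1<..<1} \<phi> < \<infinity>"
    using sobolev_spaceD[OF test_function_interval_sobolev[OF s \<phi>]] by simp
  \<comment> \<open>The part of the error that depends neither on R nor on \<theta>.\<close>
  define \<kappa> where "\<kappa> = frac_const ?n s / 2 * (M\<^sup>2 * (2 ^ ?n * L powr (1 + s)) * slice_const ?n s * enn2real ?I)"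
  have main: "\<gamma> * ?N \<le> (1 + \<theta>) * ?S + (1 + 1 / \<theta>) * \<kappa> * R powr (- (1 + s))" if R: "R > 0" and \<theta>: "\<theta> > 0" for R \<theta>
  proof -
    obtain \<Psi> where \<Psi>: "\<Psi> \<ge> R ^ (?n - 1)" "(\<integral>\<^sup>+a. ennreal ((perp_cutoff e R a)\<^sup>2) \<partial>perp_lborel e) = ennreal \<Psi>"
      using perp_cutoff_sq_integral[OF e R] by blast
    have \<Psi>0: "\<Psi> > 0"
      using \<Psi>(1) R by (auto intro: less_le_trans[rotated])
    define u where "u x = \<phi> (x \<bullet> e) * perp_cutoff e R x" for x
    have u: "u \<in> test_functions (strip_along e)"
      unfolding u_def by (rule strip_product_test_function[OF e R \<phi>])
    interpret strip_test_function e u by standard fact+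
    let ?P = "(1 + \<theta>) * \<Psi> * ?C"
      and ?Q = "(1 + 1 / \<theta>) * M\<^sup>2 * \<Psi> * (2 ^ ?n * L powr (1 + s)) * R powr (- (1 + s)) * slice_const ?n s"
    have le: "gagliardo_integral s (strip_along e) u \<le> ennreal ?P * gagliardo_integral s {-1<..<1} \<phi> + ennreal ?Q * ?I"
      unfolding u_def using gagliardo_product_le[OF s e \<phi> M(1) L(1) L(2)[OF R] R \<theta> \<Psi>] .
    have fin: "ennreal ?P * gagliardo_integral s {-1<..<1} \<phi> < \<infinity>" "ennreal ?Q * ?I < \<infinity>"
      using G I by (auto simp: ennreal_mult_less_top)
    then have "ennreal ?P * gagliardo_integral s {-1<..<1} \<phi> + ennreal ?Q * ?I < \<infinity>"
      by simp
    then have uG: "gagliardo_integral s (strip_along e) u < \<infinity>"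
      using le by (rule le_less_trans[rotated])
    have PQ: "?P \<ge> 0" "?Q \<ge> 0"
      using \<Psi>0 \<theta> C by auto
    have "enn2real (gagliardo_integral s (strip_along e) u) \<le> enn2real (ennreal ?P * gagliardo_integral s {-1<..<1} \<phi> + ennreal ?Q * ?I)"
      using le fin by (intro enn2real_mono) auto
    also have "\<dots> = ?P * enn2real (gagliardo_integral s {-1<..<1} \<phi>) + ?Q * enn2real ?I"
      using fin PQ by (subst enn2real_plus) (auto simp: enn2real_mult)
    finally have S: "frac_const ?n s / 2 * enn2real (gagliardo_integral s (strip_along e) u)
        \<le> frac_const ?n s / 2 * (?P * enn2real (gagliardo_integral s {-1<..<1} \<phi>) + ?Q * enn2real ?I)"
      using frac_const_pos[OF s, of ?n] by (intro mult_left_mono) auto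
    also have "\<dots> = \<Psi> * ((1 + \<theta>) * (frac_const ?n s * ?C / 2 * enn2real (gagliardo_integral s {-1<..<1} \<phi>))
        + (1 + 1 / \<theta>) * \<kappa> * R powr (- (1 + s)))"
      unfolding \<kappa>_def distrib_left by (simp only: mult_ac times_divide_eq_left times_divide_eq_right)
    also have "frac_const ?n s * ?C / 2 * enn2real (gagliardo_integral s {-1<..<1} \<phi>) = ?S"
      unfolding frac_seminorm_sq[OF s] frac_const_slice[OF s n] by simp
    finally have S: "(frac_seminorm s (strip_along e) u)\<^sup>2 \<le> \<Psi> * ((1 + \<theta>) * ?S + (1 + 1 / \<theta>) * \<kappa> * R powr (- (1 + s)))"
      unfolding frac_seminorm_sq[OF s, of "strip_along e"] .
    have int\<psi>: "(LINT a|perp_lborel e. (perp_cutoff e R a)\<^sup>2) = \<Psi>"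
      using \<Psi>(2) \<Psi>0 by (subst integral_eq_nn_integral) auto
    have "slice_norm_sq e u t = \<Psi> * (\<phi> t)\<^sup>2" for t
    proof -
      have "slice_norm_sq e u t = (LINT a|perp_lborel e. (\<phi> t)\<^sup>2 * (perp_cutoff e R a)\<^sup>2)"
        unfolding slice_norm_sq_def
      proof (rule integral_cong_AE)
        show "AE a in perp_lborel e. (u (a + t *\<^sub>R e))\<^sup>2 = (\<phi> t)\<^sup>2 * (perp_cutoff e R a)\<^sup>2"
          using AE_perp_lborel[OF e] e
          by (auto elim!: eventually_mono simp: u_def perp_cutoff_shift[OF e] inner_add_left power_mult_distrib)
      qed measurable
      then show ?thesis by (simp add: int\<psi>)
    qed
    then have "slice_norm_sq e u = (\<lambda>t. \<Psi> * (\<phi> t)\<^sup>2)"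
      by (rule ext)
    then have "L2_sq (strip_along e) u = \<Psi> * ?N"
      unfolding L2_slice by simp
    moreover have "\<gamma> * L2_sq (strip_along e) u \<le> (frac_seminorm s (strip_along e) u)\<^sup>2"
      using u test_function_in_sobolev_space[OF u borel_strip_along uG] by (intro strip) simp
    ultimately have "\<Psi> * (\<gamma> * ?N) \<le> \<Psi> * ((1 + \<theta>) * ?S + (1 + 1 / \<theta>) * \<kappa> * R powr (- (1 + s)))"
      using S by (simp add: mult_ac)
    then show ?thesis
      using \<Psi>0 by simp
  qed
  \<comment> \<open>\<theta> stays fixed while R tends to infinity, because 1 + 1/\<theta>
    multiplies the error.\<close>
  have "\<gamma> * ?N \<le> (1 + \<theta>) * ?S" if \<theta>: "\<theta> > 0" for \<theta>
  proof (rule tendsto_lowerbound)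
    have "((\<lambda>R. R powr (- (1 + s))) \<longlongrightarrow> 0) at_top"
      using s by (intro tendsto_neg_powr filterlim_ident) auto
    then have "((\<lambda>R. (1 + \<theta>) * ?S + (1 + 1 / \<theta>) * \<kappa> * R powr (- (1 + s))) \<longlongrightarrow> (1 + \<theta>) * ?S + (1 + 1 / \<theta>) * \<kappa> * 0) at_top"
      by (intro tendsto_intros)
    then show "((\<lambda>R. (1 + \<theta>) * ?S + (1 + 1 / \<theta>) * \<kappa> * R powr (- (1 + s))) \<longlongrightarrow> (1 + \<theta>) * ?S) at_top"
      by simp
    show "\<forall>\<^sub>F R in at_top. \<gamma> * ?N \<le> (1 + \<theta>) * ?S + (1 + 1 / \<theta>) * \<kappa> * R powr (- (1 + s))"
      using eventually_gt_at_top[of 0] by eventually_elim (rule main[OF _ \<theta>])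
  qed simp
  moreover have "((\<lambda>\<theta>. (1 + \<theta>) * ?S) \<longlongrightarrow> (1 + 0) * ?S) (at_right 0)"
    by (intro tendsto_intros)
  ultimately have "\<gamma> * ?N \<le> (1 + 0) * ?S"
    by (rule le_limit_at_right_0[rotated])
  then show ?thesis by simp
qed

subsection \<open>Positivity for \<open>s > 1/2\<close>\<close>

text \<open>The weighted bound of (\<phi> x)^2 by (\<phi> y)^2 and (\<phi> x - \<phi> y)^2 is
  integrated over x in the interval and y in its left half. There |x - y| < l, so (\<phi> x - \<phi>
  y)^2 is at most l^(1+2s) times the integrand of the energy.\<close>

lemma interval_halving:
  fixes \<phi> :: "real \<Rightarrow> real"
  assumes s: "0 < s" and [measurable]: "\<phi> \<in> borel_measurable borel" and \<theta>: "\<theta> > 0" and l: "0 < l" "l \<le> 2"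
  defines "F \<equiv> \<lambda>l. \<integral>\<^sup>+x. ennreal ((\<phi> x)\<^sup>2) * indicator {-1<..<-1 + l} x \<partial>lborel"
  shows "ennreal (l / 2) * F l \<le> ennreal ((1 + \<theta>) * l) * F (l / 2)
    + ennreal ((1 + 1 / \<theta>) * l powr (1 + 2 * s)) * gagliardo_integral s {-1<..<1} \<phi>"
proof -
  let ?J = "indicator {-1<..<1::real} :: real \<Rightarrow> ennreal"
  let ?I = "\<lambda>l. indicator {-1<..<-1 + l} :: real \<Rightarrow> ennreal"
  let ?k = "\<lambda>x y. ennreal (\<bar>\<phi> x - \<phi> y\<bar>\<^sup>2 / norm (x - y) powr (real DIM(real) + 2 * s))"
  have em: "(\<integral>\<^sup>+x. ?I r x \<partial>lborel) = ennreal r" if "r > 0" for r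
    using that by simp
  have "ennreal (l / 2) * F l = (\<integral>\<^sup>+x. (\<integral>\<^sup>+y. ennreal ((\<phi> x)\<^sup>2) * ?I l x * ?I (l / 2) y \<partial>lborel) \<partial>lborel)"
    using l em[of "l / 2"] by (simp add: F_def nn_integral_cmult nn_integral_multc mult.commute)
  also have "\<dots> \<le> (\<integral>\<^sup>+x. (\<integral>\<^sup>+y. ennreal (1 + \<theta>) * (?I l x * (ennreal ((\<phi> y)\<^sup>2) * ?I (l / 2) y))
      + ennreal ((1 + 1 / \<theta>) * l powr (1 + 2 * s)) * (?k x y * ?J y * ?J x) \<partial>lborel) \<partial>lborel)"
  proof (intro nn_integral_mono)
    fix x y :: real
    show "ennreal ((\<phi> x)\<^sup>2) * ?I l x * ?I (l / 2) y
      \<le> ennreal (1 + \<theta>) * (?I l x * (ennreal ((\<phi> y)\<^sup>2) * ?I (l / 2) y))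
      + ennreal ((1 + 1 / \<theta>) * l powr (1 + 2 * s)) * (?k x y * ?J y * ?J x)"
    proof (cases "x \<in> {-1<..<-1 + l} \<and> y \<in> {-1<..<-1 + l / 2}")
      case True
      have a: "(\<phi> x)\<^sup>2 \<le> (1 + \<theta>) * (\<phi> y)\<^sup>2 + (1 + 1 / \<theta>) * (\<phi> x - \<phi> y)\<^sup>2"
        using add_sq_le[OF \<theta>, of "\<phi> y" "\<phi> x - \<phi> y"] by simp
      have b: "(\<phi> x - \<phi> y)\<^sup>2 \<le> l powr (1 + 2 * s) * (\<bar>\<phi> x - \<phi> y\<bar>\<^sup>2 / norm (x - y) powr (1 + 2 * s))"
      proof (cases "x = y")
        case False
        have "\<bar>x - y\<bar> powr (1 + 2 * s) \<le> l powr (1 + 2 * s)"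
          using True s l by (intro powr_mono2) auto
        then have "(\<phi> x - \<phi> y)\<^sup>2 * \<bar>x - y\<bar> powr (1 + 2 * s) \<le> (\<phi> x - \<phi> y)\<^sup>2 * l powr (1 + 2 * s)"
          by (rule mult_left_mono) simp
        then show ?thesis using False by (simp add: pos_le_divide_eq mult.commute)
      qed simp
      have "1 + 1 / \<theta> \<ge> 0" using \<theta> by simp
      from order_trans[OF a add_left_mono[OF mult_left_mono[OF b this]]]
      have "(\<phi> x)\<^sup>2 \<le> (1 + \<theta>) * (\<phi> y)\<^sup>2
          + ((1 + 1 / \<theta>) * l powr (1 + 2 * s)) * (\<bar>\<phi> x - \<phi> y\<bar>\<^sup>2 / norm (x - y) powr (1 + 2 * s))"
        by (simp only: mult.assoc)
      from ennreal_leI[OF this] have "ennreal ((\<phi> x)\<^sup>2) \<le> ennreal (1 + \<theta>) * ennreal ((\<phi> y)\<^sup>2)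
          + ennreal ((1 + 1 / \<theta>) * l powr (1 + 2 * s)) * ?k x y"
        using \<theta> by (subst (asm) ennreal_plus) (auto simp: ennreal_mult'[symmetric] simp del: ennreal_plus)
      moreover have "x \<in> {-1<..<1}" "y \<in> {-1<..<1}" using True l by auto
      ultimately show ?thesis using True by simp
    qed (auto simp: indicator_def)
  qed
  also have "\<dots> = ennreal (1 + \<theta>) * (ennreal l * F (l / 2))
      + ennreal ((1 + 1 / \<theta>) * l powr (1 + 2 * s)) * gagliardo_integral s {-1<..<1} \<phi>"
    unfolding gagliardo_lborel[OF borel_unit_interval] F_def
    using em[OF l(1)] by (simp add: nn_integral_add nn_integral_cmult nn_integral_multc)
  also have "ennreal (1 + \<theta>) * (ennreal l * F (l / 2)) = ennreal ((1 + \<theta>) * l) * F (l / 2)"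
    using \<theta> l by (simp add: ennreal_mult' mult.assoc)
  finally show ?thesis .
qed

text \<open>After division by l/2 the halving estimate is fed with the ansatz f l \<le> K l^(2s) g.
  Passing from l/2 to l multiplies it by r (1 + \<theta>), where r = 2^(1-2s) < 1 leaves room for
  \<theta>; so the ansatz reproduces itself with a K independent of the number of halvings.\<close>

lemma interval_poincare:
  assumes s: "1/2 < s" "s < 1"
  obtains c where "c > 0" "\<And>\<phi>. \<phi> \<in> test_functions {-1<..<1::real} \<Longrightarrow>
    c * L2_sq {-1<..<1} \<phi> \<le> (frac_seminorm s {-1<..<1} \<phi>)\<^sup>2"
proof -
  have s0: "0 < s" using s by simp
  define r where "r = 2 powr (1 - 2 * s)"
  have r: "0 < r" "r < 1"
    using s by (auto simp: r_def powr_less_one)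
  \<comment> \<open>Makes r (1 + \<theta>) equal to (1 + r)/2, which is below 1.\<close>
  define \<theta> where "\<theta> = (1 / r - 1) / 2"
  have \<theta>: "\<theta> > 0" "r * (1 + \<theta>) < 1"
    using r by (auto simp: \<theta>_def field_simps)
  \<comment> \<open>The fixed point of the recursion for the constant, as the equation
    \<open>K\<close> below confirms.\<close>
  define K where "K = 2 * (1 + 1 / \<theta>) / (1 - r * (1 + \<theta>))"
  have K0: "K > 0"
    unfolding K_def using \<theta> by (intro divide_pos_pos mult_pos_pos add_pos_pos) auto
  have K: "r * (1 + \<theta>) * K + 2 * (1 + 1 / \<theta>) = K"
    using \<theta>(2) by (simp add: K_def divide_simps) (simp add: algebra_simps)
  have main: "L2_sq {-1<..<1} \<phi> \<le> K * 2 powr (2 * s) * enn2real (gagliardo_integral s {-1<..<1} \<phi>)"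
    if \<phi>: "\<phi> \<in> test_functions {-1<..<1::real}" for \<phi>
  proof -
    have [measurable]: "\<phi> \<in> borel_measurable borel"
      by (rule test_functions_borel[OF \<phi>])
    define F where "F l = (\<integral>\<^sup>+x. ennreal ((\<phi> x)\<^sup>2) * indicator {-1<..<-1 + l} x \<partial>lborel)" for l
    define g where "g = enn2real (gagliardo_integral s {-1<..<1} \<phi>)"
    have g: "gagliardo_integral s {-1<..<1} \<phi> = ennreal g" "g \<ge> 0"
      using sobolev_spaceD(3)[OF test_function_interval_sobolev[OF s0 s(2) \<phi>]] by (auto simp: g_def)
    have fin: "F l < \<infinity>" if "l \<le> 2" for l
    proof -
      have "F l \<le> (\<integral>\<^sup>+x. ennreal ((\<phi> x)\<^sup>2) * indicator {-1<..<1} x \<partial>lborel)"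
        unfolding F_def using that by (intro nn_integral_mono) (auto simp: indicator_def)
      also have "\<dots> < \<infinity>" by (rule test_function_L2[OF \<phi>]) simp
      finally show ?thesis .
    qed
    define f where "f l = enn2real (F l)" for l
    have Ff: "F l = ennreal (f l)" if "l \<le> 2" for l
      using fin[OF that] by (simp add: f_def)
    have f0: "f l \<ge> 0" for l by (simp add: f_def)
    have step: "f l \<le> 2 * (1 + \<theta>) * f (l / 2) + 2 * (1 + 1 / \<theta>) * l powr (2 * s) * g" if l: "0 < l" "l \<le> 2" for l
    proof -
      have "ennreal (l / 2) * F l \<le> ennreal ((1 + \<theta>) * l) * F (l / 2)
          + ennreal ((1 + 1 / \<theta>) * l powr (1 + 2 * s)) * gagliardo_integral s {-1<..<1} \<phi>"
        unfolding F_def by (rule interval_halving[OF s0 _ \<theta>(1) l]) measurable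
      then have "ennreal (l / 2 * f l) \<le> ennreal ((1 + \<theta>) * l * f (l / 2) + (1 + 1 / \<theta>) * l powr (1 + 2 * s) * g)"
        using l \<theta>(1) g f0 by (simp add: Ff ennreal_mult'[symmetric] ennreal_plus[symmetric] del: ennreal_plus)
      then have "l / 2 * f l \<le> (1 + \<theta>) * l * f (l / 2) + (1 + 1 / \<theta>) * l powr (1 + 2 * s) * g"
        using l \<theta>(1) g f0 by (subst (asm) ennreal_le_iff) auto
      also have "l powr (1 + 2 * s) = l * l powr (2 * s)"
        using l by (simp add: powr_add)
      finally have "l / 2 * f l \<le> l / 2 * (2 * (1 + \<theta>) * f (l / 2) + 2 * (1 + 1 / \<theta>) * l powr (2 * s) * g)"
        by (simp add: algebra_simps)
      then show ?thesis using l by (simp only: mult_le_cancel_left_pos half_gt_zero)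
    qed
    obtain C where C: "compact C" "C \<subseteq> {-1<..<1}" "\<And>x. x \<notin> C \<Longrightarrow> \<phi> x = 0"
      using test_functionsE[OF \<phi>] by blast
    \<comment> \<open>The support stays away from -1, so \<open>f l\<close> is 0 for small l; this
      starts the induction, and \<delta> does not enter the final constant.\<close>
    obtain \<delta> where \<delta>: "\<delta> > 0" "\<And>x. x < -1 + \<delta> \<Longrightarrow> \<phi> x = 0"
    proof (cases "C = {}")
      case True
      then show ?thesis using that[of 1] C(3) by auto
    next
      case False
      obtain c where c: "c \<in> C" "\<And>x. x \<in> C \<Longrightarrow> c \<le> x"
        using compact_attains_inf[OF C(1) False] by blast
      show ?thesis
      proof (rule that[of "c + 1"])
        show "c + 1 > 0" using c(1) C(2) by force
        show "\<phi> x = 0" if "x < -1 + (c + 1)" for x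
          using c(2)[of x] C(3)[of x] that by force
      qed
    qed
    have "0 < l \<Longrightarrow> l \<le> 2 \<Longrightarrow> l \<le> 2 ^ n * \<delta> \<Longrightarrow> f l \<le> K * l powr (2 * s) * g" for l n
    proof (induction n arbitrary: l)
      case 0
      have "F l = 0"
        unfolding F_def using \<delta>(2) "0.prems" by (intro nn_integral_zero' always_eventually) (auto simp: indicator_def)
      then show ?case using K0 g by (simp add: f_def)
    next
      case (Suc n)
      have IH: "f (l / 2) \<le> K * (l / 2) powr (2 * s) * g"
        using Suc.prems by (intro Suc.IH) auto
      have eq: "(l / 2) powr (2 * s) = l powr (2 * s) * r / 2"
        using Suc.prems by (simp add: r_def powr_divide powr_diff)
      have "2 * (1 + \<theta>) * f (l / 2) \<le> 2 * (1 + \<theta>) * (K * (l powr (2 * s) * r / 2) * g)"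
        using IH \<theta>(1) unfolding eq by (intro mult_left_mono) auto
      then have "f l \<le> 2 * (1 + \<theta>) * (K * (l powr (2 * s) * r / 2) * g) + 2 * (1 + 1 / \<theta>) * l powr (2 * s) * g"
        using step[of l] Suc.prems by linarith
      also have "\<dots> = (r * (1 + \<theta>) * K + 2 * (1 + 1 / \<theta>)) * (l powr (2 * s) * g)"
        by (simp add: algebra_simps)
      finally show ?case unfolding K by (simp add: mult.assoc)
    qed
    note * = this
    obtain n where "2 / \<delta> < 2 ^ n"
      using real_arch_pow[of 2 "2 / \<delta>"] by auto
    then have "f 2 \<le> K * 2 powr (2 * s) * g"
      using \<delta>(1) by (intro *[of 2 n]) (auto simp: divide_less_eq)
    then show ?thesis
      by (simp add: f_def F_def g_def integral_lebesgue_on_lborel)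
  qed
  let ?c = "frac_const 1 s / 2 / (K * 2 powr (2 * s))"
  show ?thesis
  proof (rule that[of ?c])
    show "?c > 0" using K0 frac_const_pos[OF s0 s(2), of 1] by simp
    fix \<phi> assume \<phi>: "\<phi> \<in> test_functions {-1<..<1::real}"
    have "?c * L2_sq {-1<..<1} \<phi> \<le> ?c * (K * 2 powr (2 * s) * enn2real (gagliardo_integral s {-1<..<1} \<phi>))"
      using main[OF \<phi>] \<open>?c > 0\<close> by (intro mult_left_mono) auto
    also have "\<dots> = (frac_seminorm s {-1<..<1} \<phi>)\<^sup>2"
      unfolding frac_seminorm_sq[OF s0 s(2)] using K0 by simp
    finally show "?c * L2_sq {-1<..<1} \<phi> \<le> (frac_seminorm s {-1<..<1} \<phi>)\<^sup>2" .
  qed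
qed

subsection \<open>Vanishing for \<open>s \<le> 1/2\<close>\<close>

text \<open>The Gaussian representation of powers with p = 1 and d = 1/2; the constant is
  pi.\<close>

lemma nn_integral_inverse_quadratic:
  obtains c where "c > 0" "\<And>d. d > 0 \<Longrightarrow> (\<integral>\<^sup>+t. ennreal (1 / (t\<^sup>2 + d\<^sup>2)) \<partial>lborel) = ennreal (c / d)"
proof
  let ?c = "pi powr (1 / 2) * Gamma (1 / 2) / Gamma (1::real) :: real"
  show "?c > 0"
    by (intro divide_pos_pos mult_pos_pos Gamma_real_pos) auto
  fix d :: real assume d: "d > 0"
  have "(\<integral>\<^sup>+t. ennreal ((t\<^sup>2 + d\<^sup>2) powr (- 1)) \<partial>lborel) = ennreal (pi powr (1 / 2) * Gamma (1 - 1 / 2) / Gamma (1::real) * (d\<^sup>2) powr (- (1 - 1 / 2)))"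
  proof (rule nn_integral_power_of_gaussian)
    show "sigma_finite_measure lborel" ..
    show "(\<integral>\<^sup>+t. ennreal (exp (- r * t\<^sup>2)) \<partial>lborel) = ennreal ((pi / r) powr (1 / 2))" if "r > 0" for r
      using nn_integral_gaussian_real[OF that] that by (simp add: powr_half_sqrt)
  qed (use d in auto)
  moreover have "(t\<^sup>2 + d\<^sup>2) powr (- 1) = 1 / (t\<^sup>2 + d\<^sup>2)" for t
    using d by (simp add: powr_minus_divide add_nonneg_nonneg)
  moreover have "(d\<^sup>2) powr (- (1 - 1 / 2)) = 1 / d"
    using d powr_minus_divide[of "d\<^sup>2" "1/2"] by (simp add: powr_half_sqrt)
  ultimately show "(\<integral>\<^sup>+t. ennreal (1 / (t\<^sup>2 + d\<^sup>2)) \<partial>lborel) = ennreal (?c / d)"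
    by simp
qed

text \<open>The exponent \<open>1/2\<close> is scale invariant, which bounds the energy of the cutoffs uniformly.\<close>

lemma gagliardo_cutoff_bounded:
  assumes s: "0 < s" "s \<le> 1/2"
  obtains B where "\<And>d. 0 < d \<Longrightarrow> d \<le> 1/4 \<Longrightarrow> gagliardo_integral s {-1<..<1} (cutoff d) \<le> ennreal B"
proof -
  obtain L where L: "L > 0" "\<And>d x y. d > 0 \<Longrightarrow> \<bar>cutoff d x - cutoff d y\<bar> \<le> L / d * \<bar>x - y\<bar>"
    using cutoff_lipschitz by blast
  obtain c where c: "c > 0" "\<And>d. d > 0 \<Longrightarrow> (\<integral>\<^sup>+t. ennreal (1 / (t\<^sup>2 + d\<^sup>2)) \<partial>lborel) = ennreal (c / d)"
    using nn_integral_inverse_quadratic by blast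
  have "gagliardo_integral s {-1<..<1} (cutoff d) \<le> ennreal (2 * (1 + L\<^sup>2) * (8 * c))" if d: "0 < d" "d \<le> 1/4" for d
  proof -
    let ?J = "indicator {-1<..<1::real} :: real \<Rightarrow> ennreal"
    \<comment> \<open>The increment of the cutoff vanishes unless one of the two points lies in a
      layer of width 2 d at an endpoint; the two layers have total length 4 d.\<close>
    define T where "T x = (indicator {-1<..<-1 + 2 * d} x + indicator {1 - 2 * d<..<1} x :: ennreal)" for x :: real
    have [measurable]: "T \<in> borel_measurable borel" unfolding T_def by measurable
    have T: "(\<integral>\<^sup>+x. T x \<partial>lborel) = ennreal (4 * d)"
      using d by (simp add: T_def nn_integral_add ennreal_plus[symmetric] del: ennreal_plus)
    let ?h = "\<lambda>x y. ennreal (1 / ((x - y)\<^sup>2 + d\<^sup>2))"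
    have h: "(\<integral>\<^sup>+y. ?h x y \<partial>lborel) = ennreal (c / d)" for x
    proof -
      have "(\<integral>\<^sup>+y. ennreal (1 / ((x - y)\<^sup>2 + d\<^sup>2)) \<partial>lborel) = (\<integral>\<^sup>+t. ennreal (1 / (t\<^sup>2 + d\<^sup>2)) \<partial>lborel)"
        by (subst nn_integral_real_affine[where c="-1" and t=x]) auto
      then show ?thesis using c(2)[OF d(1)] by simp
    qed
    have h': "(\<integral>\<^sup>+x. ?h x y \<partial>lborel) = ennreal (c / d)" for y
      using h[of y] by (simp add: power2_commute[of y])
    have pt: "ennreal (\<bar>cutoff d x - cutoff d y\<bar>\<^sup>2 / norm (x - y) powr (real DIM(real) + 2 * s))
        \<le> ennreal (2 * (1 + L\<^sup>2)) * (?h x y * (T x + T y))" if xy: "x \<in> {-1<..<1}" "y \<in> {-1<..<1}" for x y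
    proof (cases "x = y \<or> (\<bar>x\<bar> \<le> 1 - 2 * d \<and> \<bar>y\<bar> \<le> 1 - 2 * d)")
      case True
      then have "cutoff d x = cutoff d y"
        using cutoff_eq_1[OF d(1)] by auto
      then show ?thesis by simp
    next
      case False
      define \<tau> where "\<tau> = \<bar>x - y\<bar>"
      define N where "N = \<bar>cutoff d x - cutoff d y\<bar>\<^sup>2"
      have \<tau>: "\<tau> > 0" "\<tau> < 2" using False xy by (auto simp: \<tau>_def)
      have N1: "N \<le> 1"
        using cutoff_bounds[of d x] cutoff_bounds[of d y] by (auto simp: N_def abs_square_le_1)
      have "N \<le> (L / d * \<tau>)\<^sup>2"
        unfolding N_def \<tau>_def using L(2)[OF d(1)] by (intro power_mono) auto
      then have N2: "N * d\<^sup>2 \<le> L\<^sup>2 * \<tau>\<^sup>2"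
        using d by (simp add: power_mult_distrib power_divide field_simps)
      have N0: "N \<ge> 0" by (simp add: N_def)
      \<comment> \<open>Combines N \<le> 1 with N \<le> L^2 \<tau>^2 / d^2 into one kernel whose
        integral is of order 1/d.\<close>
      have "N / \<tau>\<^sup>2 \<le> (1 + L\<^sup>2) / (\<tau>\<^sup>2 + d\<^sup>2)"
      proof -
        have "N * \<tau>\<^sup>2 \<le> 1 * \<tau>\<^sup>2" using N1 by (intro mult_right_mono) auto
        then have "N * (\<tau>\<^sup>2 + d\<^sup>2) \<le> (1 + L\<^sup>2) * \<tau>\<^sup>2"
          using N2 by (simp add: algebra_simps)
        moreover have "\<tau>\<^sup>2 + d\<^sup>2 > 0" "\<tau>\<^sup>2 > 0" using \<tau> by (auto intro: add_pos_nonneg)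
        ultimately show ?thesis by (simp add: divide_le_eq pos_le_divide_eq mult.commute mult.left_commute times_divide_eq_left)
      qed
      \<comment> \<open>On an interval of length 2 the kernel for s \<le> 1/2 is at most twice the
        one for s = 1/2.\<close>
      moreover have "N / \<tau> powr (1 + 2 * s) \<le> 2 * (N / \<tau>\<^sup>2)"
      proof -
        have "\<tau>\<^sup>2 = \<tau> powr (1 + 2 * s) * \<tau> powr (1 - 2 * s)"
          using \<tau> by (simp add: powr_add[symmetric])
        moreover have "\<tau> powr (1 - 2 * s) \<le> 2 powr (1 - 2 * s)"
          using \<tau> s by (intro powr_mono2) auto
        moreover have "2 powr (1 - 2 * s) \<le> 2 powr 1"
          using s by (intro powr_mono) auto
        ultimately have "\<tau>\<^sup>2 \<le> \<tau> powr (1 + 2 * s) * 2"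
          by (simp only:) (intro mult_left_mono, auto)
        then have "1 / \<tau> powr (1 + 2 * s) \<le> 2 / \<tau>\<^sup>2"
          using \<tau> by (simp add: divide_simps mult.commute)
        from mult_left_mono[OF this N0] show ?thesis by (simp add: mult.commute)
      qed
      ultimately have "N / \<tau> powr (1 + 2 * s) \<le> 2 * ((1 + L\<^sup>2) / (\<tau>\<^sup>2 + d\<^sup>2))"
        by linarith
      then have "N / \<tau> powr (1 + 2 * s) \<le> 2 * (1 + L\<^sup>2) * (1 / (\<tau>\<^sup>2 + d\<^sup>2))"
        by simp
      then have le: "ennreal (N / \<tau> powr (1 + 2 * s)) \<le> ennreal (2 * (1 + L\<^sup>2)) * ?h x y"
        unfolding \<tau>_def by (subst ennreal_mult'[symmetric]) (simp_all only: power2_abs ennreal_leI, simp)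
      have "1 \<le> T x + T y"
        using False xy by (auto simp: T_def indicator_def abs_le_iff)
      then have "ennreal (2 * (1 + L\<^sup>2)) * ?h x y * 1 \<le> ennreal (2 * (1 + L\<^sup>2)) * ?h x y * (T x + T y)"
        by (rule mult_left_mono) simp
      with le show ?thesis by (simp add: N_def \<tau>_def mult.assoc del: ennreal_plus)
    qed
    have "gagliardo_integral s {-1<..<1} (cutoff d)
        \<le> (\<integral>\<^sup>+x. (\<integral>\<^sup>+y. ennreal (2 * (1 + L\<^sup>2)) * (?h x y * (T x + T y)) \<partial>lborel) \<partial>lborel)"
      unfolding gagliardo_lborel[OF borel_unit_interval]
    proof (intro nn_integral_mono)
      fix x :: real
      let ?k = "\<lambda>y. ennreal (\<bar>cutoff d x - cutoff d y\<bar>\<^sup>2 / norm (x - y) powr (real DIM(real) + 2 * s))"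
      show "(\<integral>\<^sup>+y. ?k y * ?J y \<partial>lborel) * ?J x \<le> (\<integral>\<^sup>+y. ennreal (2 * (1 + L\<^sup>2)) * (?h x y * (T x + T y)) \<partial>lborel)"
      proof (cases "x \<in> {-1<..<1}")
        case True
        have "(\<integral>\<^sup>+y. ?k y * ?J y \<partial>lborel) \<le> (\<integral>\<^sup>+y. ennreal (2 * (1 + L\<^sup>2)) * (?h x y * (T x + T y)) \<partial>lborel)"
        proof (intro nn_integral_mono)
          fix y :: real
          show "?k y * ?J y \<le> ennreal (2 * (1 + L\<^sup>2)) * (?h x y * (T x + T y))"
          proof (cases "y \<in> {-1<..<1}")
            case y: True
            then show ?thesis using pt[OF True y] by (simp only: indicator_simps mult_1_right)
          qed simp
        qed
        with True show ?thesis by (simp only: indicator_simps mult_1_right)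
      qed simp
    qed
    also have "\<dots> = ennreal (2 * (1 + L\<^sup>2)) * ((\<integral>\<^sup>+x. (\<integral>\<^sup>+y. ?h x y * T x \<partial>lborel) \<partial>lborel) + (\<integral>\<^sup>+x. (\<integral>\<^sup>+y. ?h x y * T y \<partial>lborel) \<partial>lborel))"
      by (simp add: distrib_left nn_integral_add nn_integral_cmult)
    also have "(\<integral>\<^sup>+x. (\<integral>\<^sup>+y. ?h x y * T x \<partial>lborel) \<partial>lborel) = ennreal (c / d) * ennreal (4 * d)"
      unfolding T[symmetric] by (subst nn_integral_multc) (auto simp: h nn_integral_cmult)
    also have "(\<integral>\<^sup>+x. (\<integral>\<^sup>+y. ?h x y * T y \<partial>lborel) \<partial>lborel) = (\<integral>\<^sup>+y. (\<integral>\<^sup>+x. ?h x y * T y \<partial>lborel) \<partial>lborel)"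
      by (rule lborel_pair.Fubini') measurable
    also have "\<dots> = ennreal (c / d) * ennreal (4 * d)"
      unfolding T[symmetric] by (subst nn_integral_multc) (auto simp: h' nn_integral_cmult)
    \<comment> \<open>The width d cancels between the mass c/d of the kernel and the length 4 d of
      the layers.\<close>
    also have "ennreal (2 * (1 + L\<^sup>2)) * (ennreal (c / d) * ennreal (4 * d) + ennreal (c / d) * ennreal (4 * d)) = ennreal (2 * (1 + L\<^sup>2) * (8 * c))"
      using c d by (simp add: ennreal_mult'[symmetric] ennreal_plus[symmetric] del: ennreal_plus)
    finally show ?thesis .
  qed
  then show ?thesis using that by blast
qed

text \<open>The identity is arranged without subtracting energies, hence valid in
  \<open>ennreal\<close> also when they are infinite. The midpoint is the form in which convexity
  enters.\<close>

lemma gagliardo_parallelogram: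
  fixes u v :: "'a::euclidean_space \<Rightarrow> real"
  assumes \<Omega>: "\<Omega> \<in> sets borel" and u[measurable]: "u \<in> borel_measurable borel" and v[measurable]: "v \<in> borel_measurable borel"
  shows "gagliardo_integral s \<Omega> (\<lambda>x. u x - v x) + 4 * gagliardo_integral s \<Omega> (\<lambda>x. (u x + v x) / 2)
    = 2 * gagliardo_integral s \<Omega> u + 2 * gagliardo_integral s \<Omega> v"
proof -
  note [measurable] = \<Omega>
  let ?k = "\<lambda>w x y. ennreal (\<bar>w x - w y\<bar>\<^sup>2 / norm (x - y) powr (real DIM('a) + 2 * s)) * indicator \<Omega> y"
  have pt: "?k (\<lambda>x. u x - v x) x y + 4 * ?k (\<lambda>x. (u x + v x) / 2) x y = 2 * ?k u x y + 2 * ?k v x y" for x y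
  proof -
    have id: "\<bar>(u x - v x) - (u y - v y)\<bar>\<^sup>2 + 4 * \<bar>(u x + v x) / 2 - (u y + v y) / 2\<bar>\<^sup>2 = 2 * \<bar>u x - u y\<bar>\<^sup>2 + 2 * \<bar>v x - v y\<bar>\<^sup>2"
      by (simp add: power2_eq_square field_simps)
    have four: "(4::ennreal) = ennreal 4" and two: "(2::ennreal) = ennreal 2" by simp_all
    have "ennreal (a / N) + ennreal 4 * ennreal (b / N) = ennreal 2 * ennreal (c / N) + ennreal 2 * ennreal (d / N)"
      if "a + 4 * b = 2 * c + 2 * d" "a \<ge> 0" "b \<ge> 0" "c \<ge> 0" "d \<ge> 0" "N \<ge> 0" for a b c d N :: real
    proof -
      have "a / N + 4 * (b / N) = 2 * (c / N) + 2 * (d / N)"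
        using that(1) by (metis add_divide_distrib times_divide_eq_right)
      then show ?thesis
        using that by (simp add: ennreal_mult'[symmetric] ennreal_plus[symmetric] del: ennreal_plus ennreal_numeral)
    qed
    from this[OF id, of "norm (x - y) powr (real DIM('a) + 2 * s)"]
    show ?thesis unfolding four two by (cases "y \<in> \<Omega>") auto
  qed
  let ?I = "\<lambda>w. (\<integral>\<^sup>+x. (\<integral>\<^sup>+y. ?k w x y \<partial>lborel) * indicator \<Omega> x \<partial>lborel)"
  have "?I (\<lambda>x. u x - v x) + 4 * ?I (\<lambda>x. (u x + v x) / 2)
      = (\<integral>\<^sup>+x. (\<integral>\<^sup>+y. ?k (\<lambda>x. u x - v x) x y + 4 * ?k (\<lambda>x. (u x + v x) / 2) x y \<partial>lborel) * indicator \<Omega> x \<partial>lborel)"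
    by (simp add: nn_integral_add nn_integral_cmult distrib_right mult.assoc)
  also have "\<dots> = 2 * ?I u + 2 * ?I v"
    unfolding pt by (simp add: nn_integral_add nn_integral_cmult distrib_right mult.assoc)
  finally show ?thesis
    unfolding gagliardo_lborel[OF \<Omega>] .
qed

text \<open>Once \<open>v i\<close> is 1 at both points, the increment of u - \<open>v i\<close> is
  that of u, because the constant 1 has no increments; Fatou's lemma in each variable does the
  rest.\<close>

lemma gagliardo_liminf:
  fixes u :: "'a::euclidean_space \<Rightarrow> real" and v :: "nat \<Rightarrow> 'a \<Rightarrow> real"
  assumes \<Omega>: "\<Omega> \<in> sets borel" and u[measurable]: "u \<in> borel_measurable borel" and v[measurable]: "\<And>i. v i \<in> borel_measurable borel"
    and ev: "\<And>x. x \<in> \<Omega> \<Longrightarrow> \<forall>\<^sub>F i in sequentially. v i x = 1"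
  shows "gagliardo_integral s \<Omega> u \<le> liminf (\<lambda>i. gagliardo_integral s \<Omega> (\<lambda>x. u x - v i x))"
proof -
  note [measurable] = \<Omega>
  let ?k = "\<lambda>w x y. ennreal (\<bar>w x - w y\<bar>\<^sup>2 / norm (x - y) powr (real DIM('a) + 2 * s)) * indicator \<Omega> y * indicator \<Omega> x"
  have G: "gagliardo_integral s \<Omega> w = (\<integral>\<^sup>+x. (\<integral>\<^sup>+y. ?k w x y \<partial>lborel) \<partial>lborel)" if [measurable]: "w \<in> borel_measurable borel" for w
    unfolding gagliardo_lborel[OF \<Omega>] by (simp add: nn_integral_multc)
  have lim: "liminf (\<lambda>i. ?k (\<lambda>x. u x - v i x) x y) = ?k u x y" for x y
  proof (cases "x \<in> \<Omega> \<and> y \<in> \<Omega>")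
    case True
    have "\<forall>\<^sub>F i in sequentially. ?k u x y = ?k (\<lambda>x. u x - v i x) x y"
    proof -
      have "\<forall>\<^sub>F i in sequentially. v i x = 1 \<and> v i y = 1"
        using ev[of x] ev[of y] True by (intro eventually_conj) auto
      then show ?thesis by (rule eventually_mono) simp
    qed
    then have "(\<lambda>i. ?k (\<lambda>x. u x - v i x) x y) \<longlonglongrightarrow> ?k u x y"
      by (rule Lim_transform_eventually[OF tendsto_const])
    then show ?thesis by (rule lim_imp_Liminf[OF sequentially_bot])
  qed (auto simp: Liminf_const)
  have "gagliardo_integral s \<Omega> u = (\<integral>\<^sup>+x. (\<integral>\<^sup>+y. liminf (\<lambda>i. ?k (\<lambda>x. u x - v i x) x y) \<partial>lborel) \<partial>lborel)"
    unfolding lim by (rule G[OF u])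
  also have "\<dots> \<le> (\<integral>\<^sup>+x. liminf (\<lambda>i. (\<integral>\<^sup>+y. ?k (\<lambda>x. u x - v i x) x y \<partial>lborel)) \<partial>lborel)"
    by (intro nn_integral_mono nn_integral_liminf) measurable
  also have "\<dots> \<le> liminf (\<lambda>i. \<integral>\<^sup>+x. (\<integral>\<^sup>+y. ?k (\<lambda>x. u x - v i x) x y \<partial>lborel) \<partial>lborel)"
    by (intro nn_integral_liminf) measurable
  also have "\<dots> = liminf (\<lambda>i. gagliardo_integral s \<Omega> (\<lambda>x. u x - v i x))"
    by (subst G) auto
  finally show ?thesis .
qed

section \<open>Convex sets of test functions close to 1\<close>

text \<open>Convex sets that decrease with j. The summand 2 gives |x| \<le> 1/2 already for j = 0,
  which keeps the L^2 norm at least 1.\<close>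

definition near_one :: "nat \<Rightarrow> (real \<Rightarrow> real) set" where
  "near_one j = {u \<in> test_functions {-1<..<1}. \<forall>x. \<bar>x\<bar> \<le> 1 - 1 / (real j + 2) \<longrightarrow> u x = 1}"

lemma near_one_mono: "i \<le> j \<Longrightarrow> near_one j \<subseteq> near_one i"
proof -
  assume "i \<le> j"
  then have "1 / (real j + 2) \<le> 1 / (real i + 2)"
    by (intro divide_left_mono) auto
  then show ?thesis by (force simp: near_one_def)
qed

lemma near_one_midpoint:
  assumes "u \<in> near_one j" "v \<in> near_one j"
  shows "(\<lambda>x. (u x + v x) / 2) \<in> near_one j"
proof -
  have uv: "u \<in> test_functions {-1<..<1}" "v \<in> test_functions {-1<..<1}"
    using assms by (auto simp: near_one_def)
  obtain K where K: "compact K" "K \<subseteq> {-1<..<1}" "\<And>x. x \<notin> K \<Longrightarrow> u x = 0"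
    using test_functionsE[OF uv(1)] by blast
  obtain K' where K': "compact K'" "K' \<subseteq> {-1<..<1}" "\<And>x. x \<notin> K' \<Longrightarrow> v x = 0"
    using test_functionsE[OF uv(2)] by blast
  have "(\<lambda>x. (u x + v x) / 2) \<in> test_functions {-1<..<1}"
  proof (rule test_functionsI)
    show "C_diff m (\<lambda>x. (u x + v x) / 2)" for m
      using C_diff_cmult[OF C_diff_add[OF uv[THEN test_functions_smooth]], of m "1/2"] by simp
    show "compact (K \<union> K')" using K K' by blast
    show "K \<union> K' \<subseteq> {-1<..<1}" using K K' by blast
    show "(u x + v x) / 2 = 0" if "x \<notin> K \<union> K'" for x
      using that K K' by simp
  qed
  then show ?thesis using assms by (simp add: near_one_def)
qed

text \<open>A Mazur-type argument: the infima of the energy over the convex sets \<open>near_one j\<close> increase to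
  a finite limit; by the parallelogram law, almost minimisers form a Cauchy sequence for the energy,
  and since they tend pointwise to the constant 1, which has no energy, the limit is 0.\<close>

lemma near_one_small_energy:
  assumes s: "0 < s" "s \<le> 1/2" and \<epsilon>: "\<epsilon> > 0"
  shows "\<exists>u\<in>near_one 0. enn2real (gagliardo_integral s {-1<..<1} u) < \<epsilon>"
proof (rule ccontr)
  assume contra: "\<not> ?thesis"
  let ?G = "gagliardo_integral s {-1<..<1::real}"
  define Q where "Q u = enn2real (?G u)" for u
  have test: "u \<in> test_functions {-1<..<1}" if "u \<in> near_one j" for u j
    using that by (simp add: near_one_def)
  have s1: "s < 1" using s by simp
  have fin: "?G u < \<infinity>" if "u \<in> near_one j" for u j
    using sobolev_spaceD(3)[OF test_function_interval_sobolev[OF s(1) s1 test[OF that]]] .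
  have GQ: "?G u = ennreal (Q u)" if "u \<in> near_one j" for u j
    using fin[OF that] by (simp add: Q_def)
  have Q0: "Q u \<ge> 0" for u by (simp add: Q_def)
  have low: "\<epsilon> \<le> Q u" if "u \<in> near_one j" for u j
    using contra near_one_mono[of 0 j] that by (force simp: Q_def not_less)
  obtain B where B: "\<And>d. 0 < d \<Longrightarrow> d \<le> 1/4 \<Longrightarrow> ?G (cutoff d) \<le> ennreal B"
    using gagliardo_cutoff_bounded[OF s] by blast
  \<comment> \<open>Twice the parameter of this cutoff is 1/(j + 2), and the parameter is at most
    1/4, as the uniform energy bound requires.\<close>
  have cut: "cutoff (1 / (2 * (real j + 2))) \<in> near_one j" for j
  proof -
    have d: "1 / (2 * (real j + 2)) > 0" "1 - 1 / (real j + 2) = 1 - 2 * (1 / (2 * (real j + 2)))"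
      by (simp_all add: field_simps)
    show ?thesis
      unfolding near_one_def d(2) using cutoff_test_function[OF d(1)] cutoff_eq_1[OF d(1)] by blast
  qed
  have QB: "Q (cutoff (1 / (2 * (real j + 2)))) \<le> max B 0" for j
  proof -
    have "?G (cutoff (1 / (2 * (real j + 2)))) \<le> ennreal B"
      by (rule B) (auto simp: field_simps)
    also have "\<dots> \<le> ennreal (max B 0)" by (rule ennreal_leI) simp
    finally have "enn2real (?G (cutoff (1 / (2 * (real j + 2))))) \<le> enn2real (ennreal (max B 0))"
      by (rule enn2real_mono) simp
    also have "\<dots> = max B 0" by (rule enn2real_ennreal) simp
    finally show ?thesis by (simp only: Q_def)
  qed
  define m where "m j = Inf (Q ` near_one j)" for j
  have bdd: "bdd_below (Q ` near_one j)" for j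
    using Q0 by (intro bdd_belowI[of _ 0]) auto
  have m_le: "m j \<le> Q u" if "u \<in> near_one j" for j u
    unfolding m_def by (rule cInf_lower[OF _ bdd]) (use that in auto)
  have ne: "Q ` near_one j \<noteq> {}" for j
    using cut by blast
  have m_low: "\<epsilon> \<le> m j" for j
    unfolding m_def by (rule cInf_greatest[OF ne]) (use low in auto)
  have m_up: "m j \<le> max B 0" for j
    using m_le[OF cut] QB by (rule order_trans)
  have m_mono: "m i \<le> m j" if "i \<le> j" for i j
    unfolding m_def using near_one_mono[OF that] by (intro cInf_superset_mono ne bdd image_mono)
  have "incseq m" using m_mono by (auto simp: incseq_def)
  then obtain l where l: "m \<longlonglongrightarrow> l" "\<And>j. m j \<le> l"
    using incseq_convergent[of m "max B 0"] m_up by auto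
  have "\<exists>u\<in>near_one j. Q u < m j + 1 / (real j + 1)" for j
    using cInf_lessD[OF ne, of j "m j + 1 / (real j + 1)"] by (auto simp: m_def)
  then obtain u where u: "\<And>j. u j \<in> near_one j" "\<And>j. Q (u j) < m j + 1 / (real j + 1)"
    by metis
  have ub: "u j \<in> borel_measurable borel" for j
    by (rule test_functions_borel[OF test[OF u(1)]])
  \<comment> \<open>The midpoint has energy at least \<open>m j\<close>, so the parallelogram law
    leaves 2 \<open>m j\<close> + 2 \<open>m i\<close> - 4 \<open>m j\<close> plus the errors of the
    almost minimisers, and \<open>m i\<close> \<le> l.\<close>
  have cauchy: "?G (\<lambda>x. u j x - u i x) \<le> ennreal (2 * l - 2 * m j + 4 / (real j + 1))" if ij: "j \<le> i" for i j
  proof -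
    have ui: "u i \<in> near_one j" using near_one_mono[OF ij] u(1) by blast
    let ?w = "\<lambda>x. (u j x + u i x) / 2"
    have w: "?w \<in> near_one j" by (rule near_one_midpoint[OF u(1) ui])
    have par: "?G (\<lambda>x. u j x - u i x) + 4 * ?G ?w = 2 * ?G (u j) + 2 * ?G (u i)"
      by (rule gagliardo_parallelogram[OF _ ub ub]) simp
    have "?G (\<lambda>x. u j x - u i x) \<le> 2 * ?G (u j) + 2 * ?G (u i)"
      unfolding par[symmetric] by simp
    also have "\<dots> < \<infinity>" using fin[OF u(1)] by (auto simp: ennreal_mult_less_top)
    finally have D: "?G (\<lambda>x. u j x - u i x) = ennreal (Q (\<lambda>x. u j x - u i x))"
      by (simp add: Q_def)
    have "ennreal (Q (\<lambda>x. u j x - u i x) + 4 * Q ?w) = ennreal (2 * Q (u j) + 2 * Q (u i))"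
      using par unfolding D GQ[OF w] GQ[OF u(1)]
      by (simp add: Q0 ennreal_plus ennreal_mult' )
    then have "Q (\<lambda>x. u j x - u i x) + 4 * Q ?w = 2 * Q (u j) + 2 * Q (u i)"
      by (simp add: Q0 del: ennreal_plus)
    moreover have "1 / (real i + 1) \<le> 1 / (real j + 1)"
      using ij by (intro divide_left_mono) auto
    ultimately have "Q (\<lambda>x. u j x - u i x) \<le> 2 * l - 2 * m j + 4 * (1 / (real j + 1))"
      using u(2)[of j] u(2)[of i] m_le[OF w] l(2)[of i] by linarith
    then show ?thesis unfolding D by (intro ennreal_leI) simp
  qed
  \<comment> \<open>As i grows, \<open>u i\<close> tends to 1, and the bound for the energy of
    \<open>u j\<close> - \<open>u i\<close> becomes one for the energy of \<open>u j\<close>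
    itself.\<close>
  have Qu: "m j \<le> 2 * l - 2 * m j + 4 / (real j + 1)" for j
  proof -
    have ev: "\<forall>\<^sub>F i in sequentially. u i x = 1" if "x \<in> {-1<..<1}" for x
    proof -
      obtain n where n: "1 / (1 - \<bar>x\<bar>) < real n" using reals_Archimedean2 by blast
      have "u i x = 1" if "i \<ge> n" for i
      proof -
        have pos: "1 - \<bar>x\<bar> > 0" using \<open>x \<in> {-1<..<1}\<close> by auto
        have "1 / (1 - \<bar>x\<bar>) \<le> real i + 2" using n that by simp
        then have "1 \<le> (real i + 2) * (1 - \<bar>x\<bar>)" using pos by (simp add: pos_divide_le_eq)
        then have "1 / (real i + 2) \<le> 1 - \<bar>x\<bar>" by (simp add: pos_divide_le_eq mult.commute)
        then show ?thesis using u(1)[of i] by (simp add: near_one_def)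
      qed
      then show ?thesis by (auto simp: eventually_sequentially)
    qed
    have "?G (u j) \<le> liminf (\<lambda>i. ?G (\<lambda>x. u j x - u i x))"
      by (rule gagliardo_liminf[OF _ ub ub ev]) auto
    also have "\<dots> \<le> limsup (\<lambda>i. ?G (\<lambda>x. u j x - u i x))"
      by (rule Liminf_le_Limsup) simp
    also have "\<dots> \<le> ennreal (2 * l - 2 * m j + 4 / (real j + 1))"
      by (rule Limsup_bounded) (use cauchy in \<open>auto simp: eventually_sequentially\<close>)
    finally have "Q (u j) \<le> 2 * l - 2 * m j + 4 / (real j + 1)"
      unfolding GQ[OF u(1)] using l(2)[of j] by (subst (asm) ennreal_le_iff) auto
    then show ?thesis using m_le[OF u(1)] by (rule order_trans[rotated])
  qed
  have "(\<lambda>j. 1 / (real j + 1)) \<longlonglongrightarrow> 0"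
    using LIMSEQ_inverse_real_of_nat by (simp add: inverse_eq_divide add.commute)
  then have "(\<lambda>j. 2 * l - 2 * m j + 4 * (1 / (real j + 1))) \<longlonglongrightarrow> 2 * l - 2 * l + 4 * 0"
    by (intro tendsto_intros l(1))
  \<comment> \<open>As j tends to infinity the infima tend to l and the bound to 0, against
    \<open>m 0\<close> \<ge> \<epsilon>.\<close>
  then have "l \<le> 2 * l - 2 * l + 4 * 0"
    by (rule LIMSEQ_le[OF l(1)]) (use Qu in auto)
  then show False using m_low[of 0] l(2)[of 0] \<epsilon> by simp
qed

section \<open>Comparison and values of the constants\<close>

text \<open>Guarantees that the infimum on the interval runs over a nonempty set.\<close>

lemma interval_test_function_nonzero:
  assumes s: "0 < s" "s < 1"
  shows "\<exists>\<phi>\<in>test_functions {-1<..<1::real} \<inter> sobolev_space s {-1<..<1}. \<not> (AE x in lebesgue_on {-1<..<1}. \<phi> x = 0)"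
proof -
  have \<phi>: "cutoff (1/4) \<in> test_functions {-1<..<1}"
    by (rule cutoff_test_function) simp
  have "L2_sq {-1<..<1} (cutoff (1/4)) \<ge> 1"
    by (rule L2_ge_1[OF \<phi>]) (simp add: cutoff_eq_1)
  then have "\<not> (AE x in lebesgue_on {-1<..<1}. cutoff (1/4) x = 0)"
    by (intro not_AE_zero_if_L2_pos) simp
  with \<phi> test_function_interval_sobolev[OF s \<phi>] show ?thesis by blast
qed

text \<open>If every test function on the strip in the Sobolev space vanished almost everywhere, the
  comparison of energies would hold there with any constant, hence also on the interval.\<close>

lemma strip_test_function_nonzero:
  fixes e :: "'a::euclidean_space"
  assumes s: "0 < s" "s < 1" and e: "e \<in> Basis"
  shows "\<exists>u\<in>test_functions (strip_along e) \<inter> sobolev_space s (strip_along e). \<not> (AE x in lebesgue_on (strip_along e). u x = 0)"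
proof (rule ccontr)
  assume "\<not> ?thesis"
  then have zero: "L2_sq (strip_along e) u = 0"
    if "u \<in> test_functions (strip_along e) \<inter> sobolev_space s (strip_along e)" for u
    using that by (intro integral_eq_zero_AE) (auto elim: eventually_mono)
  have \<phi>: "cutoff (1/4) \<in> test_functions {-1<..<1}"
    by (rule cutoff_test_function) simp
  let ?S = "(frac_seminorm s {-1<..<1} (cutoff (1/4)))\<^sup>2"
  have N: "1 \<le> L2_sq {-1<..<1} (cutoff (1/4))"
    by (rule L2_ge_1[OF \<phi>]) (simp add: cutoff_eq_1)
  \<comment> \<open>Under the assumption every constant is admissible on the strip; the energy plus
    1 is too large for a function with L^2 norm at least 1.\<close>
  have "(?S + 1) * L2_sq {-1<..<1} (cutoff (1/4)) \<le> ?S"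
    by (rule poincare_strip_to_interval[OF s _ e \<phi>]) (auto simp: zero)
  moreover have "(?S + 1) * 1 \<le> (?S + 1) * L2_sq {-1<..<1} (cutoff (1/4))"
    using N by (rule mult_left_mono) simp
  ultimately show False by simp
qed

text \<open>Each constant is inserted as the lower bound c in the characterisation of the other one,
  so that the two transfer results give the two inequalities.\<close>

lemma poincare_const_strip_along:
  fixes e :: "'a::euclidean_space"
  assumes s: "0 < s" "s < 1" and e: "e \<in> Basis"
  shows "poincare_const s (strip_along e) = poincare_const s {-1<..<1::real}"
proof -
  note iff1 = le_poincare_const_iff[OF s borel_unit_interval _ interval_test_function_nonzero[OF s]]
  note iff2 = le_poincare_const_iff[OF s borel_strip_along _ strip_test_function_nonzero[OF s e]]
  \<comment> \<open>The characterisation with c = 0, where every tested inequality is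
    trivial.\<close>
  have nn: "0 \<le> poincare_const s {-1<..<1::real}" "0 \<le> poincare_const s (strip_along e)"
    using iff1[of 0] iff2[of 0] by auto
  show ?thesis
  proof (rule antisym)
    show "poincare_const s (strip_along e) \<le> poincare_const s {-1<..<1::real}"
      using iff2[OF nn(2)] unfolding iff1[OF nn(2)]
      by (intro ballI poincare_strip_to_interval[OF s nn(2) e]) auto
    show "poincare_const s {-1<..<1::real} \<le> poincare_const s (strip_along e)"
      unfolding iff2[OF nn(1)]
    proof
      fix u assume uW: "u \<in> test_functions (strip_along e) \<inter> sobolev_space s (strip_along e)"
      interpret strip_test_function e u
        using e uW by unfold_locales auto
      show "poincare_const s {-1<..<1::real} * L2_sq (strip_along e) u
          \<le> (frac_seminorm s (strip_along e) u)\<^sup>2"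
        using iff1[OF nn(1)] by (intro poincare_interval_to_strip[OF s nn(1) IntD2[OF uW]]) auto
    qed
  qed
qed

lemma poincare_const_interval_pos:
  assumes s: "1/2 < s" "s < 1"
  shows "poincare_const s {-1<..<1::real} > 0"
proof -
  have s0: "0 < s" using s by simp
  obtain c where c: "c > 0" "\<And>\<phi>. \<phi> \<in> test_functions {-1<..<1::real} \<Longrightarrow>
    c * L2_sq {-1<..<1} \<phi> \<le> (frac_seminorm s {-1<..<1} \<phi>)\<^sup>2"
    using interval_poincare[OF s] by blast
  have "c \<le> poincare_const s {-1<..<1::real}"
    using c by (subst le_poincare_const_iff[OF s0 s(2) _ _ interval_test_function_nonzero[OF s0 s(2)]]) auto
  with c(1) show ?thesis by simp
qed

text \<open>\<open>near_one 0\<close> contains functions of arbitrarily small energy, whereas their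
  L^2 norm stays at least 1.\<close>

lemma poincare_const_interval_zero:
  assumes s: "0 < s" "s \<le> 1/2"
  shows "poincare_const s {-1<..<1::real} = 0"
proof -
  have s1: "s < 1" using s by simp
  note iff = le_poincare_const_iff[OF s(1) s1 borel_unit_interval _ interval_test_function_nonzero[OF s(1) s1]]
  let ?p = "poincare_const s {-1<..<1::real}" and ?c = "frac_const 1 s / 2"
  have nn: "0 \<le> ?p" using iff[of 0] by auto
  have c: "?c > 0" using frac_const_pos[OF s(1) s1, of 1] by simp
  have "?p \<le> \<epsilon>" if \<epsilon>: "\<epsilon> > 0" for \<epsilon>
  proof -
    obtain u where u: "u \<in> near_one 0" "enn2real (gagliardo_integral s {-1<..<1} u) < \<epsilon> / ?c"
      using near_one_small_energy[OF s, of "\<epsilon> / ?c"] \<epsilon> c by auto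
    have ut: "u \<in> test_functions {-1<..<1}" and u1: "\<And>x. \<bar>x\<bar> \<le> 1/2 \<Longrightarrow> u x = 1"
      using u(1) by (auto simp: near_one_def)
    have "?p * 1 \<le> ?p * L2_sq {-1<..<1} u"
      using L2_ge_1[OF ut u1] nn by (rule mult_left_mono)
    also have "\<dots> \<le> (frac_seminorm s {-1<..<1} u)\<^sup>2"
      using iff[OF nn] ut test_function_interval_sobolev[OF s(1) s1 ut] by auto
    also have "\<dots> = ?c * enn2real (gagliardo_integral s {-1<..<1} u)"
      by (simp add: frac_seminorm_sq[OF s(1) s1])
    also have "\<dots> \<le> ?c * (\<epsilon> / ?c)"
      using u(2) c by (intro mult_left_mono) auto
    also have "\<dots> = \<epsilon>" using c by simp
    finally show ?thesis by simp
  qed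
  then have "?p \<le> 0" by (rule field_le_epsilon[of ?p 0]) simp
  with nn show ?thesis by simp
qed

lemma strip_eq_strip_along: "strip k = strip_along (axis k 1)"
  by (auto simp: strip_def strip_along_def inner_axis)

theorem theorem1p1:
  fixes s :: real and k :: "'n::finite"
  assumes "0 < s" and "s < 1"
  shows "(s \<le> 1/2 \<longrightarrow>
            poincare_const s (strip k) = poincare_const s {-1<..<1::real} \<and>
            poincare_const s {-1<..<1::real} = 0) \<and>
         (1/2 < s \<longrightarrow>
            poincare_const s (strip k) > 0 \<and>
            poincare_const s (strip k) = poincare_const s {-1<..<1::real})"
proof -
  have "axis k (1::real) \<in> Basis"
    by (rule axis_in_Basis_iff[THEN iffD2]) simp
  then have eq: "poincare_const s (strip k) = poincare_const s {-1<..<1::real}"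
    unfolding strip_eq_strip_along by (rule poincare_const_strip_along[OF assms])
  show ?thesis
    unfolding eq using poincare_const_interval_zero poincare_const_interval_pos assms by auto
qed

end
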